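(* Let $p$ be a prime, $q=p^f$ with $f\ge 1$, and if $p=2$ assume $f\ge 3$. Let $c,c'\in\mathbb{Z}/(q-1)\mathbb{Z}$ and let $\chi=\omega^{-c}$ and $\chi'=\omega^{-c'}$, where $\omega$ is the Teichmüller character. Then $G(\chi)=G(\chi')$ if and only if both of the following conditions hold: (i) $s_q(uc)=s_q(uc')$ for all $u\in(\mathbb{Z}/(q-1)\mathbb{Z})^\times$; and (ii) $\nu_q(c)\equiv\nu_q(c')\pmod p$ if $p$ is odd, and $\beta_q(c)\equiv\beta_q(c')\pmod 2$ if $p=2$ (and $f\ge 3$).
   Context: Let $\mu_n$ denote the group of $n$-th roots of unity. Fix a generator $\zeta_p$ of $\mu_p$ and the additive character $\psi:\mathbb{F}_q\to\mu_p$, $\psi(a)=\zeta_p^{\operatorname{Tr}(a)}$, where $\operatorname{Tr}:\mathbb{F}_q\to\mathbb{F}_p$ is the trace. The Gauss sum of a multiplicative character $\chi:\mathbb{F}_q^\times\to\mu_{q-1}$ is $G(\chi)=\sum_{a\in\mathbb{F}_q^\times}\chi(a)\psi(a)\in\mathbb{Z}[\mu_{q-1},\mu_p]$. Let $L=\mathbb{Q}(\mu_{p(q-1)})$ with ring of integers $\mathcal{O}_L$, choose a prime $\mathfrak{p}$ of $\mathcal{O}_L$ over $p$ and identify $\mathcal{O}_L/\mathfrak{p}$ with $\mathbb{F}_q$. The Teichmüller character $\omega:\mathbb{F}_q^\times\to\mu_{q-1}$ sends $a$ to the unique element of $\mu_{q-1}$ congruent to $a$ modulo $\mathfrak{p}$;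 it generates the group of multiplicative characters of $\mathbb{F}_q^\times$. For a class $\bar a\in\mathbb{Z}/(q-1)\mathbb{Z}$, let $a$ be its representative with $0\le a\le q-2$ and write $a=a_0+a_1p+\dots+a_{f-1}p^{f-1}$ with $0\le a_j\le p-1$. Define $s_q(\bar a)=\sum_{j=0}^{f-1}a_j$; if $p$ is odd, $\nu_q(\bar a)=(a_0!)(a_1!)\cdots(a_{f-1}!)$; if $p=2$, $\beta_q(\bar a)=a_0a_1+a_1a_2+\dots+a_{f-2}a_{f-1}+a_{f-1}a_0$. *)

theory Defs
  imports
    Complex_Main
    "HOL-Computational_Algebra.Polynomial"
    "HOL-Number_Theory.Residues"
    "HOL-Algebra.Algebra"
    "HOL-Algebra.Algebraic_Closure_Type"
begin

definition unity_roots :: "nat \<Rightarrow> complex set" where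
  "unity_roots n = {z. z ^ n = 1}"

definition cyclotomic :: "nat \<Rightarrow> complex set" where
  "cyclotomic n = generate_field (ring_of_type_algebra :: complex ring) (unity_roots n)"

definition ring_of_integers :: "complex set \<Rightarrow> complex ring" where
  "ring_of_integers L = ring_of_type_algebra\<lparr>carrier := {x \<in> L. algebraic_int x}\<rparr>"

definition prime_over :: "complex ring \<Rightarrow> nat \<Rightarrow> complex set \<Rightarrow> bool" where
  "prime_over OL p P \<longleftrightarrow> primeideal P OL \<and> P \<inter> \<int> = {of_int k | k. int p dvd k}"

text \<open>The trace from the field \<open>F\<close> of order \<open>p ^ f\<close> to its prime subfield, as the sum of
  the conjugates under the Frobenius automorphism.\<close>

definition field_trace :: "('a, 'b) ring_scheme \<Rightarrow> nat \<Rightarrow> nat \<Rightarrow> 'a \<Rightarrow> 'a" where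
  "field_trace F p f a = (\<Oplus>\<^bsub>F\<^esub>i\<in>{..<f}. a [^]\<^bsub>F\<^esub> (p ^ i))"

text \<open>The exponent of \<open>\<zeta>\<close> is the representative in \<open>{0..<p}\<close> of the trace, under the
  identification of the prime subfield \<open>{[n] \<cdot>\<^bsub>F\<^esub> \<one>\<^bsub>F\<^esub> | n. n < p}\<close>
  with the integers modulo \<open>p\<close>.\<close>

definition additive_char ::
    "('a, 'b) ring_scheme \<Rightarrow> nat \<Rightarrow> nat \<Rightarrow> complex \<Rightarrow> 'a \<Rightarrow> complex" where
  "additive_char F p f \<zeta> a =
     \<zeta> ^ (THE n. n < p \<and> [n] \<cdot>\<^bsub>F\<^esub> \<one>\<^bsub>F\<^esub> = field_trace F p f a)"

definition gauss_sum ::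
    "('a, 'b) ring_scheme \<Rightarrow> nat \<Rightarrow> nat \<Rightarrow> complex \<Rightarrow> ('a \<Rightarrow> complex) \<Rightarrow> complex" where
  "gauss_sum F p f \<zeta> \<chi> = (\<Sum>a\<in>Units F. \<chi> a * additive_char F p f \<zeta> a)"

text \<open>Here \<open>\<phi>\<close> is the chosen identification of \<open>OL Quot P\<close> with the field \<open>F\<close> of order \<open>q\<close>,
  so that \<open>\<phi> (P +>\<^bsub>OL\<^esub> z)\<close> is the reduction of \<open>z\<close> modulo \<open>P\<close>.
  Only the values at units of \<open>F\<close> are meaningful.\<close>

definition teichmueller ::
    "complex ring \<Rightarrow> complex set \<Rightarrow> (complex set \<Rightarrow> 'a) \<Rightarrow> nat \<Rightarrow> 'a \<Rightarrow> complex" where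
  "teichmueller OL P \<phi> q a = (THE z. z \<in> unity_roots (q - 1) \<and> \<phi> (P +>\<^bsub>OL\<^esub> z) = a)"

text \<open>The elements of \<^term>\<open>carrier (residue_ring (int q - 1))\<close> are the integers
  \<open>0, \<dots>, q - 2\<close>, so a class is its own canonical representative.\<close>

definition digit :: "nat \<Rightarrow> int \<Rightarrow> nat \<Rightarrow> nat" where
  "digit p a j = (nat a div p ^ j) mod p"

definition digit_sum :: "nat \<Rightarrow> nat \<Rightarrow> int \<Rightarrow> nat" where
  "digit_sum p f a = (\<Sum>j<f. digit p a j)"

definition digit_fact_prod :: "nat \<Rightarrow> nat \<Rightarrow> int \<Rightarrow> nat" where
  "digit_fact_prod p f a = (\<Prod>j<f. fact (digit p a j))"

definition digit_cyclic_corr :: "nat \<Rightarrow> nat \<Rightarrow> int \<Rightarrow> nat" where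
  "digit_cyclic_corr p f a = (\<Sum>j<f. digit p a j * digit p a (Suc j mod f))"

end

(* Identify F with the set T of 0 and the (q-1)-st roots of unity, by reduction modulo P, and write
   G c for the Gauss sum of the (-c)-th power of the Teichmueller character. Running through the
   digits of c with G (p * c) = G c and G 1 * G (c - 1) = J * G c for a Jacobi sum J expresses
   G 1 ^ s(c) as K * G c, where K is prime to P and K = +- nu(c) modulo P (for p = 2, K = +- 1 modulo 4
   with sign (-1) ^ beta(c) up to a factor depending only on s(c)).

   If G c = G c', Galois conjugation gives G (u * c) = G (u * c'), and since G 1 is in P but K is not,
   the digit sums agree; then the K's agree, hence so do nu or beta. Conversely, equality of all digit
   sums gives G c / G c' = K' / K at every conjugate. All conjugates of this quotient have absolute
   value 1, and the traces of its powers are rational and integral at p, so they are integers. By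
   simultaneous Dirichlet approximation the quotient is a root of unity. It is congruent to 1 modulo P,
   so its order is a power of p; for odd p the conjugation that inverts the p-th roots of unity and
   fixes the (q-1)-st ones fixes the quotient, and for p = 2 it is congruent to 1 modulo 4.
   In both cases it equals 1. *)

theory Submission
  imports Defs "HOL-Analysis.Kronecker_Approximation_Theorem"
begin

unbundle no vec_syntax

section \<open>Galois conjugates of cyclotomic integers\<close>

text \<open>The quotient of two Gauss sums is not visibly integral, and \<open>A\<close> is not a
  localization, so nothing can be divided. Instead \<open>M = G c * cnj (G c')\<close> is used,
  which is integral and is \<open>q\<close> times the quotient when \<open>c'\<close> is nonzero;
  statements at \<open>P\<close> carry an explicit multiplier outside \<open>P\<close>. Control at
  the single prime \<open>P\<close> suffices because it is applied to traces: these are rational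
  integers, \<open>P\<close> meets the integers exactly in the multiples of \<open>p\<close>, and
  only powers of \<open>q\<close> occur as denominators. A Galois conjugation is the substitution of
  another root of unity into an integer polynomial. That this is well defined comes from congruences
  modulo large primes, in place of the irreducibility of cyclotomic polynomials. For
  \<open>p = 2\<close> all digit factorials are 1, and 1 and -1 agree modulo \<open>P\<close>, so
  the sign of \<open>K\<close> is invisible there; this forces the modulus 4. The extra precision
  comes from squaring: every element of \<open>mu\<close> is a square, and the square of a quantity
  known modulo 2 is known modulo 4.\<close>

definition ipoly :: "int poly \<Rightarrow> complex \<Rightarrow> complex" where
  "ipoly g x = poly (map_poly of_int g) x"

lemma ipoly_0 [simp]: "ipoly 0 x = 0"
  by (simp add: ipoly_def)

lemma ipoly_pCons [simp]: "ipoly (pCons a g) x = of_int a + x * ipoly g x"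
  by (simp add: ipoly_def map_poly_pCons)

lemma ipoly_1 [simp]: "ipoly 1 x = 1"
  by (simp add: one_pCons)

lemma ipoly_add [simp]: "ipoly (g + h) x = ipoly g x + ipoly h x"
  by (induction g h rule: poly_induct2) (auto simp: algebra_simps)

lemma ipoly_minus [simp]: "ipoly (- g) x = - ipoly g x"
  by (induction g) (auto simp: algebra_simps)

lemma ipoly_smult [simp]: "ipoly (Polynomial.smult a g) x = of_int a * ipoly g x"
  by (induction g) (auto simp: algebra_simps)

lemma ipoly_mult [simp]: "ipoly (g * h) x = ipoly g x * ipoly h x"
  by (induction g) (auto simp: algebra_simps)

lemma ipoly_power [simp]: "ipoly (g ^ k) x = ipoly g x ^ k"
  by (induction k) auto

lemma ipoly_monom [simp]: "ipoly (Polynomial.monom 1 k) x = x ^ k"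
  by (induction k) (auto simp: Polynomial.monom_Suc one_pCons[symmetric])

lemma ipoly_diff [simp]: "ipoly (g - h) x = ipoly g x - ipoly h x"
  using ipoly_add[of g "- h" x] by simp

text \<open>Since \<open>y\<close> is nonzero, powers of the variable can be cancelled from an
  annihilating polynomial. The nonzero constant coefficient is then a multiple of \<open>y\<close>,
  which is what bounds the integers dividing \<open>y\<close>.\<close>

lemma algebraic_int_ipoly_root:
  assumes "algebraic_int y" "y \<noteq> 0"
  obtains g where "ipoly g y = 0" "Polynomial.coeff g 0 \<noteq> 0"
proof -
  obtain h where h: "ipoly h y = 0" "h \<noteq> 0"
    using assms(1) unfolding algebraic_int_altdef_ipoly ipoly_def by (metis Polynomial.coeff_0 zero_neq_one)
  have "\<exists>g. ipoly g y = 0 \<and> Polynomial.coeff g 0 \<noteq> 0"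
    using h
  proof (induction h)
    case (pCons a h)
    show ?case
    proof (cases "a = 0")
      case True
      then show ?thesis using pCons assms(2) by auto
    qed (use pCons in \<open>auto intro!: exI[of _ "pCons a h"]\<close>)
  qed simp
  then show thesis using that by blast
qed

section \<open>Congruences modulo an ideal in a subring of the complex numbers\<close>

locale complex_ideal =
  fixes A I :: "complex set"
  assumes one_closed [simp, intro]: "1 \<in> A"
    and diff_closed [intro]: "x \<in> A \<Longrightarrow> y \<in> A \<Longrightarrow> x - y \<in> A"
    and mult_closed [intro]: "x \<in> A \<Longrightarrow> y \<in> A \<Longrightarrow> x * y \<in> A"
    and ideal_sub: "I \<subseteq> A"
    and ideal_zero [simp]: "0 \<in> I"
    and ideal_diff: "x \<in> I \<Longrightarrow> y \<in> I \<Longrightarrow> x - y \<in> I"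
    and ideal_absorb: "a \<in> A \<Longrightarrow> x \<in> I \<Longrightarrow> a * x \<in> I"
begin

text \<open>Membership of both sides in \<open>A\<close> is built in, so that calculations with
  congruences keep track of integrality by themselves.\<close>

definition cg :: "complex \<Rightarrow> complex \<Rightarrow> bool" where
  "cg x y \<longleftrightarrow> x \<in> A \<and> y \<in> A \<and> x - y \<in> I"

lemma zero_closed [simp, intro]: "0 \<in> A"
  using diff_closed[of 1 1] by simp

lemma minus_closed [intro]: "x \<in> A \<Longrightarrow> - x \<in> A"
  using diff_closed[of 0 x] by simp

lemma add_closed [intro]: "x \<in> A \<Longrightarrow> y \<in> A \<Longrightarrow> x + y \<in> A"
  using diff_closed[of x "- y"] by auto

lemma nat_closed [simp, intro]: "of_nat k \<in> A"
  by (induction k) auto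

lemma int_closed [simp, intro]: "of_int k \<in> A"
  by (cases k) (auto simp del: of_nat_Suc intro!: minus_closed)

lemma numeral_closed [simp, intro]: "numeral k \<in> A"
  using nat_closed[of "numeral k"] by simp

lemma power_closed [intro]: "x \<in> A \<Longrightarrow> x ^ k \<in> A"
  by (induction k) auto

lemma sum_closed [intro]: "(\<And>i. i \<in> S \<Longrightarrow> g i \<in> A) \<Longrightarrow> sum g S \<in> A"
  by (induction S rule: infinite_finite_induct) auto

lemma prod_closed [intro]: "(\<And>i. i \<in> S \<Longrightarrow> g i \<in> A) \<Longrightarrow> prod g S \<in> A"
  by (induction S rule: infinite_finite_induct) auto

lemma ipoly_closed [intro]: "x \<in> A \<Longrightarrow> ipoly g x \<in> A"
  by (induction g) auto

lemma cg_refl [intro]: "x \<in> A \<Longrightarrow> cg x x"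
  by (simp add: cg_def)

lemma cg_sym: "cg x y \<Longrightarrow> cg y x"
  unfolding cg_def using ideal_diff[of 0 "x - y"] by auto

lemma cg_add [intro]: "cg x y \<Longrightarrow> cg u v \<Longrightarrow> cg (x + u) (y + v)"
  unfolding cg_def using ideal_diff[of "x - y" "v - u"] ideal_diff[of 0 "u - v"]
  by (auto simp: algebra_simps)

lemma cg_trans [trans]: "cg x y \<Longrightarrow> cg y z \<Longrightarrow> cg x z"
  using cg_add[of "x" y y z] unfolding cg_def by auto

lemma cg_eq_trans [trans]: "cg x y \<Longrightarrow> y = z \<Longrightarrow> cg x z"
  by simp

lemma eq_cg_trans [trans]: "x = y \<Longrightarrow> cg y z \<Longrightarrow> cg x z"
  by simp

lemma cg_mult [intro]:
  assumes "cg x y" "cg u v"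
  shows "cg (x * u) (y * v)"
proof -
  have "u * (x - y) \<in> I" "(- y) * (u - v) \<in> I"
    using assms unfolding cg_def by (blast intro: ideal_absorb minus_closed)+
  from ideal_diff[OF this] have "x * u - y * v \<in> I"
    by (simp add: algebra_simps)
  then show ?thesis using assms by (auto simp: cg_def)
qed

lemma cg_minus [intro]: "cg x y \<Longrightarrow> cg (- x) (- y)"
  using cg_mult[of "-1" "-1" x y] cg_refl[of "-1"] minus_closed[of 1] by simp

lemma cg_diff [intro]: "cg x y \<Longrightarrow> cg u v \<Longrightarrow> cg (x - u) (y - v)"
  using cg_add[of x y "- u" "- v"] by auto

lemma cg_power [intro]: "cg x y \<Longrightarrow> cg (x ^ k) (y ^ k)"
  by (induction k) auto

lemma cg_sum [intro]: "(\<And>i. i \<in> S \<Longrightarrow> cg (g i) (h i)) \<Longrightarrow> cg (sum g S) (sum h S)"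
  by (induction S rule: infinite_finite_induct) auto

lemma cg_0_iff: "cg x 0 \<longleftrightarrow> x \<in> I"
  using ideal_sub by (auto simp: cg_def)

lemma cg_closed: "cg x y \<Longrightarrow> x \<in> A" "cg x y \<Longrightarrow> y \<in> A"
  by (auto simp: cg_def)

text \<open>The inner binomial coefficients of exponent \<open>l\<close> are multiples of
  \<open>l\<close>. Any ideal containing \<open>l\<close> is allowed, since three kinds occur:
  \<open>P\<close> for the Frobenius of the residue field, the multiples of a large prime for Galois
  conjugation, and the multiples of 2 for the refinement modulo 4.\<close>

lemma cg_prime_power_add:
  assumes "Factorial_Ring.prime l" "of_nat l \<in> I" "x \<in> A" "y \<in> A"
  shows "cg ((x + y) ^ (l ^ k)) (x ^ (l ^ k) + y ^ (l ^ k))"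
proof (induction k)
  case 0
  then show ?case using assms by auto
next
  case (Suc k)
  have step: "cg ((u + v) ^ l) (u ^ l + v ^ l)" if uv: "u \<in> A" "v \<in> A" for u v
  proof -
    have l: "l > 1" using assms(1) prime_gt_1_nat by blast
    have split: "{..l} = insert 0 (insert l {1..<l})" using l by auto
    have "cg (\<Sum>i\<in>{1..<l}. of_nat (l choose i) * u ^ i * v ^ (l - i)) (\<Sum>i\<in>{1..<l}. 0)"
    proof (rule cg_sum)
      fix i assume i: "i \<in> {1..<l}"
      then have "l dvd (l choose i)"
        using assms(1) by (intro dvd_choose_prime) auto
      then obtain m where m: "l choose i = l * m" by blast
      have "(of_nat m * u ^ i * v ^ (l - i)) * of_nat l \<in> I"
        using uv assms by (intro ideal_absorb) auto
      then show "cg (of_nat (l choose i) * u ^ i * v ^ (l - i)) 0"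
        unfolding cg_0_iff m by (simp add: mult_ac)
    qed
    then have "cg (v ^ l + (u ^ l + (\<Sum>i\<in>{1..<l}. of_nat (l choose i) * u ^ i * v ^ (l - i))))
       (v ^ l + (u ^ l + (\<Sum>i\<in>{1..<l}. 0)))"
      using uv by blast
    moreover have "(u + v) ^ l = v ^ l + (u ^ l + (\<Sum>i\<in>{1..<l}. of_nat (l choose i) * u ^ i * v ^ (l - i)))"
      unfolding binomial_ring split using l by (simp add: add_ac)
    ultimately show ?thesis by (simp add: add_ac)
  qed
  have "cg (((x + y) ^ (l ^ k)) ^ l) ((x ^ (l ^ k) + y ^ (l ^ k)) ^ l)"
    using Suc by blast
  also have "cg \<dots> ((x ^ (l ^ k)) ^ l + (y ^ (l ^ k)) ^ l)"
    using assms by (intro step) auto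
  finally show ?case by (simp add: power_mult[symmetric] mult_ac)
qed

lemma cg_int_power:
  assumes "Factorial_Ring.prime l" "of_nat l \<in> I"
  shows "cg (of_int k ^ (l ^ j)) (of_int k)"
proof (induction j)
  case 0
  then show ?case by auto
next
  case (Suc j)
  have n: "cg (of_nat m ^ l) (of_nat m)" for m
  proof (induction m)
    case 0
    then show ?case using assms(1) prime_gt_0_nat[of l] by (simp add: zero_power cg_0_iff)
  next
    case (Suc m)
    have "cg ((of_nat m + 1) ^ (l ^ 1)) (of_nat m ^ (l ^ 1) + 1 ^ (l ^ 1))"
      using assms by (intro cg_prime_power_add) auto
    also have "cg \<dots> (of_nat m + 1)" using Suc by auto
    finally show ?case by (simp add: add_ac)
  qed
  have l0: "cg (of_nat l) 0" using assms by (simp add: cg_0_iff)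
  define m where "m = nat (k mod int l)"
  have m: "k = int m + int l * (k div int l)"
    using prime_gt_0_nat[OF assms(1)] by (simp add: m_def)
  have "cg (of_nat m + of_nat l * of_int (k div int l)) (of_nat m + 0 * of_int (k div int l))"
    using l0 by blast
  then have km: "cg (of_int k) (of_nat m)"
    by (subst m) simp
  have "cg ((of_int k ^ (l ^ j)) ^ l) (of_int k ^ l)" using Suc by blast
  also have "cg \<dots> (of_nat m ^ l)" using km by blast
  also have "cg \<dots> (of_nat m)" by (rule n)
  also have "cg \<dots> (of_int k)" using km cg_sym by blast
  finally show ?case by (simp add: power_mult[symmetric] mult_ac)
qed

text \<open>The Frobenius is additive, and it fixes the integer coefficients by Fermat's little
  theorem, so it acts only on the argument.\<close>

lemma cg_ipoly_power:
  assumes "Factorial_Ring.prime l" "of_nat l \<in> I" "x \<in> A"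
  shows "cg (ipoly g x ^ (l ^ k)) (ipoly g (x ^ (l ^ k)))"
proof (induction g)
  case 0
  have "(0::nat) < l ^ k" using prime_gt_0_nat[OF assms(1)] by simp
  then show ?case by (simp add: zero_power cg_0_iff)
next
  case (pCons a g)
  have "cg ((of_int a + x * ipoly g x) ^ (l ^ k)) (of_int a ^ (l ^ k) + (x * ipoly g x) ^ (l ^ k))"
    using assms by (intro cg_prime_power_add) auto
  also have "cg \<dots> (of_int a + x ^ (l ^ k) * ipoly g (x ^ (l ^ k)))"
    unfolding power_mult_distrib using assms pCons cg_int_power by auto
  finally show ?case by simp
qed

end

section \<open>Substituting coprime powers of a root of unity\<close>

locale integer_ring =
  fixes A :: "complex set"
  assumes one_mem: "1 \<in> A"
    and diff_mem: "x \<in> A \<Longrightarrow> y \<in> A \<Longrightarrow> x - y \<in> A"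
    and mult_mem: "x \<in> A \<Longrightarrow> y \<in> A \<Longrightarrow> x * y \<in> A"
    and integral: "x \<in> A \<Longrightarrow> algebraic_int x"
begin

lemma principal_ideal:
  assumes "a \<in> A"
  shows "complex_ideal A ((*) a ` A)"
proof
  show "0 \<in> (*) a ` A"
    by (metis (no_types, lifting) diff_mem diff_self image_iff mult_zero_right one_mem)
next
  fix x y assume "x \<in> (*) a ` A" "y \<in> (*) a ` A"
  then show "x - y \<in> (*) a ` A"
    by (auto simp: right_diff_distrib[symmetric] intro!: imageI diff_mem)
next
  fix x y assume "x \<in> A" "y \<in> (*) a ` A"
  then show "x * y \<in> (*) a ` A"
    by (auto simp: mult.left_commute intro!: imageI mult_mem)
qed (use assms one_mem diff_mem mult_mem in auto)

text \<open>For the unit ideal the congruence is trivial; the purpose is to inherit the closure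
  lemmas of \<open>complex_ideal\<close>.\<close>

sublocale unit: complex_ideal A A
  by standard (use one_mem diff_mem[of 1 1] diff_mem mult_mem in auto)

lemma rational_mem_int:
  assumes "x \<in> A" "x \<in> \<rat>"
  shows "x \<in> \<int>"
  using assms integral rational_algebraic_int_is_int by blast

lemma dvd_if_int_multiple:
  fixes a m :: int
  assumes "of_int a = of_int m * r" "r \<in> A"
  shows "m dvd a"
proof (cases "m = 0")
  case False
  then have "r = of_int a / of_int m" using assms by (simp add: field_simps)
  then have "r \<in> \<rat>" by simp
  then obtain k where "r = of_int k" using rational_mem_int assms(2) Ints_cases by metis
  then have "of_int a = (of_int (m * k) :: complex)" using assms by simp
  then show ?thesis by (metis dvd_triv_left of_int_eq_iff)
qed (use assms in auto)

text \<open>Take an integer equation for \<open>y\<close> with constant coefficient \<open>a\<close>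
  nonzero. An integer \<open>l\<close> dividing \<open>y\<close> in \<open>A\<close> also divides
  \<open>a\<close> in \<open>A\<close>, hence among the integers, because a rational element of
  \<open>A\<close> is an integer.\<close>

lemma bounded_int_divisors:
  assumes "y \<in> A" "y \<noteq> 0"
  obtains B :: nat where "\<And>l r. r \<in> A \<Longrightarrow> y = of_nat l * r \<Longrightarrow> l \<le> B"
proof -
  obtain g where g: "ipoly g y = 0" "Polynomial.coeff g 0 \<noteq> 0"
    using algebraic_int_ipoly_root integral assms by metis
  obtain a h where gh: "g = pCons a h" by (cases g)
  have "l \<le> nat \<bar>a\<bar>" if r: "r \<in> A" "y = of_nat l * r" for l r
  proof -
    have "of_int a = of_int (int l) * (- r * ipoly h y)"
      using g(1) r(2) unfolding gh by (simp add: eq_neg_iff_add_eq_0 mult_ac)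
    moreover have "- r * ipoly h y \<in> A"
      using r(1) assms by auto
    ultimately have "int l dvd a" by (rule dvd_if_int_multiple)
    moreover have "a \<noteq> 0" using g(2) gh by simp
    ultimately have "\<bar>int l\<bar> \<le> \<bar>a\<bar>" by (intro dvd_imp_le_int)
    then show ?thesis by simp
  qed
  then show thesis using that by blast
qed

text \<open>Landau's trick: every residue class prime to \<open>n\<close> contains a number all of whose
  prime factors exceed a given bound, so that only large primes need to be treated. For these,
  \<open>g (x\<^sup>l) \<equiv> (g x)\<^sup>l\<close> modulo \<open>l\<close> and there are only finitely many values.\<close>

lemma ipoly_root_coprime_power:
  assumes n: "n > 0" and roots: "\<And>z. z ^ n = 1 \<Longrightarrow> z \<in> A"
    and x: "x ^ n = 1" and gx: "ipoly g x = 0" and u: "coprime u n"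
  shows "ipoly g (x ^ u) = 0"
proof -
  have "\<exists>B. \<forall>z\<in>{z. z ^ n = 1 \<and> ipoly g z \<noteq> 0}. \<forall>l r. r \<in> A \<longrightarrow> ipoly g z = of_nat l * r \<longrightarrow> l \<le> (B z :: nat)"
  proof (rule bchoice, safe)
    fix z assume "z ^ n = 1" "ipoly g z \<noteq> 0"
    then show "\<exists>b. \<forall>l r. r \<in> A \<longrightarrow> ipoly g z = of_nat l * r \<longrightarrow> l \<le> b"
      using bounded_int_divisors[of "ipoly g z"] roots unit.ipoly_closed by metis
  qed
  then obtain B where B: "\<And>z l r. z ^ n = 1 \<Longrightarrow> ipoly g z \<noteq> 0 \<Longrightarrow> r \<in> A \<Longrightarrow>
      ipoly g z = of_nat l * r \<Longrightarrow> l \<le> (B z :: nat)" by blast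
  define L where "L = Max (B ` {z. z ^ n = 1})"
  have fin: "finite {z::complex. z ^ n = 1}" using n finite_roots_unity[of n] by simp
  have BL: "B z \<le> L" if "z ^ n = 1" for z
    unfolding L_def using that fin by (intro Max_ge) auto
  have large: "ipoly g (z ^ l) = 0"
    if l: "Factorial_Ring.prime l" "l > L" and z: "z ^ n = 1" "ipoly g z = 0" for z l
  proof (rule ccontr)
    assume nz: "ipoly g (z ^ l) \<noteq> 0"
    interpret l: complex_ideal A "(*) (of_nat l) ` A"
      by (rule principal_ideal) auto
    have "of_nat l \<in> (*) (of_nat l :: complex) ` A"
      using one_mem by (auto intro!: image_eqI[of _ _ 1])
    then have "l.cg (ipoly g z ^ (l ^ 1)) (ipoly g (z ^ (l ^ 1)))"
      by (intro l.cg_ipoly_power l roots z) 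
    then have "l.cg (ipoly g (z ^ l)) 0"
      using z(2) l(1) prime_gt_0_nat[of l] l.cg_sym by (auto simp: zero_power)
    then obtain r where "r \<in> A" "ipoly g (z ^ l) = of_nat l * r"
      unfolding l.cg_0_iff by blast
    moreover have zl: "(z ^ l) ^ n = 1" using z(1) by (metis mult.commute power_mult power_one)
    ultimately have "l \<le> B (z ^ l)" using nz B by blast
    then show False using BL[OF zl] l(2) by simp
  qed
  \<comment> \<open>\<open>N\<close> agrees with \<open>u\<close> modulo \<open>n\<close> and has no
    prime factor up to \<open>L\<close>: a small prime dividing \<open>u\<close> divides neither
    \<open>n\<close> nor \<open>Q\<close>, and a small prime not dividing \<open>u\<close> divides
    \<open>Q\<close>.\<close>
  define Q where "Q = \<Prod>{l. Factorial_Ring.prime l \<and> l \<le> L \<and> \<not> l dvd u}"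
  define N where "N = u + n * Q"
  have finQ: "finite {l. Factorial_Ring.prime l \<and> l \<le> L \<and> \<not> l dvd u}" 
    by (rule finite_subset[of _ "{..L}"]) auto
  have N_large: "l > L" if l: "Factorial_Ring.prime l" "l dvd N" for l
  proof (rule ccontr)
    assume "\<not> L < l"
    then have lL: "l \<le> L" by simp
    show False
    proof (cases "l dvd u")
      case True
      then have "l dvd n * Q" using l(2) unfolding N_def using dvd_add_right_iff by blast
      moreover have "\<not> l dvd n" using True u l(1) by (meson coprime_common_divisor not_prime_unit)
      ultimately have "l dvd Q" using l(1) prime_dvd_mult_iff by blast
      then obtain l' where l': "Factorial_Ring.prime l'" "\<not> l' dvd u" "l dvd l'"
        unfolding Q_def using prime_dvd_prod_iff[OF finQ l(1), of "\<lambda>x. x"] by auto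
      then have "l = l'" using l(1) primes_dvd_imp_eq by blast
      then show False using True l' by blast
    next
      case False
      then have "l dvd Q" unfolding Q_def using finQ l(1) lL by (intro dvd_prodI) auto
      then show False using False l(2) unfolding N_def
        by (metis dvd_add_left_iff dvd_mult)
    qed
  qed
  have "N \<noteq> 0"
  proof
    assume "N = 0"
    have u0: "u = 0" and Q0: "n * Q = 0" using \<open>N = 0\<close> unfolding N_def by auto
    have "Q \<noteq> 0" unfolding Q_def using finQ by (auto simp: prod_zero_iff)
    then show False using Q0 n by simp
  qed
  moreover have "ipoly g (z ^ m) = 0"
    if "m \<noteq> 0" "\<And>l. Factorial_Ring.prime l \<Longrightarrow> l dvd m \<Longrightarrow> l > L" "z ^ n = 1" "ipoly g z = 0" for m z
    using that
  proof (induction m arbitrary: z rule: prime_divisors_induct)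
    case (factor l m)
    have z: "(z ^ l) ^ n = 1" using factor.prems(3) by (metis mult.commute power_mult power_one)
    have "ipoly g (z ^ l) = 0"
      using factor.prems(2)[of l] factor.prems(3,4) factor.hyps large by auto
    then have "ipoly g ((z ^ l) ^ m) = 0"
      using factor.prems(1,2) z by (intro factor.IH) auto
    then show ?case by (simp add: power_mult)
  qed auto
  ultimately have "ipoly g (x ^ N) = 0" using N_large x gx by blast
  moreover have "x ^ N = x ^ u" unfolding N_def power_add power_mult using x by simp
  ultimately show ?thesis by simp
qed

end

text \<open>A sieve: discarding the multiples of one more prime \<open>l\<close> subtracts a sum of
  the same shape, with \<open>n / l\<close> and \<open>x ^ l\<close> in place of \<open>n\<close>
  and \<open>x\<close>. Without any sieving the geometric sum is \<open>n\<close> or 0.\<close>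

lemma sum_roots_not_dvd_int:
  fixes x :: complex
  assumes "finite S" "\<And>l. l \<in> S \<Longrightarrow> Factorial_Ring.prime l \<and> l dvd n" "n > 0" "x ^ n = 1"
  shows "(\<Sum>u | u < n \<and> (\<forall>l\<in>S. \<not> l dvd u). x ^ u) \<in> \<int>"
  using assms
proof (induction S arbitrary: n x rule: finite_induct)
  case empty
  have "(\<Sum>u<n. x ^ u) \<in> \<int>"
  proof (cases "x = 1")
    case False
    then show ?thesis using geometric_sum[of x n] empty by simp
  qed simp
  then show ?case by (simp add: lessThan_def)
next
  case (insert l S)
  obtain m where m: "n = l * m" using insert.prems(1) by blast
  have l: "Factorial_Ring.prime l" "l > 0" and mpos: "m > 0" using insert.prems m prime_gt_0_nat by auto
  have ndvd: "\<not> l' dvd l" if "l' \<in> S" for l'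
    using that insert l by (metis insertI2 primes_dvd_imp_eq)
  have Sm: "Factorial_Ring.prime l' \<and> l' dvd m" if "l' \<in> S" for l'
    using that insert.prems(1)[of l'] ndvd[of l'] m by (auto simp: prime_dvd_mult_iff)
  have eq: "{u. u < n \<and> (\<forall>l'\<in>S. \<not> l' dvd u)} =
      {u. u < n \<and> (\<forall>l'\<in>insert l S. \<not> l' dvd u)} \<union> (*) l ` {v. v < m \<and> (\<forall>l'\<in>S. \<not> l' dvd v)}"
  proof -
    have "(\<forall>l'\<in>S. \<not> l' dvd l * v) \<longleftrightarrow> (\<forall>l'\<in>S. \<not> l' dvd v)" for v
      using Sm ndvd prime_dvd_mult_iff by blast
    then show ?thesis using l m by (auto simp: image_iff dvd_def)
  qed
  have "(\<Sum>u | u < n \<and> (\<forall>l'\<in>S. \<not> l' dvd u). x ^ u) =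
      (\<Sum>u | u < n \<and> (\<forall>l'\<in>insert l S. \<not> l' dvd u). x ^ u)
      + (\<Sum>u\<in>(*) l ` {v. v < m \<and> (\<forall>l'\<in>S. \<not> l' dvd v)}. x ^ u)"
    unfolding eq by (rule sum.union_disjoint) auto
  also have "(\<Sum>u\<in>(*) l ` {v. v < m \<and> (\<forall>l'\<in>S. \<not> l' dvd v)}. x ^ u)
      = (\<Sum>v | v < m \<and> (\<forall>l'\<in>S. \<not> l' dvd v). (x ^ l) ^ v)"
    using l by (subst sum.reindex) (auto simp: inj_on_def power_mult)
  finally have "(\<Sum>u | u < n \<and> (\<forall>l'\<in>insert l S. \<not> l' dvd u). x ^ u) =
     (\<Sum>u | u < n \<and> (\<forall>l'\<in>S. \<not> l' dvd u). x ^ u) - (\<Sum>v | v < m \<and> (\<forall>l'\<in>S. \<not> l' dvd v). (x ^ l) ^ v)"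
    by simp
  moreover have "(\<Sum>u | u < n \<and> (\<forall>l'\<in>S. \<not> l' dvd u). x ^ u) \<in> \<int>"
    using insert.prems by (intro insert.IH) auto
  moreover have "(\<Sum>v | v < m \<and> (\<forall>l'\<in>S. \<not> l' dvd v). (x ^ l) ^ v) \<in> \<int>"
    using insert.prems m mpos Sm by (intro insert.IH) (auto simp: power_mult[symmetric])
  ultimately show ?case by simp
qed

lemma sum_coprime_powers_int:
  fixes x :: complex
  assumes "n > 0" "x ^ n = 1"
  shows "(\<Sum>u | u < n \<and> coprime u n. x ^ u) \<in> \<int>"
proof -
  have iff: "coprime u n \<longleftrightarrow> (\<forall>l\<in>prime_factors n. \<not> l dvd u)" for u
  proof
    assume c: "coprime u n"
    show "\<forall>l\<in>prime_factors n. \<not> l dvd u"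
    proof (intro ballI notI)
      fix l assume l: "l \<in> prime_factors n" "l dvd u"
      then have "is_unit l" using coprime_common_divisor[OF c] in_prime_factors_imp_dvd by blast
      then show False using in_prime_factors_imp_prime[OF l(1)] not_prime_unit by blast
    qed
  next
    assume *: "\<forall>l\<in>prime_factors n. \<not> l dvd u"
    show "coprime u n"
    proof (rule ccontr)
      assume "\<not> coprime u n"
      then have "gcd u n \<noteq> 1" by (simp add: coprime_iff_gcd_eq_1)
      then obtain l where l: "Factorial_Ring.prime l" "l dvd gcd u n"
        using prime_factor_nat[of "gcd u n"] by blast
      then have "l \<in> prime_factors n" using assms(1) by (intro prime_factorsI) simp_all
      then show False using * l(2) by simp
    qed
  qed
  show ?thesis
    unfolding iff using in_prime_factors_imp_prime in_prime_factors_imp_dvd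
    by (intro sum_roots_not_dvd_int conjI assms) auto
qed

lemma sum_coprime_ipoly_int:
  assumes "n > 0" "x ^ n = 1"
  shows "(\<Sum>u | u < n \<and> coprime u n. ipoly g (x ^ u)) \<in> \<int>"
proof -
  define U where "U = {u. u < n \<and> coprime u n}"
  \<comment> \<open>The extra factor \<open>(x ^ k) ^ u\<close> absorbs the power of the variable
    belonging to each coefficient, which makes induction on the polynomial possible.\<close>
  have "(\<Sum>u\<in>U. (x ^ k) ^ u * ipoly g (x ^ u)) \<in> \<int>" for k
  proof (induction g arbitrary: k)
    case (pCons a g)
    have "(x ^ k) ^ u * ipoly (pCons a g) (x ^ u) =
        of_int a * (x ^ k) ^ u + (x ^ Suc k) ^ u * ipoly g (x ^ u)" for u
      by (simp add: distrib_left power_mult_distrib mult_ac)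
    then have "(\<Sum>u\<in>U. (x ^ k) ^ u * ipoly (pCons a g) (x ^ u)) =
      of_int a * (\<Sum>u\<in>U. (x ^ k) ^ u) + (\<Sum>u\<in>U. (x ^ Suc k) ^ u * ipoly g (x ^ u))"
      by (simp only: sum.distrib sum_distrib_left)
    moreover have "(x ^ k) ^ n = 1"
      using assms(2) by (metis mult.commute power_mult power_one)
    then have "(\<Sum>u\<in>U. (x ^ k) ^ u) \<in> \<int>"
      unfolding U_def using assms(1) by (intro sum_coprime_powers_int)
    ultimately show ?case using pCons.IH[of "Suc k"] by simp
  qed simp
  from this[of 0] show ?thesis by (simp add: U_def)
qed

text \<open>A form of Kronecker's theorem. An exponent \<open>k\<close> that brings all
  \<open>e u ^ k\<close> close to 1 puts the integral power sum within distance 1 of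
  \<open>card U\<close>, hence equal to it. As no real part exceeds 1, every term must be 1.\<close>

lemma roots_of_unity_if_int_power_sums:
  fixes e :: "nat \<Rightarrow> complex"
  assumes U: "U \<subseteq> {..<n}" and e: "\<And>u. u \<in> U \<Longrightarrow> norm (e u) = 1"
    and int: "\<And>k. (\<Sum>u\<in>U. e u ^ k) \<in> \<int>"
  obtains k where "k > 0" "\<And>u. u \<in> U \<Longrightarrow> e u ^ k = 1"
proof -
  have fin: "finite U" using U finite_subset by blast
  \<comment> \<open>7 is an upper bound for \<open>2 * pi\<close>, so an approximation error of
    \<open>1 / N\<close> in the angle moves each point by less than \<open>7 / N\<close>. The
    successor keeps \<open>N\<close> positive for empty \<open>U\<close> and the total error
    strictly below 1.\<close>
  define N where "N = 7 * Suc (card U)"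
  define \<theta> where "\<theta> u = Arg (e u) / (2 * pi)" for u
  have "N > 0" by (simp add: N_def)
  obtain k' m where k': "0 < k'" and "k' \<le> int (N ^ n)" and m: "\<And>i. i < n \<Longrightarrow> \<bar>of_int k' * \<theta> i - of_int (m i)\<bar> < 1 / N"
    by (rule Dirichlet_approx_simult[OF \<open>N > 0\<close>, of n \<theta>]) (rule that)
  define k where "k = nat k'"
  have "k > 0" using k' by (simp add: k_def)
  have close: "norm (e u ^ k - 1) < 7 / N" if u: "u \<in> U" for u
  proof -
    define d where "d = 2 * pi * (of_int k' * \<theta> u - of_int (m u))"
    have "e u = cis (2 * pi * \<theta> u)"
      using cis_Arg[of "e u"] e[OF u] by (simp add: \<theta>_def sgn_div_norm) (metis norm_zero zero_neq_one)
    then have "e u ^ k = cis (real k * (2 * pi * \<theta> u))"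
      by (simp only: Complex.DeMoivre)
    also have "real k * (2 * pi * \<theta> u) = d + 2 * pi * of_int (m u)"
      using k' by (simp add: d_def k_def algebra_simps)
    also have "cis \<dots> = cis d"
      by (simp add: cis_mult[symmetric])
    finally have ek: "e u ^ k = cis d" .
    have "norm (cis d - 1) \<le> \<bar>d\<bar>"
    proof -
      have "norm (cis d - 1) = 2 * \<bar>sin (d / 2)\<bar>"
        using norm_exp_i_times dist_exp_i_1[of d] by (simp add: cis_conv_exp)
      also have "\<dots> \<le> \<bar>d\<bar>" using abs_sin_x_le_abs_x[of "d / 2"] by simp
      finally show ?thesis .
    qed
    also have "\<bar>d\<bar> = 2 * pi * \<bar>of_int k' * \<theta> u - of_int (m u)\<bar>"
      by (simp add: d_def abs_mult)
    also have "\<dots> < 2 * pi * (1 / N)"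
      using m[of u] u U by (intro mult_strict_left_mono) auto
    also have "\<dots> < 7 / N"
      using pi_approx(2) \<open>N > 0\<close> by (simp add: divide_strict_right_mono)
    finally show ?thesis by (simp add: ek)
  qed
  have "norm ((\<Sum>u\<in>U. e u ^ k) - of_nat (card U)) = norm (\<Sum>u\<in>U. e u ^ k - 1)"
    by (simp add: sum_subtractf)
  also have "\<dots> \<le> (\<Sum>u\<in>U. norm (e u ^ k - 1))" by (rule norm_sum)
  also have "\<dots> \<le> (\<Sum>u\<in>U. 7 / N)"
    using close by (intro sum_mono less_imp_le)
  also have "\<dots> < 1" by (simp add: N_def field_simps)
  finally have lt: "norm ((\<Sum>u\<in>U. e u ^ k) - of_nat (card U)) < 1" .
  obtain t where t: "(\<Sum>u\<in>U. e u ^ k) = of_int t" using int Ints_cases by metis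
  have "norm (of_int (t - int (card U)) :: complex) < 1" using lt unfolding t by simp
  then have "t = int (card U)" unfolding norm_of_int by linarith
  then have "Re (\<Sum>u\<in>U. e u ^ k) = card U" using t by simp
  then have s0: "(\<Sum>u\<in>U. 1 - Re (e u ^ k)) = 0" by (simp add: sum_subtractf)
  have ge: "1 - Re (e u ^ k) \<ge> 0" if "u \<in> U" for u
    using complex_Re_le_cmod[of "e u ^ k"] e[OF that] by (simp add: norm_power)
  have "e u ^ k = 1" if u: "u \<in> U" for u
  proof -
    have re: "Re (e u ^ k) = 1"
      using sum_nonneg_eq_0_iff[OF fin ge] s0 u by simp
    have "cmod (e u ^ k) = 1" using e[OF u] by (simp add: norm_power)
    then have "Im (e u ^ k) = 0"
      using re cmod_power2[of "e u ^ k"] by simp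
    then show ?thesis using re by (simp add: complex_eq_iff)
  qed
  then show thesis using that \<open>k > 0\<close> by blast
qed

section \<open>The cyclotomic order, its conjugations and its traces\<close>

definition unity_gen :: "nat \<Rightarrow> complex" where
  "unity_gen n = cis (2 * pi / real n)"

definition cyc_ints :: "nat \<Rightarrow> complex set" where
  "cyc_ints n = range (\<lambda>g. ipoly g (unity_gen n))"

text \<open>Meaningful for \<open>u\<close> coprime to \<open>n\<close> and \<open>x\<close> in \<open>cyc_ints n\<close>, where the choice of the
  polynomial does not matter by \<open>ipoly_root_coprime_power\<close>.\<close>

definition galois :: "nat \<Rightarrow> nat \<Rightarrow> complex \<Rightarrow> complex" where
  "galois n u x = ipoly (SOME g. ipoly g (unity_gen n) = x) (unity_gen n ^ u)"

lemma unity_gen_power_self: "n > 0 \<Longrightarrow> unity_gen n ^ n = 1"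
  by (simp add: unity_gen_def Complex.DeMoivre)

lemma root_of_unity_power_gen:
  assumes "n > 0" "z ^ n = 1"
  obtains k where "k < n" "z = unity_gen n ^ k"
proof -
  have "z \<in> (\<lambda>k. cis (2 * pi * real k / real n)) ` {..<n}"
    using Complex.bij_betw_roots_unity[OF assms(1)] assms(2) by (simp add: bij_betw_def)
  then show thesis using that by (auto simp: unity_gen_def Complex.DeMoivre mult_ac)
qed

lemma unity_gen_power_eq_1_iff:
  assumes "n > 0"
  shows "unity_gen n ^ k = 1 \<longleftrightarrow> n dvd k"
proof
  assume *: "unity_gen n ^ k = 1"
  have "unity_gen n ^ k = unity_gen n ^ (n * (k div n) + k mod n)" by simp
  also have "\<dots> = unity_gen n ^ (k mod n)"
    unfolding power_add power_mult unity_gen_power_self[OF assms] by simp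
  finally have "cis (2 * pi * real (k mod n) / real n) = cis (2 * pi * real 0 / real n)"
    using * by (simp add: unity_gen_def Complex.DeMoivre mult_ac)
  then have "k mod n = 0"
    using Complex.bij_betw_roots_unity[OF assms] assms unfolding bij_betw_def inj_on_def
    by (metis lessThan_iff mod_less_divisor)
  then show "n dvd k" by auto
next
  assume "n dvd k"
  then show "unity_gen n ^ k = 1"
    using unity_gen_power_self[OF assms] by (auto simp: power_mult)
qed

lemma cyc_intsE:
  assumes "x \<in> cyc_ints n"
  obtains g where "x = ipoly g (unity_gen n)"
  using assms by (auto simp: cyc_ints_def)

lemma ipoly_in_cyc_ints [simp]: "ipoly g (unity_gen n) \<in> cyc_ints n"
  by (simp add: cyc_ints_def)

lemma cyc_ints_one [simp]: "1 \<in> cyc_ints n"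
  using ipoly_in_cyc_ints[of 1] by simp

lemma cyc_ints_zero [simp]: "0 \<in> cyc_ints n"
  using ipoly_in_cyc_ints[of 0] by simp

lemma cyc_ints_add: "x \<in> cyc_ints n \<Longrightarrow> y \<in> cyc_ints n \<Longrightarrow> x + y \<in> cyc_ints n"
  by (metis cyc_intsE ipoly_add ipoly_in_cyc_ints)

lemma cyc_ints_mult: "x \<in> cyc_ints n \<Longrightarrow> y \<in> cyc_ints n \<Longrightarrow> x * y \<in> cyc_ints n"
  by (metis cyc_intsE ipoly_mult ipoly_in_cyc_ints)

lemma cyc_ints_power: "x \<in> cyc_ints n \<Longrightarrow> x ^ k \<in> cyc_ints n"
  by (induction k) (auto intro: cyc_ints_mult)

lemma cyc_ints_sum: "(\<And>i. i \<in> S \<Longrightarrow> g i \<in> cyc_ints n) \<Longrightarrow> sum g S \<in> cyc_ints n"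
  by (induction S rule: infinite_finite_induct) (auto intro: cyc_ints_add)

lemma cyc_ints_root:
  assumes "n > 0" "z ^ n = 1"
  shows "z \<in> cyc_ints n"
  using root_of_unity_power_gen[OF assms] by (metis ipoly_in_cyc_ints ipoly_monom)

locale galois_action = integer_ring +
  fixes n :: nat
  assumes n_pos: "n > 0" and root_mem: "z ^ n = 1 \<Longrightarrow> z \<in> A"
begin

context
  fixes u :: nat assumes u: "coprime u n"
begin

lemma galois_ipoly: "galois n u (ipoly g (unity_gen n)) = ipoly g (unity_gen n ^ u)"
proof -
  define h where "h = (SOME h. ipoly h (unity_gen n) = ipoly g (unity_gen n))"
  have "ipoly h (unity_gen n) = ipoly g (unity_gen n)"
    unfolding h_def by (rule someI_ex) blast
  then have "ipoly (h - g) (unity_gen n ^ u) = 0"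
    by (intro ipoly_root_coprime_power[OF n_pos root_mem unity_gen_power_self[OF n_pos] _ u]) auto
  then show ?thesis by (simp add: galois_def h_def)
qed

lemma galois_0 [simp]: "galois n u 0 = 0"
  using galois_ipoly[of 0] by simp

lemma galois_of_int [simp]: "galois n u (of_int k) = of_int k"
  using galois_ipoly[of "[:k:]"] by simp

lemma galois_add:
  "x \<in> cyc_ints n \<Longrightarrow> y \<in> cyc_ints n \<Longrightarrow> galois n u (x + y) = galois n u x + galois n u y"
  by (metis cyc_intsE galois_ipoly ipoly_add)

lemma galois_mult:
  "x \<in> cyc_ints n \<Longrightarrow> y \<in> cyc_ints n \<Longrightarrow> galois n u (x * y) = galois n u x * galois n u y"
  by (metis cyc_intsE galois_ipoly ipoly_mult)

lemma galois_power:
  "x \<in> cyc_ints n \<Longrightarrow> galois n u (x ^ k) = galois n u x ^ k"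
  by (metis cyc_intsE galois_ipoly ipoly_power)

lemma galois_sum:
  "(\<And>i. i \<in> S \<Longrightarrow> g i \<in> cyc_ints n) \<Longrightarrow> galois n u (sum g S) = (\<Sum>i\<in>S. galois n u (g i))"
  by (induction S rule: infinite_finite_induct) (simp_all add: galois_add cyc_ints_sum)

lemma galois_root:
  assumes "z ^ n = 1"
  shows "galois n u z = z ^ u"
proof -
  obtain k where "z = unity_gen n ^ k" using root_of_unity_power_gen[OF n_pos assms] by blast
  then show ?thesis using galois_ipoly[of "Polynomial.monom 1 k"]
    by (simp add: power_mult[symmetric] mult.commute)
qed

end

lemma sum_galois_int:
  assumes "x \<in> cyc_ints n"
  shows "(\<Sum>u | u < n \<and> coprime u n. galois n u x) \<in> \<int>"
proof -
  obtain g where g: "x = ipoly g (unity_gen n)" using assms cyc_intsE by blast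
  have "(\<Sum>u | u < n \<and> coprime u n. galois n u x) = (\<Sum>u | u < n \<and> coprime u n. ipoly g (unity_gen n ^ u))"
    unfolding g by (intro sum.cong galois_ipoly) auto
  then show ?thesis using sum_coprime_ipoly_int[OF n_pos unity_gen_power_self[OF n_pos]] by metis
qed

end

section \<open>Teichmueller representatives and the additive character\<close>

text \<open>Kept apart from \<open>residue_setup\<close>: the injectivity of reduction on
  \<open>T\<close>, proved here, is what later establishes, by counting, the existence of
  representatives assumed there.\<close>

locale prime_above = complex_ideal A P for A P +
  fixes p f q :: nat
  assumes integral_A: "x \<in> A \<Longrightarrow> algebraic_int x"
    and prime_p: "Factorial_Ring.prime p" and f_pos: "f \<ge> 1" and q_eq: "q = p ^ f" and q_gt_2: "q > 2"
    and roots_mem: "z ^ (p * (q - 1)) = 1 \<Longrightarrow> z \<in> A"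
    and P_prime: "x \<in> A \<Longrightarrow> y \<in> A \<Longrightarrow> x * y \<in> P \<Longrightarrow> x \<in> P \<or> y \<in> P"
    and of_int_mem_P: "of_int k \<in> P \<longleftrightarrow> int p dvd k"
begin

sublocale galois_action A "p * (q - 1)"
proof
  show "p * (q - 1) > 0" using prime_gt_0_nat[OF prime_p] q_gt_2 by simp
qed (fact one_closed diff_closed mult_closed integral_A roots_mem)+

lemma p_gt_1: "p > 1"
  using prime_p prime_gt_1_nat by blast

lemma of_nat_mem_P: "of_nat k \<in> P \<longleftrightarrow> p dvd k"
  using of_int_mem_P[of "int k"] by simp

lemma one_notin_P: "1 \<notin> P"
  using of_nat_mem_P[of 1] p_gt_1 by simp

lemma p_mem_P: "of_nat p \<in> P"
  by (simp add: of_nat_mem_P)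

lemma P_power: "x \<in> A \<Longrightarrow> x ^ k \<in> P \<Longrightarrow> x \<in> P"
  by (induction k) (use P_prime one_notin_P in auto)

lemma notin_P_mult: "x \<in> A \<Longrightarrow> x \<notin> P \<Longrightarrow> y \<in> A \<Longrightarrow> y \<notin> P \<Longrightarrow> x * y \<notin> P"
  using P_prime by blast

lemma p_dvd_q: "p dvd q"
  using f_pos by (simp add: q_eq)

lemma q_minus_1_notin_P: "of_nat (q - 1) \<notin> P"
proof
  assume "of_nat (q - 1) \<in> P"
  then have "p dvd q - 1" by (simp add: of_nat_mem_P)
  moreover have "p dvd (q - 1) + 1" using p_dvd_q q_gt_2 by simp
  ultimately have "p dvd 1" using dvd_add_right_iff by blast
  then show False using p_gt_1 by simp
qed

definition mu :: "complex set" where "mu = {z. z ^ (q - 1) = 1}"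

lemma finite_mu [simp]: "finite mu"
  unfolding mu_def using q_gt_2 by (intro finite_roots_unity) auto

lemma card_mu: "card mu = q - 1"
  unfolding mu_def using q_gt_2 by (intro card_roots_unity_eq) auto

lemma zero_notin_mu [simp]: "0 \<notin> mu"
  using q_gt_2 by (simp add: mu_def zero_power)

lemma mu_nz: "z \<in> mu \<Longrightarrow> z \<noteq> 0"
  by auto

lemma one_mem_mu [simp]: "1 \<in> mu"
  by (simp add: mu_def)

lemma mu_mult: "x \<in> mu \<Longrightarrow> y \<in> mu \<Longrightarrow> x * y \<in> mu"
  by (simp add: mu_def power_mult_distrib)

lemma mu_inverse: "x \<in> mu \<Longrightarrow> inverse x \<in> mu"
  by (simp add: mu_def power_inverse)

lemma mu_divide: "x \<in> mu \<Longrightarrow> y \<in> mu \<Longrightarrow> x / y \<in> mu"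
  by (simp add: mu_def power_divide)

lemma mu_power: "x \<in> mu \<Longrightarrow> x ^ k \<in> mu"
  by (induction k) (auto intro: mu_mult)

lemma mu_powi: "x \<in> mu \<Longrightarrow> x powi k \<in> mu"
  by (auto simp: power_int_def intro: mu_power mu_inverse)

lemma mu_root: "z \<in> mu \<Longrightarrow> z ^ (p * (q - 1)) = 1"
  by (subst mult.commute) (simp add: mu_def power_mult)

lemma mu_mem [intro]: "z \<in> mu \<Longrightarrow> z \<in> A"
  using mu_root roots_mem by blast

lemma mu_norm: "z \<in> mu \<Longrightarrow> norm z = 1"
  unfolding mu_def using power_eq_1_iff[of z "q - 1"] q_gt_2 by auto

lemma mu_cnj: "z \<in> mu \<Longrightarrow> cnj z = inverse z"
  using mu_norm[of z] by (simp add: inverse_complex_def complex_eq_iff cmod_def)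

lemma mu_power_q: "z \<in> mu \<Longrightarrow> z ^ q = z"
  using power_Suc[of z "q - 1"] q_gt_2 by (simp add: mu_def)

lemma mu_notin_P: "z \<in> mu \<Longrightarrow> z \<notin> P"
  using ideal_absorb[of "inverse z" z] mu_inverse[of z] mu_nz[of z] one_notin_P by auto

lemma mu_powi_cong:
  assumes "z \<in> mu" "int (q - 1) dvd k - l"
  shows "z powi k = z powi l"
proof -
  obtain m where m: "k = l + int (q - 1) * m" using assms(2) by (metis add.commute diff_add_cancel dvdE)
  have "z powi k = z powi l * (z powi int (q - 1)) powi m"
    unfolding m using mu_nz[OF assms(1)] by (simp add: power_int_add power_int_mult)
  also have "z powi int (q - 1) = 1" using assms(1) by (simp add: mu_def)
  finally show ?thesis by simp
qed

text \<open>Orthogonality of characters: multiplication by a primitive root \<open>g\<close>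
  permutes \<open>mu\<close> and multiplies the sum by \<open>g powi k\<close>, which differs from 1
  in the second case.\<close>

lemma sum_mu_powi: "(\<Sum>z\<in>mu. z powi k) = (if int (q - 1) dvd k then of_nat (q - 1) else 0)"
proof (cases "int (q - 1) dvd k")
  case True
  then have "(\<Sum>z\<in>mu. z powi k) = (\<Sum>z\<in>mu. 1)"
    using mu_powi_cong[of _ k 0] by (intro sum.cong) auto
  then show ?thesis using True card_mu by simp
next
  case False
  define g where "g = unity_gen (q - 1)"
  have g: "g \<in> mu" using unity_gen_power_self[of "q - 1"] q_gt_2 by (simp add: mu_def g_def)
  define m where "m = nat (k mod int (q - 1))"
  have km: "int (q - 1) dvd k - int m"
    using q_gt_2 by (simp add: m_def)
  have "g powi k = g ^ m" using mu_powi_cong[OF g km] by simp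
  moreover have "\<not> (q - 1) dvd m"
    using False km by (metis dvd_diff_commute dvd_diff_right_iff int_dvd_int_iff)
  ultimately have ne: "g powi k \<noteq> 1"
    using unity_gen_power_eq_1_iff[of "q - 1" m] q_gt_2 by (simp add: g_def)
  have "(\<Sum>z\<in>mu. z powi k) = (\<Sum>z\<in>mu. (g * z) powi k)"
    by (rule sum.reindex_bij_witness[of _ "\<lambda>z. g * z" "\<lambda>z. z / g"])
       (use g mu_nz mu_mult mu_divide in auto)
  also have "\<dots> = g powi k * (\<Sum>z\<in>mu. z powi k)"
    by (simp add: power_int_mult_distrib sum_distrib_left)
  finally show ?thesis using ne False by simp
qed

definition T :: "complex set" where "T = insert 0 mu"

lemma finite_T [simp]: "finite T"
  by (simp add: T_def)

lemma card_T: "card T = q"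
  using card_mu q_gt_2 by (simp add: T_def)

lemma T_mem [intro]: "z \<in> T \<Longrightarrow> z \<in> A"
  by (auto simp: T_def)

lemma T_power: "x \<in> T \<Longrightarrow> k > 0 \<Longrightarrow> x ^ k \<in> T"
  by (auto simp: T_def mu_power zero_power)

lemma T_power_q: "z \<in> T \<Longrightarrow> z ^ q = z"
  using mu_power_q q_gt_2 by (auto simp: T_def zero_power)

text \<open>If a root of unity \<open>w\<close> other than 1 were congruent to 1, then its geometric
  sum, which is 0, would be congruent to \<open>q - 1\<close>; but \<open>q - 1\<close> is prime to
  \<open>p\<close>.\<close>

lemma T_cg_imp_eq:
  assumes "x \<in> T" "y \<in> T" "cg x y"
  shows "x = y"
proof (cases "x = 0 \<or> y = 0")
  case True
  then show ?thesis
    using assms mu_notin_P cg_0_iff cg_sym unfolding T_def by blast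
next
  case False
  then have xy: "x \<in> mu" "y \<in> mu" using assms by (auto simp: T_def)
  define w where "w = x / y"
  have w: "w \<in> mu" using xy mu_divide by (simp add: w_def)
  have "cg (inverse y * x) (inverse y * y)"
    using assms xy mu_inverse by (intro cg_mult cg_refl) auto
  then have w1: "cg w 1" using xy mu_nz by (simp add: w_def field_simps)
  have "cg (\<Sum>i<q-1. w ^ i) (\<Sum>i<q-1. 1 ^ i)"
    using w1 by blast
  moreover have "(\<Sum>i<q-1. w ^ i) = 0" if "w \<noteq> 1"
    using geometric_sum[OF that, of "q - 1"] w by (simp add: mu_def)
  moreover have "\<not> cg 0 (of_nat (q - 1))"
    using q_minus_1_notin_P cg_sym cg_0_iff by blast
  ultimately have "w = 1" by fastforce
  then show ?thesis using xy mu_nz by (simp add: w_def)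
qed

text \<open>Pigeonhole: the \<open>q\<close> elements of \<open>T\<close> lie in distinct classes,
  and there are at most \<open>q\<close> classes. The map \<open>h\<close> stands for reduction, of
  which only the fibres and the size of the image matter.\<close>

lemma residue_representative:
  assumes h: "\<And>x y. x \<in> A \<Longrightarrow> y \<in> A \<Longrightarrow> h x = h y \<longleftrightarrow> x - y \<in> P"
    and card: "finite (h ` A)" "card (h ` A) \<le> q" and x: "x \<in> A"
  shows "\<exists>z\<in>T. x - z \<in> P"
proof -
  have "inj_on h T"
  proof (rule inj_onI)
    fix y z assume yz: "y \<in> T" "z \<in> T" "h y = h z"
    then have "cg y z" using h[OF T_mem T_mem] by (auto simp: cg_def)
    then show "y = z" by (rule T_cg_imp_eq[OF yz(1,2)])
  qed
  then have "card (h ` T) = q" using card_T by (simp add: card_image)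
  then have "h ` T = h ` A" using card by (intro card_seteq) auto
  then obtain z where "z \<in> T" "h x = h z" using x by blast
  then show ?thesis using h[OF x T_mem] by blast
qed

end

locale residue_setup = prime_above A P p f q for A P p f q +
  fixes \<zeta> :: complex
  assumes residue: "x \<in> A \<Longrightarrow> \<exists>z\<in>T. x - z \<in> P"
    and zeta: "unity_roots p = {\<zeta> ^ k | k :: nat. True}"
begin

text \<open>The Teichmueller representative of a class. Since \<open>T\<close> is closed under
  multiplication but not under addition, \<open>tau\<close> is what brings sums back into
  \<open>T\<close>.\<close>

definition tau :: "complex \<Rightarrow> complex" where
  "tau x = (SOME z. z \<in> T \<and> cg x z)"

lemma
  assumes "x \<in> A"
  shows tau_mem: "tau x \<in> T" and cg_tau: "cg x (tau x)"
proof -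
  obtain z where "z \<in> T" "x - z \<in> P" using residue[OF assms] by blast
  then have "\<exists>z. z \<in> T \<and> cg x z" using assms by (auto simp: cg_def)
  then have "tau x \<in> T \<and> cg x (tau x)" unfolding tau_def by (rule someI_ex)
  then show "tau x \<in> T" "cg x (tau x)" by auto
qed

lemma tau_eqI:
  assumes "z \<in> T" "cg x z"
  shows "tau x = z"
proof -
  have x: "x \<in> A" using assms(2) cg_closed by blast
  have "cg (tau x) x" using cg_tau[OF x] by (rule cg_sym)
  also note assms(2)
  finally show ?thesis by (rule T_cg_imp_eq[OF tau_mem[OF x] assms(1)])
qed

lemma tau_T [simp]: "z \<in> T \<Longrightarrow> tau z = z"
  by (rule tau_eqI) auto

lemma tau_eq_iff: "x \<in> A \<Longrightarrow> y \<in> A \<Longrightarrow> tau x = tau y \<longleftrightarrow> cg x y"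
proof
  assume x: "x \<in> A" and y: "y \<in> A"
  assume eq: "tau x = tau y"
  have "cg x (tau y)" using cg_tau[OF x] unfolding eq .
  also have "cg (tau y) y" using cg_tau[OF y] by (rule cg_sym)
  finally show "cg x y" .
next
  assume y: "y \<in> A" and "cg x y"
  note this(2)
  also note cg_tau[OF y]
  finally show "tau x = tau y" by (rule tau_eqI[OF tau_mem[OF y]])
qed

lemma tau_mem_A [intro]: "x \<in> A \<Longrightarrow> tau x \<in> A"
  by (rule T_mem[OF tau_mem])

lemma tau_mu:
  assumes "x \<in> A" "x \<notin> P"
  shows "tau x \<in> mu"
proof -
  have "tau x \<noteq> 0" using cg_tau[OF assms(1)] assms(2) cg_0_iff[of x] by metis
  then show ?thesis using tau_mem[OF assms(1)] unfolding T_def by simp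
qed

lemma cg_power_q:
  assumes "x \<in> A"
  shows "cg (x ^ q) x"
proof -
  have "cg (x ^ q) (tau x ^ q)" using cg_tau[OF assms] by (rule cg_power)
  also have "tau x ^ q = tau x" by (rule T_power_q[OF tau_mem[OF assms]])
  also have "cg (tau x) x" using cg_tau[OF assms] by (rule cg_sym)
  finally show ?thesis .
qed

text \<open>Translation of the residue field by the class of \<open>a\<close>, transported to
  \<open>T\<close> for use as a substitution in character sums.\<close>

lemma bij_tau_shift:
  assumes "a \<in> A"
  shows "bij_betw (\<lambda>x. tau (x + a)) T T"
proof -
  have "inj_on (\<lambda>x. tau (x + a)) T"
  proof (rule inj_onI)
    fix x y assume xy: "x \<in> T" "y \<in> T" "tau (x + a) = tau (y + a)"
    then have "cg (x + a) (y + a)"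
      using tau_eq_iff[OF add_closed add_closed, of x a y a] assms T_mem by blast
    from cg_diff[OF this cg_refl[OF assms]] have "cg x y" by simp
    then show "x = y" by (rule T_cg_imp_eq[OF xy(1,2)])
  qed
  moreover have "(\<lambda>x. tau (x + a)) ` T \<subseteq> T"
  proof (rule image_subsetI)
    fix x assume "x \<in> T"
    then show "tau (x + a) \<in> T" by (intro tau_mem[OF add_closed] T_mem assms)
  qed
  ultimately show ?thesis
    using endo_inj_surj[OF finite_T] by (simp add: bij_betw_def)
qed

lemma cg_int_iff: "cg (of_int k) (of_int l) \<longleftrightarrow> int p dvd k - l"
  using of_int_mem_P[of "k - l"] by (simp add: cg_def)

lemma cg_nat_iff: "cg (of_nat k) (of_nat l) \<longleftrightarrow> k mod p = l mod p"
  using cg_int_iff[of "int k" "int l"] by (simp add: mod_eq_dvd_iff[symmetric] zmod_int[symmetric])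

text \<open>The fixed points of the Frobenius form the prime field: the \<open>p\<close> integer
  classes are fixed, and \<open>s ^ p = s\<close> has at most \<open>p\<close> solutions.\<close>

lemma fixed_frob_T:
  assumes "s \<in> T" "s ^ p = s"
  obtains k where "k < p" "s = tau (of_nat k)"
proof -
  let ?E = "{s \<in> T. s ^ p = s}"
  have sub: "(\<lambda>k. tau (of_nat k)) ` {..<p} \<subseteq> ?E"
  proof safe
    fix k assume "k < p"
    show "tau (of_nat k) \<in> T" by (simp add: tau_mem)
    have "cg (tau (of_nat k) ^ p) (of_nat k ^ p)" by (intro cg_power cg_sym[OF cg_tau]) simp
    also have "cg (of_nat k ^ p) (of_nat k)"
      using cg_int_power[OF prime_p p_mem_P, of "int k" 1] by simp
    also have "cg (of_nat k) (tau (of_nat k))" by (intro cg_tau) simp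
    finally show "tau (of_nat k) ^ p = tau (of_nat k)"
      using p_gt_1 by (intro T_cg_imp_eq T_power tau_mem) auto
  qed
  have inj: "inj_on (\<lambda>k. tau (of_nat k)) {..<p}"
    by (rule inj_onI) (simp add: tau_eq_iff cg_nat_iff)
  have p1: "p - 1 > 0" using p_gt_1 by simp
  have "?E \<subseteq> insert 0 {z. z ^ (p - 1) = 1}"
  proof
    fix s assume "s \<in> ?E"
    moreover have "s ^ p = s * s ^ (p - 1)" using p_gt_1 by (simp flip: power_Suc)
    ultimately show "s \<in> insert 0 {z. z ^ (p - 1) = 1}" by auto
  qed
  then have "card ?E \<le> card (insert 0 {z::complex. z ^ (p - 1) = 1})"
    using p1 by (intro card_mono) (auto intro: finite_roots_unity)
  also have "\<dots> \<le> p"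
    using card_roots_unity_eq[OF p1] card_insert_le_m1[of p "{z::complex. z ^ (p - 1) = 1}" 0] p_gt_1 by simp
  finally have "(\<lambda>k. tau (of_nat k)) ` {..<p} = ?E"
    using sub card_image[OF inj] by (intro card_seteq) auto
  then show thesis using assms that by blast
qed

section \<open>The trace to the prime field and the additive character\<close>

definition trc :: "complex \<Rightarrow> complex" where
  "trc x = (\<Sum>i<f. x ^ (p ^ i))"

definition tr :: "complex \<Rightarrow> nat" where
  "tr x = (THE k. k < p \<and> cg (of_nat k) (trc x))"

lemma trc_closed [intro]: "x \<in> A \<Longrightarrow> trc x \<in> A"
  unfolding trc_def by blast

lemma trc_cong: "cg x y \<Longrightarrow> cg (trc x) (trc y)"
  unfolding trc_def by blast

lemma cg_power_p_add: "x \<in> A \<Longrightarrow> y \<in> A \<Longrightarrow> cg ((x + y) ^ (p ^ i)) (x ^ (p ^ i) + y ^ (p ^ i))"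
  by (rule cg_prime_power_add[OF prime_p p_mem_P])

lemma trc_add: "x \<in> A \<Longrightarrow> y \<in> A \<Longrightarrow> cg (trc (x + y)) (trc x + trc y)"
  unfolding trc_def sum.distrib[symmetric] by (intro cg_sum cg_power_p_add)

text \<open>The Frobenius shifts the summands by one place, and the summand \<open>x ^ q\<close>
  that enters at the end is congruent to the \<open>x\<close> that drops out.\<close>

lemma trc_frob:
  assumes "x \<in> A"
  shows "cg (trc (x ^ p)) (trc x)"
proof -
  have "trc (x ^ p) + x = (\<Sum>i<f. x ^ (p ^ Suc i)) + x ^ (p ^ 0)"
    by (simp add: trc_def power_mult)
  also have "\<dots> = (\<Sum>i<Suc f. x ^ (p ^ i))"
    unfolding sum.lessThan_Suc_shift by simp
  also have "\<dots> = trc x + x ^ q" by (simp add: trc_def q_eq)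
  finally have "trc (x ^ p) = trc x + x ^ q - x" by (simp add: algebra_simps)
  moreover have "cg (trc x + x ^ q - x) (trc x + x - x)"
    using assms cg_power_q by blast
  ultimately show ?thesis by simp
qed

lemma trc_power_p:
  assumes "x \<in> A"
  shows "cg (trc x ^ p) (trc x)"
proof -
  have "cg ((\<Sum>i<m. x ^ (p ^ i)) ^ p) (\<Sum>i<m. (x ^ p) ^ (p ^ i))" for m
  proof (induction m)
    case (Suc m)
    have "cg (((\<Sum>i<m. x ^ (p ^ i)) + x ^ (p ^ m)) ^ (p ^ 1)) ((\<Sum>i<m. x ^ (p ^ i)) ^ (p ^ 1) + (x ^ (p ^ m)) ^ (p ^ 1))"
      using assms by (intro cg_power_p_add) auto
    also have "cg \<dots> ((\<Sum>i<m. (x ^ p) ^ (p ^ i)) + (x ^ p) ^ (p ^ m))"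
    proof (intro cg_add)
      show "cg ((x ^ p ^ m) ^ p ^ 1) ((x ^ p) ^ p ^ m)"
        using assms by (simp add: power_mult[symmetric] mult.commute cg_refl power_closed)
    qed (use Suc in simp)
    finally show ?case by simp
  qed (use p_gt_1 in \<open>simp add: zero_power cg_refl\<close>)
  from this[of f] have "cg (trc x ^ p) (trc (x ^ p))" by (simp only: trc_def)
  also note trc_frob[OF assms]
  finally show ?thesis .
qed

text \<open>The representative of \<open>trc x\<close> is fixed by the Frobenius, hence comes from
  an integer.\<close>

lemma tr_exists:
  assumes "x \<in> A"
  obtains k where "k < p" "cg (of_nat k) (trc x)"
proof -
  let ?s = "tau (trc x)"
  have "cg (?s ^ p) (trc x ^ p)" using assms by (intro cg_power cg_sym[OF cg_tau]) auto
  also have "cg \<dots> (trc x)" by (rule trc_power_p[OF assms])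
  also have "cg \<dots> ?s" using assms by (intro cg_tau) auto
  finally have "?s ^ p = ?s"
    using assms p_gt_1 by (intro T_cg_imp_eq T_power tau_mem) auto
  then obtain k where "k < p" "?s = tau (of_nat k)"
    using fixed_frob_T tau_mem[of "trc x"] assms by auto
  then have "cg (trc x) (of_nat k)" using assms by (subst tau_eq_iff[symmetric]) auto
  then show thesis using that[OF \<open>k < p\<close> cg_sym] by blast
qed

lemma zeta_power_p: "\<zeta> ^ p = 1"
proof -
  have "\<zeta> ^ 1 \<in> unity_roots p" unfolding zeta by blast
  then show ?thesis by (simp add: unity_roots_def)
qed

lemma zeta_power_mod: "\<zeta> ^ (k mod p) = \<zeta> ^ k"
proof -
  have "\<zeta> ^ k = \<zeta> ^ (p * (k div p) + k mod p)" by simp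
  then show ?thesis unfolding power_add power_mult zeta_power_p by simp
qed

text \<open>The powers with exponent below \<open>p\<close> exhaust the \<open>p\<close> roots of
  unity of order dividing \<open>p\<close>, so they are distinct; this is the primitivity of
  \<open>\<zeta>\<close>.\<close>

lemma zeta_power_eq_iff: "\<zeta> ^ k = \<zeta> ^ l \<longleftrightarrow> k mod p = l mod p"
proof -
  have "unity_roots p = (\<lambda>k. \<zeta> ^ k) ` {..<p}"
  proof
    show "unity_roots p \<subseteq> (\<lambda>k. \<zeta> ^ k) ` {..<p}"
      unfolding zeta using p_gt_1
      by (auto simp: image_iff intro!: bexI[of _ "_ mod p"] simp: zeta_power_mod)
  qed (auto simp: zeta)
  moreover have "card (unity_roots p) = p"
    unfolding unity_roots_def using p_gt_1 by (intro card_roots_unity_eq) auto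
  ultimately have "inj_on (\<lambda>k. \<zeta> ^ k) {..<p}"
    by (intro eq_card_imp_inj_on) auto
  then have "\<zeta> ^ (k mod p) = \<zeta> ^ (l mod p) \<longleftrightarrow> k mod p = l mod p"
    using p_gt_1 by (auto simp: inj_on_def)
  then show ?thesis by (simp add: zeta_power_mod)
qed

lemma zeta_nz: "\<zeta> \<noteq> 0"
  using zeta_power_p p_gt_1 by (auto simp: zero_power)

definition psi :: "complex \<Rightarrow> complex" where
  "psi x = \<zeta> ^ tr x"

lemma
  assumes "x \<in> A"
  shows tr_less: "tr x < p" and cg_tr: "cg (of_nat (tr x)) (trc x)"
proof -
  obtain k where k: "k < p" "cg (of_nat k) (trc x)" using tr_exists[OF assms] .
  have "\<exists>!k. k < p \<and> cg (of_nat k) (trc x)"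
  proof (rule ex1I[of _ k])
    fix l assume "l < p \<and> cg (of_nat l) (trc x)"
    then have "cg (of_nat l) (of_nat k)" using k cg_sym cg_trans by blast
    then show "l = k" using \<open>l < p \<and> _\<close> k(1) by (simp add: cg_nat_iff)
  qed (use k in auto)
  then have "tr x < p \<and> cg (of_nat (tr x)) (trc x)" unfolding tr_def by (rule theI')
  then show "tr x < p" "cg (of_nat (tr x)) (trc x)" by auto
qed

lemma psi_eqI:
  assumes "x \<in> A" "cg (of_nat k) (trc x)"
  shows "psi x = \<zeta> ^ k"
proof -
  have "cg (of_nat (tr x)) (of_nat k)"
    using cg_tr[OF assms(1)] assms(2) cg_trans cg_sym by blast
  then show ?thesis unfolding psi_def zeta_power_eq_iff cg_nat_iff .
qed

lemma psi_add:
  assumes "x \<in> A" "y \<in> A"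
  shows "psi (x + y) = psi x * psi y"
proof -
  have "cg (of_nat (tr x) + of_nat (tr y)) (trc x + trc y)"
    using assms cg_tr by blast
  also have "cg \<dots> (trc (x + y))" using trc_add assms cg_sym by blast
  finally have "psi (x + y) = \<zeta> ^ (tr x + tr y)"
    using assms by (intro psi_eqI) auto
  then show ?thesis by (simp add: psi_def power_add)
qed

lemma psi_cong:
  assumes "cg x y"
  shows "psi x = psi y"
proof -
  have "cg (of_nat (tr y)) (trc y)" using assms by (intro cg_tr cg_closed)
  also have "cg (trc y) (trc x)" using trc_cong[OF assms] by (rule cg_sym)
  finally have "psi x = \<zeta> ^ tr y" using assms by (intro psi_eqI cg_closed)
  then show ?thesis by (simp add: psi_def)
qed

lemma psi_0 [simp]: "psi 0 = 1"
  using psi_add[of 0 0] zeta_nz by (simp add: psi_def)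

lemma psi_frob:
  assumes "x \<in> A"
  shows "psi (x ^ p) = psi x"
proof -
  have "cg (of_nat (tr x)) (trc x)" using assms by (rule cg_tr)
  also have "cg (trc x) (trc (x ^ p))" using trc_frob[OF assms] by (rule cg_sym)
  finally have "psi (x ^ p) = \<zeta> ^ tr x" using assms by (intro psi_eqI) auto
  then show ?thesis by (simp add: psi_def)
qed

lemma psi_mult_nat: "x \<in> A \<Longrightarrow> psi (of_nat k * x) = psi x ^ k"
proof (induction k)
  case (Suc k)
  then show ?case using psi_add[of x "of_nat k * x"] by (auto simp: distrib_right)
qed simp

lemma psi_power_p: "psi x ^ p = 1"
  unfolding psi_def by (subst power_mult[symmetric], subst mult.commute, subst power_mult) (simp add: zeta_power_p)

lemma psi_root: "psi x ^ (p * (q - 1)) = 1"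
  by (simp add: power_mult psi_power_p)

lemma psi_closed [intro]: "psi x \<in> A"
  by (rule roots_mem[OF psi_root])

lemma psi_norm: "norm (psi x) = 1"
  using power_eq_1_iff[OF psi_power_p] p_gt_1 by auto

lemma psi_minus:
  assumes "x \<in> A"
  shows "psi (- x) = cnj (psi x)"
proof -
  have "psi (- x) * psi x = 1" using psi_add[of "-x" x] assms by auto
  moreover have "cnj (psi x) * psi x = 1"
    using psi_norm[of x] complex_norm_square[of "psi x"] by (simp add: mult.commute)
  ultimately show ?thesis by (metis mult_cancel_right mult_zero_right zero_neq_one)
qed

text \<open>By the Frobenius congruence \<open>(psi x - 1) ^ p\<close> is congruent to
  \<open>psi x ^ p - 1 = 0\<close>, and \<open>P\<close> is prime.\<close>

lemma cg_psi_1: "cg (psi x) 1"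
proof -
  have "cg ((psi x - 1 + 1) ^ (p ^ 1)) ((psi x - 1) ^ (p ^ 1) + 1 ^ (p ^ 1))"
    by (rule cg_power_p_add) auto
  then have "cg 1 ((psi x - 1) ^ p + 1)" by (simp add: psi_power_p)
  then have "cg (1 - ((psi x - 1) ^ p + 1)) ((psi x - 1) ^ p + 1 - ((psi x - 1) ^ p + 1))"
    by (intro cg_diff cg_refl) auto
  then have "(psi x - 1) ^ p \<in> P"
    unfolding cg_def using ideal_diff[of 0 "- ((psi x - 1) ^ p)"] by simp
  then have "psi x - 1 \<in> P" using P_power[of "psi x - 1" p] by auto
  then show ?thesis by (auto simp: cg_def)
qed

text \<open>Were \<open>psi\<close> trivial on \<open>mu\<close>, all traces would vanish modulo
  \<open>P\<close>. Summing them against \<open>inverse z\<close> extracts the coefficient of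
  \<open>z\<close> in the trace polynomial and yields \<open>q - 1\<close>, which is not in
  \<open>P\<close>.\<close>

lemma psi_nontrivial:
  obtains z where "z \<in> mu" "psi z \<noteq> 1"
proof -
  have "\<exists>z\<in>mu. psi z \<noteq> 1"
  proof (rule ccontr)
    assume *: "\<not> (\<exists>z\<in>mu. psi z \<noteq> 1)"
    have "cg 0 (trc z)" if "z \<in> mu" for z
    proof -
      have "\<zeta> ^ tr z = \<zeta> ^ 0" using * that by (simp add: psi_def)
      then have "tr z = 0" unfolding zeta_power_eq_iff using tr_less[OF mu_mem[OF that]] by simp
      then show ?thesis using cg_tr[OF mu_mem[OF that]] by simp
    qed
    then have "cg (\<Sum>z\<in>mu. inverse z * 0) (\<Sum>z\<in>mu. inverse z * trc z)"
      by (blast intro: cg_sum cg_mult cg_refl mu_mem mu_inverse)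
    moreover have "(\<Sum>z\<in>mu. inverse z * trc z) = of_nat (q - 1)"
    proof -
      have "(\<Sum>z\<in>mu. inverse z * trc z) = (\<Sum>z\<in>mu. \<Sum>i<f. z powi (int (p ^ i) - 1))"
        unfolding trc_def sum_distrib_left
      proof (intro sum.cong refl)
        fix z i assume "z \<in> mu"
        then have "z \<noteq> 0" by (rule mu_nz)
        then have "z powi (int (p ^ i) - 1) = z powi int (p ^ i) / z"
          by (subst power_int_diff) auto
        then show "inverse z * z ^ p ^ i = z powi (int (p ^ i) - 1)"
          by (simp only: power_int_of_nat divide_inverse mult.commute)
      qed
      also have "\<dots> = (\<Sum>i<f. \<Sum>z\<in>mu. z powi (int (p ^ i) - 1))" by (rule sum.swap)
      also have "\<dots> = (\<Sum>i<f. if i = 0 then of_nat (q - 1) else 0)"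
      proof (rule sum.cong)
        fix i assume i: "i \<in> {..<f}"
        have "int (q - 1) dvd int (p ^ i) - 1 \<longleftrightarrow> i = 0"
        proof (cases "i = 0")
          case False
          then have "p ^ i > 1" using p_gt_1 by (intro one_less_power) auto
          moreover have "p ^ i < q" unfolding q_eq using i p_gt_1 by simp
          ultimately have "\<not> (q - 1) dvd (p ^ i - 1)"
            by (intro nat_dvd_not_less) auto
          moreover have "int (p ^ i) - 1 = int (p ^ i - 1)"
            using \<open>p ^ i > 1\<close> by (subst of_nat_diff) auto
          ultimately have "\<not> int (q - 1) dvd int (p ^ i) - 1"
            by (simp only: int_dvd_int_iff not_False_eq_True)
          then show ?thesis using False by blast
        qed simp
        then show "(\<Sum>z\<in>mu. z powi (int (p ^ i) - 1)) = (if i = 0 then of_nat (q - 1) else 0)"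
          by (simp only: sum_mu_powi)
      qed simp
      also have "\<dots> = of_nat (q - 1)" using f_pos by simp
      finally show ?thesis .
    qed
    ultimately have "cg 0 (of_nat (q - 1))" by simp
    from cg_sym[OF this] have "of_nat (q - 1) \<in> P" unfolding cg_0_iff .
    then show False using q_minus_1_notin_P by blast
  qed
  then show thesis using that by blast
qed

lemma sum_psi_T:
  assumes "a \<in> A"
  shows "(\<Sum>x\<in>T. psi (a * x)) = (if a \<in> P then of_nat q else 0)"
proof (cases "a \<in> P")
  case True
  have "psi (a * x) = 1" if "x \<in> T" for x
  proof -
    have "x * a \<in> P" using True that by (intro ideal_absorb) auto
    then show ?thesis using psi_cong[of "a * x" 0] by (simp add: cg_0_iff mult.commute)
  qed
  then show ?thesis using True by (simp add: card_T)
next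
  case False
  obtain z where z: "z \<in> mu" "psi z \<noteq> 1" by (rule psi_nontrivial)
  have ta: "tau a \<in> mu" using False assms tau_mu by blast
  \<comment> \<open>Chosen so that \<open>a * y\<close> reduces to \<open>z\<close>, where
    \<open>psi\<close> is nontrivial; translation by \<open>y\<close> then multiplies the sum by a
    factor other than 1.\<close>
  define y where "y = z / tau a"
  have y: "y \<in> mu" unfolding y_def using z ta by (intro mu_divide)
  have "cg (a * y) (tau a * y)" using assms y cg_tau by blast
  also have "tau a * y = z" using ta mu_nz by (simp add: y_def)
  finally have ay: "psi (a * y) \<noteq> 1" using psi_cong z(2) by metis
  have "(\<Sum>x\<in>T. psi (a * x)) = (\<Sum>x\<in>T. psi (a * tau (x + y)))"
    using y by (intro sum.reindex_bij_betw[symmetric] bij_tau_shift) auto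
  also have "\<dots> = (\<Sum>x\<in>T. psi (a * x) * psi (a * y))"
  proof (rule sum.cong)
    fix x assume x: "x \<in> T"
    have "cg (a * tau (x + y)) (a * (x + y))"
      using assms x y by (intro cg_mult cg_refl cg_sym[OF cg_tau]) auto
    then have "psi (a * tau (x + y)) = psi (a * x + a * y)"
      using psi_cong by (simp add: distrib_left)
    also have "\<dots> = psi (a * x) * psi (a * y)" using assms x y by (intro psi_add) auto
    finally show "psi (a * tau (x + y)) = psi (a * x) * psi (a * y)" .
  qed simp
  also have "\<dots> = psi (a * y) * (\<Sum>x\<in>T. psi (a * x))"
    by (simp add: sum_distrib_left mult.commute)
  finally show ?thesis using ay False by simp
qed

lemma sum_psi_mu:
  assumes "a \<in> A"
  shows "(\<Sum>x\<in>mu. psi (a * x)) = (if a \<in> P then of_nat q - 1 else - 1)"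
proof -
  have "1 + (\<Sum>x\<in>mu. psi (a * x)) = (\<Sum>x\<in>T. psi (a * x))"
    by (simp add: T_def)
  then have "(\<Sum>x\<in>mu. psi (a * x)) = (\<Sum>x\<in>T. psi (a * x)) - 1"
    by (simp add: algebra_simps)
  then show ?thesis unfolding sum_psi_T[OF assms] by simp
qed

end

section \<open>Gauss and Jacobi sums\<close>

context residue_setup
begin

definition G :: "int \<Rightarrow> complex" where
  "G c = (\<Sum>z\<in>mu. z powi (- c) * psi z)"

text \<open>The Jacobi sum of the powers \<open>-a\<close> and \<open>-b\<close> of the Teichmueller
  character; \<open>x = 1\<close> is left out because \<open>1 - x\<close> is then 0, on which no
  multiplicative character is evaluated.\<close>

definition J :: "int \<Rightarrow> int \<Rightarrow> complex" where
  "J a b = (\<Sum>x\<in>mu - {1}. x powi (- a) * tau (1 - x) powi (- b))"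

lemma G_cong:
  assumes "int (q - 1) dvd c - d"
  shows "G c = G d"
proof -
  have "int (q - 1) dvd (- c) - (- d)"
    using assms by (metis dvd_minus_iff minus_diff_eq minus_diff_minus)
  then show ?thesis unfolding G_def using mu_powi_cong by (intro sum.cong) simp_all
qed

lemma G_0: "G 0 = - 1"
proof -
  have "1 \<notin> P" by (rule one_notin_P)
  then show ?thesis using sum_psi_mu[of 1] by (simp add: G_def)
qed

lemma G_mem [intro]: "G c \<in> A"
  unfolding G_def using mu_powi by (intro sum_closed mult_closed psi_closed mu_mem)

lemma G_cyc: "G c \<in> cyc_ints (p * (q - 1))"
  unfolding G_def
proof (intro cyc_ints_sum cyc_ints_mult)
  fix z assume "z \<in> mu"
  then show "z powi (- c) \<in> cyc_ints (p * (q - 1))"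
    using mu_powi mu_root n_pos by (intro cyc_ints_root) simp_all
qed (use cyc_ints_root[OF n_pos psi_root] in blast)

lemma bij_mu_frob: "bij_betw (\<lambda>z. z ^ p) mu mu"
proof -
  have "inj_on (\<lambda>z. z ^ p) mu"
  proof (rule inj_onI)
    fix z w assume zw: "z \<in> mu" "w \<in> mu" "z ^ p = w ^ p"
    obtain g where g: "f = Suc g" using f_pos not0_implies_Suc[of f] by auto
    have "z ^ q = (z ^ p) ^ (p ^ g)" "w ^ q = (w ^ p) ^ (p ^ g)"
      unfolding q_eq g power_Suc power_mult by simp_all
    then show "z = w" using zw mu_power_q by simp
  qed
  moreover have "(\<lambda>z. z ^ p) ` mu \<subseteq> mu"
    using mu_power by (intro image_subsetI)
  ultimately show ?thesis
    using endo_inj_surj[OF finite_mu] by (simp add: bij_betw_def)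
qed

text \<open>The Frobenius permutes \<open>mu\<close> and leaves \<open>psi\<close> unchanged, so it
  only multiplies the exponent by \<open>p\<close>.\<close>

lemma G_frob: "G (int p * c) = G c"
proof -
  have "G c = (\<Sum>z\<in>mu. (z ^ p) powi (- c) * psi (z ^ p))"
    unfolding G_def by (rule sum.reindex_bij_betw[OF bij_mu_frob, symmetric])
  also have "\<dots> = (\<Sum>z\<in>mu. z powi (- (int p * c)) * psi z)"
  proof (rule sum.cong)
    fix z assume "z \<in> mu"
    then have "psi (z ^ p) = psi z" by (intro psi_frob mu_mem)
    moreover have "(z ^ p) powi (- c) = z powi (- (int p * c))"
      using power_int_mult[of z "int p" "- c"] by simp
    ultimately show "(z ^ p) powi (- c) * psi (z ^ p) = z powi (- (int p * c)) * psi z" by simp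
  qed simp
  finally show ?thesis by (simp add: G_def)
qed

lemma mu_minus_1_mem_P_iff: "w \<in> mu \<Longrightarrow> w - 1 \<in> P \<longleftrightarrow> w = 1"
  using T_cg_imp_eq[of w 1] mu_mem[of w] by (auto simp: cg_def T_def)

text \<open>Writing \<open>x = w * y\<close> turns the sum over \<open>y\<close> into a full
  additive character sum in \<open>w - 1\<close>; orthogonality keeps the term \<open>w = 1\<close>,
  and the rest is a nontrivial multiplicative character sum.\<close>

lemma G_norm:
  assumes "\<not> int (q - 1) dvd c"
  shows "G c * cnj (G c) = of_nat q"
proof -
  have "G c * cnj (G c) = (\<Sum>y\<in>mu. \<Sum>x\<in>mu. (x powi (- c) * psi x) * (y powi c * psi (- y)))"
  proof -
    have "cnj (y powi (- c) * psi y) = y powi c * psi (- y)" if y: "y \<in> mu" for y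
    proof -
      have "cnj (y powi (- c)) = inverse y powi (- c)" using mu_cnj[OF y] by simp
      also have "\<dots> = y powi c" by (simp only: power_int_inverse power_int_minus inverse_inverse_eq)
      finally show ?thesis using psi_minus[OF mu_mem[OF y]] by simp
    qed
    then show ?thesis
      unfolding G_def cnj_sum sum_product by (subst sum.swap) (intro sum.cong refl, simp)
  qed
  also have "\<dots> = (\<Sum>y\<in>mu. \<Sum>w\<in>mu. w powi (- c) * psi ((w - 1) * y))"
  proof (rule sum.cong)
    fix y assume y: "y \<in> mu"
    have "(\<Sum>x\<in>mu. (x powi (- c) * psi x) * (y powi c * psi (- y))) =
      (\<Sum>w\<in>mu. ((w * y) powi (- c) * psi (w * y)) * (y powi c * psi (- y)))"
      by (rule sum.reindex_bij_witness[of _ "\<lambda>w. w * y" "\<lambda>x. x / y"])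
        (use y mu_nz mu_mult mu_divide in auto)
    also have "\<dots> = (\<Sum>w\<in>mu. w powi (- c) * psi ((w - 1) * y))"
    proof (rule sum.cong)
      fix w assume w: "w \<in> mu"
      have "psi ((w - 1) * y) = psi (w * y + - y)" by (simp add: algebra_simps)
      also have "\<dots> = psi (w * y) * psi (- y)"
        using w y by (intro psi_add) auto
      finally have "psi ((w - 1) * y) = psi (w * y) * psi (- y)" .
      moreover have "y powi (- c) * y powi c = 1"
        using mu_nz[OF y] by (simp add: power_int_minus)
      ultimately show "((w * y) powi (- c) * psi (w * y)) * (y powi c * psi (- y)) = w powi (- c) * psi ((w - 1) * y)"
        by (simp add: power_int_mult_distrib mult_ac)
    qed simp
    finally show "(\<Sum>x\<in>mu. (x powi (- c) * psi x) * (y powi c * psi (- y))) = (\<Sum>w\<in>mu. w powi (- c) * psi ((w - 1) * y))" .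
  qed simp
  also have "\<dots> = (\<Sum>w\<in>mu. w powi (- c) * (\<Sum>y\<in>mu. psi ((w - 1) * y)))"
    unfolding sum_distrib_left by (rule sum.swap)
  also have "\<dots> = (\<Sum>w\<in>mu. (if w = 1 then of_nat q else 0) - w powi (- c))"
  proof (rule sum.cong)
    fix w assume w: "w \<in> mu"
    have "(\<Sum>y\<in>mu. psi ((w - 1) * y)) = (if w = 1 then of_nat q - 1 else - 1)"
      using sum_psi_mu[OF diff_closed[OF mu_mem[OF w] one_closed]] mu_minus_1_mem_P_iff[OF w] by simp
    then show "w powi (- c) * (\<Sum>y\<in>mu. psi ((w - 1) * y)) = (if w = 1 then of_nat q else 0) - w powi (- c)"
      by (simp add: algebra_simps)
  qed simp
  also have "\<dots> = of_nat q"
    using assms by (simp add: sum_subtractf sum_mu_powi)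
  finally show ?thesis .
qed

lemma G_norm_abs:
  assumes "\<not> int (q - 1) dvd c"
  shows "norm (G c) ^ 2 = real q"
proof -
  have "complex_of_real (norm (G c) ^ 2) = complex_of_real (real q)"
    using G_norm[OF assms] complex_norm_square[of "G c"] by simp
  then show ?thesis unfolding of_real_eq_iff .
qed

lemma G_nz: "\<not> int (q - 1) dvd c \<Longrightarrow> G c \<noteq> 0"
  using G_norm[of c] q_gt_2 by auto

lemma one_minus_mu_notin_P: "u \<in> mu - {1} \<Longrightarrow> 1 - u \<notin> P"
  using mu_minus_1_mem_P_iff[of u] ideal_diff[of 0 "1 - u"] by auto

lemma tau_1_minus: "u \<in> mu - {1} \<Longrightarrow> tau (1 - u) \<in> mu"
  using one_minus_mu_notin_P by (intro tau_mu) auto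

lemma powi_minus_add:
  fixes t :: complex
  shows "t \<noteq> 0 \<Longrightarrow> t powi (- (a + b)) = t powi (- a) * t powi (- b)"
  using power_int_add[of t "- a" "- b"] by simp

text \<open>The double sum is split according to whether \<open>x + y\<close> reduces to 0. The
  degenerate pairs contribute a multiple of a nontrivial character sum, that is, nothing; the others
  are rescaled by the representative of \<open>x + y\<close>.\<close>

lemma G_mult:
  assumes "\<not> int (q - 1) dvd a + b"
  shows "G a * G b = J a b * G (a + b)"
proof -
  define F where "F = (\<lambda>(x, y). x powi (- a) * y powi (- b) * psi (x + y))"
  have "G a * G b = (\<Sum>(x, y)\<in>mu \<times> mu. (x powi (- a) * psi x) * (y powi (- b) * psi y))"
    unfolding G_def sum_product by (simp add: sum.cartesian_product)
  also have "\<dots> = sum F (mu \<times> mu)"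
    unfolding F_def by (intro sum.cong refl) (auto simp: psi_add mu_mem)
  also have "\<dots> = sum F {s \<in> mu \<times> mu. fst s + snd s \<in> P} + sum F {s \<in> mu \<times> mu. fst s + snd s \<notin> P}"
    by (subst sum.union_disjoint[symmetric]) (auto intro!: sum.cong)
  \<comment> \<open>Degenerate pairs have the second entry opposite to the first in the residue
    field. The factor is \<open>tau (-1)\<close> and not -1, because -1 does not lie in
    \<open>mu\<close> when \<open>p = 2\<close>.\<close>
  also have "sum F {s \<in> mu \<times> mu. fst s + snd s \<in> P} = (\<Sum>x\<in>mu. tau (-1) powi (- b) * x powi (- (a + b)))"
  proof (rule sum.reindex_bij_witness[of _ "\<lambda>x. (x, tau (-1) * x)" fst])
    have t1: "tau (-1) \<in> mu" using one_notin_P ideal_diff[of 0 "-1"] by (intro tau_mu) auto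
    have eq: "snd s = tau (-1) * fst s" if s: "s \<in> {s \<in> mu \<times> mu. fst s + snd s \<in> P}" for s
    proof (rule T_cg_imp_eq)
      have "cg (snd s) (-1 * fst s)" using s by (auto simp: cg_def add.commute intro!: minus_closed)
      also have "cg (-1 * fst s) (tau (-1) * fst s)"
        using s by (intro cg_mult cg_tau cg_refl) auto
      finally show "cg (snd s) (tau (-1) * fst s)" .
    qed (use s t1 in \<open>auto simp: T_def intro: mu_mult\<close>)
    then show "(fst s, tau (-1) * fst s) = s" if "s \<in> {s \<in> mu \<times> mu. fst s + snd s \<in> P}" for s
      using eq[OF that] by (simp add: prod_eq_iff)
    show "fst s \<in> mu" if "s \<in> {s \<in> mu \<times> mu. fst s + snd s \<in> P}" for s using that by auto
    show "(x, tau (-1) * x) \<in> {s \<in> mu \<times> mu. fst s + snd s \<in> P}" if "x \<in> mu" for x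
    proof -
      have "cg (x * -1) (x * tau (-1))" using that by (intro cg_mult cg_tau cg_refl) auto
      from cg_add[OF cg_refl[OF mu_mem[OF that]] cg_sym[OF this]]
      have "cg (x + tau (-1) * x) 0" by (simp add: mult.commute)
      then show ?thesis using that mu_mult[OF t1 that] by (simp add: cg_0_iff)
    qed
    show "tau (-1) powi (- b) * fst s powi (- (a + b)) = F s"
      if s: "s \<in> {s \<in> mu \<times> mu. fst s + snd s \<in> P}" for s
    proof -
      have "psi (fst s + snd s) = 1" using s psi_cong[of "fst s + snd s" 0] by (auto simp: cg_0_iff)
      moreover have "fst s \<noteq> 0" using s mu_nz by auto
      ultimately show ?thesis unfolding F_def split_def powi_minus_add[OF \<open>fst s \<noteq> 0\<close>]
        by (simp only: eq[OF s] power_int_mult_distrib mult_ac mult_1_left mult_1_right)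
    qed
  qed auto
  also have "\<dots> = tau (-1) powi (- b) * (\<Sum>x\<in>mu. x powi (- (a + b)))"
    by (simp add: sum_distrib_left)
  also have "(\<Sum>x\<in>mu. x powi (- (a + b))) = 0"
    using assms by (simp only: sum_mu_powi dvd_minus_iff if_False)
  \<comment> \<open>With \<open>t = tau (x + y)\<close> and \<open>u = x / t\<close>, the second
    entry becomes \<open>t * tau (1 - u)\<close>, and the sum factors into a part in
    \<open>u\<close> and a part in \<open>t\<close>.\<close>
  also have "sum F {s \<in> mu \<times> mu. fst s + snd s \<notin> P} =
     (\<Sum>(u, t)\<in>(mu - {1}) \<times> mu. (u powi (- a) * tau (1 - u) powi (- b)) * (t powi (- (a + b)) * psi t))"
  proof (rule sum.reindex_bij_witness[of _ "\<lambda>(u, t). (t * u, t * tau (1 - u))"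
        "\<lambda>(x, y). (x / tau (x + y), tau (x + y))"])
    show "(case (case s of (x, y) \<Rightarrow> (x / tau (x + y), tau (x + y))) of
        (u, t) \<Rightarrow> (t * u, t * tau (1 - u))) = s"
      and "(case s of (x, y) \<Rightarrow> (x / tau (x + y), tau (x + y))) \<in> (mu - {1}) \<times> mu"
      and "(case (case s of (x, y) \<Rightarrow> (x / tau (x + y), tau (x + y))) of
        (u, t) \<Rightarrow> u powi (- a) * tau (1 - u) powi (- b) * (t powi (- (a + b)) * psi t)) = F s"
      if "s \<in> {s \<in> mu \<times> mu. fst s + snd s \<notin> P}" for s
    proof -
      obtain x y where s: "s = (x, y)" by (cases s)
      have xy: "x \<in> mu" "y \<in> mu" "x + y \<notin> P" using that s by auto
      define t where "t = tau (x + y)"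
      have t: "t \<in> mu" unfolding t_def using xy by (intro tau_mu) auto
      have ct: "cg t (x + y)" unfolding t_def using xy by (intro cg_sym[OF cg_tau]) auto
      define u where "u = x / t"
      have u: "u \<in> mu" unfolding u_def using xy t mu_divide by simp
      have "cg (inverse t * t) (inverse t * (x + y))"
        using t mu_inverse by (intro cg_mult cg_refl ct) auto
      then have "cg 1 (u + y / t)"
        using mu_nz[OF t] by (simp add: u_def field_simps)
      from cg_diff[OF this cg_refl[of u]] u have "cg (1 - u) (y / t)" by auto
      then have tu: "tau (1 - u) = y / t"
        using mu_divide[OF xy(2) t] by (intro tau_eqI) (auto simp: T_def)
      have "u \<noteq> 1"
      proof
        assume "u = 1"
        then have "t = x" using mu_nz[OF t] by (simp add: u_def)
        from cg_diff[OF ct[unfolded this] cg_refl[of x]] xy have "cg 0 y" by auto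
        from cg_sym[OF this] mu_notin_P[OF xy(2)] show False by (simp add: cg_0_iff)
      qed
      then show "(case s of (x, y) \<Rightarrow> (x / tau (x + y), tau (x + y))) \<in> (mu - {1}) \<times> mu"
        using u t by (simp add: s t_def u_def)
      show "(case (case s of (x, y) \<Rightarrow> (x / tau (x + y), tau (x + y))) of
        (u, t) \<Rightarrow> (t * u, t * tau (1 - u))) = s"
        using mu_nz[OF t] tu by (simp add: s t_def[symmetric] u_def[symmetric]) (simp add: u_def)
      have "psi (x + y) = psi t" using psi_cong[OF ct] by simp
      moreover have "t * u = x" "t * tau (1 - u) = y" using mu_nz[OF t] by (simp add: u_def, simp add: tu)
      ultimately have "F s = (t * u) powi (- a) * (t * tau (1 - u)) powi (- b) * psi t"
        by (simp only: F_def s prod.case)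
      also have "\<dots> = u powi (- a) * tau (1 - u) powi (- b) * (t powi (- (a + b)) * psi t)"
        unfolding powi_minus_add[OF mu_nz[OF t]] power_int_mult_distrib by (simp only: mult_ac)
      finally show "(case (case s of (x, y) \<Rightarrow> (x / tau (x + y), tau (x + y))) of
        (u, t) \<Rightarrow> u powi (- a) * tau (1 - u) powi (- b) * (t powi (- (a + b)) * psi t)) = F s"
        by (simp add: s t_def[symmetric] u_def[symmetric])
    qed
    show "(case (case s of (u, t) \<Rightarrow> (t * u, t * tau (1 - u))) of (x, y) \<Rightarrow> (x / tau (x + y), tau (x + y))) = s"
      and "(case s of (u, t) \<Rightarrow> (t * u, t * tau (1 - u))) \<in> {s \<in> mu \<times> mu. fst s + snd s \<notin> P}"
      if "s \<in> (mu - {1}) \<times> mu" for s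
    proof -
      obtain u t where s: "s = (u, t)" by (cases s)
      have u: "u \<in> mu - {1}" and t: "t \<in> mu" using that s by auto
      have "cg (t * u + t * tau (1 - u)) (t * u + t * (1 - u))"
        using u t by (intro cg_add cg_mult cg_refl cg_sym[OF cg_tau]) auto
      then have ct: "cg (t * u + t * tau (1 - u)) t" by (simp add: algebra_simps)
      then have tt: "tau (t * u + t * tau (1 - u)) = t" using t by (intro tau_eqI) (auto simp: T_def)
      then show "(case (case s of (u, t) \<Rightarrow> (t * u, t * tau (1 - u))) of (x, y) \<Rightarrow> (x / tau (x + y), tau (x + y))) = s"
        using mu_nz[OF t] by (simp add: s)
      have "t * u + t * tau (1 - u) \<notin> P"
      proof
        assume "t * u + t * tau (1 - u) \<in> P"
        then have "cg (t * u + t * tau (1 - u)) 0" by (simp add: cg_0_iff)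
        from cg_trans[OF cg_sym[OF ct] this] have "t \<in> P" by (simp add: cg_0_iff)
        then show False using mu_notin_P[OF t] by simp
      qed
      then show "(case s of (u, t) \<Rightarrow> (t * u, t * tau (1 - u))) \<in> {s \<in> mu \<times> mu. fst s + snd s \<notin> P}"
        using u t tau_1_minus[OF u] mu_mult by (simp add: s)
    qed
  qed
  also have "\<dots> = J a b * G (a + b)"
    unfolding J_def G_def sum_product by (simp add: sum.cartesian_product)
  finally show ?thesis by simp
qed

end

section \<open>Stickelberger's congruence\<close>

lemma digit_0: "digit p (int c) 0 = c mod p"
  by (simp add: digit_def)

lemma digit_mult_Suc: "p > 0 \<Longrightarrow> digit p (int (p * d)) (Suc j) = digit p (int d) j"
  by (simp add: digit_def nat_mult_distrib div_mult2_eq flip: of_nat_mult)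

lemma digit_pred_Suc:
  assumes "c mod p \<noteq> 0"
  shows "digit p (int (c - 1)) (Suc j) = digit p (int c) (Suc j)"
proof -
  have "(c - 1) div p = c div p"
  proof (cases c)
    case (Suc b)
    then show ?thesis using assms div_Suc[of b p] by simp
  qed simp
  then show ?thesis by (simp add: digit_def div_mult2_eq)
qed

lemma digit_pred_0:
  assumes "c mod p \<noteq> 0"
  shows "digit p (int c) 0 = Suc (digit p (int (c - 1)) 0)"
proof (cases c)
  case (Suc b)
  then show ?thesis unfolding digit_0 using assms mod_Suc[of b p] by (simp split: if_splits)
qed (use assms in simp)

lemma digit_last_eq_0: "c < p ^ j \<Longrightarrow> digit p (int c) j = 0"
  by (simp add: digit_def)

lemma digit_sum_pred:
  assumes "c mod p \<noteq> 0" "f \<ge> 1"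
  shows "digit_sum p f (int c) = Suc (digit_sum p f (int (c - 1)))"
proof -
  obtain g where "f = Suc g" using assms(2) by (cases f) auto
  then show ?thesis
    unfolding digit_sum_def
    by (simp only: sum.lessThan_Suc_shift digit_pred_Suc[OF assms(1)] digit_pred_0[OF assms(1)] add_Suc)
qed

lemma digit_fact_prod_pred:
  assumes "c mod p \<noteq> 0" "f \<ge> 1"
  shows "digit_fact_prod p f (int c) = (c mod p) * digit_fact_prod p f (int (c - 1))"
proof -
  obtain g where "f = Suc g" using assms(2) by (cases f) auto
  moreover have "fact (digit p (int c) 0) = (c mod p) * fact (digit p (int (c - 1)) 0)"
    using digit_pred_0[OF assms(1)] unfolding digit_0 by simp
  ultimately show ?thesis
    unfolding digit_fact_prod_def
    by (simp only: prod.lessThan_Suc_shift digit_pred_Suc[OF assms(1)] mult.assoc)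
qed

text \<open>Below \<open>p ^ f\<close>, multiplication by \<open>p\<close> rotates the digits
  cyclically: the top digit of \<open>d\<close> is 0 and reappears as the bottom digit of the
  product.\<close>

lemma
  assumes "p * d < p ^ f" "f \<ge> 1" "p > 0"
  shows digit_sum_mult: "digit_sum p f (int (p * d)) = digit_sum p f (int d)"
    and digit_fact_prod_mult: "digit_fact_prod p f (int (p * d)) = digit_fact_prod p f (int d)"
    and digit_cyclic_corr_mult: "digit_cyclic_corr p f (int (p * d)) = digit_cyclic_corr p f (int d)"
proof -
  obtain g where f: "f = Suc g" using assms(2) by (cases f) auto
  have "d < p ^ g" using assms by (simp add: f)
  then have last: "digit p (int d) g = 0" by (rule digit_last_eq_0)
  have zero: "digit p (int (p * d)) 0 = 0" unfolding digit_0 by simp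
  note shift = digit_mult_Suc[OF assms(3)]
  show "digit_sum p f (int (p * d)) = digit_sum p f (int d)"
    unfolding digit_sum_def f by (subst sum.lessThan_Suc_shift) (simp only: sum.lessThan_Suc shift zero last)
  show "digit_fact_prod p f (int (p * d)) = digit_fact_prod p f (int d)"
    unfolding digit_fact_prod_def f
    by (subst prod.lessThan_Suc_shift, subst prod.lessThan_Suc, simp only: shift zero last, rule mult.commute)
  have "digit_cyclic_corr p f (int (p * d)) =
      (\<Sum>j<g. digit p (int d) j * digit p (int (p * d)) (Suc (Suc j) mod f))"
    unfolding digit_cyclic_corr_def f by (subst sum.lessThan_Suc_shift) (simp only: shift zero mult_zero_left add_0)
  also have "\<dots> = (\<Sum>j<g. digit p (int d) j * digit p (int d) (Suc j mod f))"
  proof (rule sum.cong)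
    fix j assume j: "j \<in> {..<g}"
    show "digit p (int d) j * digit p (int (p * d)) (Suc (Suc j) mod f) = digit p (int d) j * digit p (int d) (Suc j mod f)"
    proof (cases "Suc j = g")
      case True
      then have "Suc (Suc j) mod f = 0" "Suc j mod f = g" using f by simp_all
      then show ?thesis using zero last by simp
    next
      case False
      then have "Suc (Suc j) mod f = Suc (Suc j)" "Suc j mod f = Suc j" using j f by simp_all
      then show ?thesis using shift by simp
    qed
  qed simp
  also have "\<dots> = digit_cyclic_corr p f (int d)"
    unfolding digit_cyclic_corr_def f using last by simp
  finally show "digit_cyclic_corr p f (int (p * d)) = digit_cyclic_corr p f (int d)" .
qed

text \<open>Only the two products containing digit 0 change; its cyclic neighbours are the digits 1
  and \<open>f - 1\<close>.\<close>

lemma digit_cyclic_corr_pred: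
  assumes "c mod p \<noteq> 0" "f \<ge> 3"
  shows "digit_cyclic_corr p f (int c) =
    digit_cyclic_corr p f (int (c - 1)) + digit p (int c) 1 + digit p (int c) (f - 1)"
proof -
  obtain g where f: "f = Suc (Suc g)" "g \<ge> 1" using assms(2) by (metis Suc_le_D Suc_le_mono numeral_3_eq_3 One_nat_def)
  have split: "digit_cyclic_corr p f a = digit p a 0 * digit p a 1 +
     (\<Sum>j<g. digit p a (Suc j) * digit p a (Suc (Suc j))) + digit p a (Suc g) * digit p a 0" for a
  proof -
    have "digit_cyclic_corr p f a = digit p a 0 * digit p a (1 mod f) +
        (\<Sum>j<g. digit p a (Suc j) * digit p a (Suc (Suc j) mod f)) + digit p a (Suc g) * digit p a (Suc (Suc g) mod f)"
      unfolding digit_cyclic_corr_def f by (subst sum.lessThan_Suc, subst sum.lessThan_Suc_shift) simp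
    moreover have "Suc (Suc j) mod f = Suc (Suc j)" if "j < g" for j using that f by simp
    ultimately show ?thesis using f by simp
  qed
  show ?thesis
    unfolding split digit_pred_Suc[OF assms(1)] One_nat_def digit_pred_0[OF assms(1)]
    by (simp add: f(1) digit_pred_Suc[OF assms(1), unfolded One_nat_def])
qed

section \<open>Jacobi sums modulo \<open>P\<close> and squares modulo 4\<close>

context residue_setup
begin

text \<open>Orthogonality selects from the binomial expansion the exponents congruent to
  \<open>j\<close> modulo \<open>q - 1\<close>. Both congruences for Jacobi sums come down to this
  once \<open>tau\<close> has been removed.\<close>

lemma sum_mu_binomial:
  "(\<Sum>x\<in>mu. x powi (- j) * (1 + e * x) ^ m) =
    of_nat (q - 1) * (\<Sum>k | k \<le> m \<and> int (q - 1) dvd int k - j. of_nat (m choose k) * e ^ k)"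
proof -
  have "(\<Sum>x\<in>mu. x powi (- j) * (1 + e * x) ^ m) =
      (\<Sum>x\<in>mu. \<Sum>k\<le>m. of_nat (m choose k) * e ^ k * x powi (int k - j))"
  proof (rule sum.cong)
    fix x assume "x \<in> mu"
    then have "x powi (int k - j) = x powi (- j) * x ^ k" for k
      using power_int_add[of x "- j" "int k"] mu_nz by auto
    then show "x powi (- j) * (1 + e * x) ^ m = (\<Sum>k\<le>m. of_nat (m choose k) * e ^ k * x powi (int k - j))"
      unfolding add.commute[of 1] binomial_ring sum_distrib_left by (simp add: power_mult_distrib mult_ac)
  qed simp
  also have "\<dots> = (\<Sum>k\<le>m. \<Sum>x\<in>mu. of_nat (m choose k) * e ^ k * x powi (int k - j))"
    by (rule sum.swap)
  also have "\<dots> = (\<Sum>k\<le>m. of_nat (m choose k) * e ^ k * (\<Sum>x\<in>mu. x powi (int k - j)))"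
    by (simp only: sum_distrib_left)
  also have "\<dots> = (\<Sum>k\<le>m. if int (q - 1) dvd int k - j then of_nat (q - 1) * (of_nat (m choose k) * e ^ k) else 0)"
    unfolding sum_mu_powi by (intro sum.cong) auto
  also have "\<dots> = (\<Sum>k | k \<in> {..m} \<and> int (q - 1) dvd int k - j. of_nat (q - 1) * (of_nat (m choose k) * e ^ k))"
    by (rule sum.inter_filter[symmetric]) simp
  finally show ?thesis by (simp add: sum_distrib_left)
qed

text \<open>The exponent \<open>-(c - 1)\<close> is exchanged for the positive \<open>q - c\<close>,
  congruent to it modulo \<open>q - 1\<close>, so that the binomial theorem becomes
  applicable.\<close>

lemma J_1_eq:
  assumes "1 \<le> c" "c \<le> q - 2"
  shows "J 1 (int c - 1) = (\<Sum>x\<in>mu - {1}. x powi (- 1) * tau (1 - x) ^ (q - c))"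
  unfolding J_def
proof (rule sum.cong)
  fix x assume x: "x \<in> mu - {1}"
  have "- (int c - 1) - int (q - c) = - int (q - 1)"
    using assms q_gt_2 by (simp add: of_nat_diff)
  then have "int (q - 1) dvd - (int c - 1) - int (q - c)" by simp
  from mu_powi_cong[OF tau_1_minus[OF x] this]
  show "x powi - 1 * tau (1 - x) powi - (int c - 1) = x powi - 1 * tau (1 - x) ^ (q - c)"
    by simp
qed simp

text \<open>Modulo \<open>P\<close>, \<open>tau (1 - x)\<close> is \<open>1 - x\<close>. Of the
  exponents up to \<open>q - c\<close> only 1 is congruent to 1 modulo \<open>q - 1\<close>, which
  leaves \<open>- (q - 1) * (q - c)\<close>.\<close>

lemma J_cong:
  assumes c: "1 \<le> c" "c \<le> q - 2"
  shows "cg (J 1 (int c - 1)) (- of_nat c)"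
proof -
  have "cg (J 1 (int c - 1)) (\<Sum>x\<in>mu - {1}. x powi (- 1) * (1 - x) ^ (q - c))"
    unfolding J_1_eq[OF c]
  proof (intro cg_sum cg_mult cg_power)
    fix x assume x: "x \<in> mu - {1}"
    then have "x powi - 1 \<in> mu" using mu_powi by blast
    then show "cg (x powi - 1) (x powi - 1)" by blast
    show "cg (tau (1 - x)) (1 - x)" using x by (intro cg_sym[OF cg_tau]) auto
  qed
  \<comment> \<open>The term at \<open>x = 1\<close> can be restored because it is 0, the exponent
    \<open>q - c\<close> being positive.\<close>
  also have "(\<Sum>x\<in>mu - {1}. x powi (- 1) * (1 - x) ^ (q - c)) = (\<Sum>x\<in>mu. x powi (- 1) * (1 + (- 1) * x) ^ (q - c))"
    using c q_gt_2 by (subst sum.remove[of mu 1]) (simp_all add: zero_power)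
  also have "\<dots> = of_nat (q - 1) * (\<Sum>k\<in>{1}. of_nat ((q - c) choose k) * (- 1) ^ k)"
  proof -
    have "int (q - 1) dvd int k - 1 \<longleftrightarrow> k = 1" if k: "k \<le> q - c" for k
    proof
      assume d: "int (q - 1) dvd int k - 1"
      show "k = 1"
      proof (rule ccontr)
        assume "k \<noteq> 1"
        then have "int (q - 1) \<le> \<bar>int k - 1\<bar>" using dvd_imp_le_int[OF _ d] by auto
        then show False using k c q_gt_2 by linarith
      qed
    qed simp
    then have "{k. k \<le> q - c \<and> int (q - 1) dvd int k - 1} = {1}"
      using c q_gt_2 by auto
    then show ?thesis unfolding sum_mu_binomial by simp
  qed
  also have "\<dots> = of_int (- (int q - 1) * (int q - int c))"
    using c q_gt_2 by (simp add: of_nat_diff algebra_simps)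
  also have "cg \<dots> (of_int (- int c))"
  proof -
    have "int p dvd int q" using p_dvd_q by simp
    moreover have "- (int q - 1) * (int q - int c) - (- int c) = int q * (int c + 1 - int q)"
      by (simp add: algebra_simps)
    ultimately show ?thesis unfolding cg_int_iff by simp
  qed
  finally show ?thesis by simp
qed

text \<open>The elements of \<open>A\<close> divisible by 4 in the localization at \<open>P\<close>.\<close>

definition I4 :: "complex set" where
  "I4 = {x \<in> A. \<exists>t\<in>A - P. \<exists>r\<in>A. t * x = 4 * r}"

sublocale four: complex_ideal A I4
proof
  show "I4 \<subseteq> A" by (auto simp: I4_def)
  show "0 \<in> I4" using one_notin_P by (auto simp: I4_def intro!: bexI[of _ 1] bexI[of _ 0])
  show "x - y \<in> I4" if x: "x \<in> I4" and y: "y \<in> I4" for x y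
  proof -
    obtain t r where t: "t \<in> A - P" "r \<in> A" "t * x = 4 * r" using x by (auto simp: I4_def)
    obtain t' r' where t': "t' \<in> A - P" "r' \<in> A" "t' * y = 4 * r'" using y by (auto simp: I4_def)
    have "t * t' * (x - y) = t' * (t * x) - t * (t' * y)" by (simp add: algebra_simps)
    also have "\<dots> = 4 * (t' * r - t * r')" unfolding t t' by (simp add: algebra_simps)
    finally have "t * t' * (x - y) = 4 * (t' * r - t * r')" .
    moreover have "t * t' \<in> A - P" using t t' notin_P_mult by auto
    moreover have "t' * r - t * r' \<in> A" using t t' by auto
    ultimately show ?thesis using x y unfolding I4_def by blast
  qed
  show "a * x \<in> I4" if a: "a \<in> A" and x: "x \<in> I4" for a x
  proof -
    obtain t r where t: "t \<in> A - P" "r \<in> A" "t * x = 4 * r" using x by (auto simp: I4_def)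
    then have "t * (a * x) = 4 * (a * r)" by (simp add: algebra_simps)
    moreover have "a * r \<in> A" "a * x \<in> A" using a t x by (auto simp: I4_def)
    ultimately show ?thesis using t(1) unfolding I4_def by blast
  qed
qed auto

lemma four_cg_int: "4 dvd k - l \<Longrightarrow> four.cg (of_int k) (of_int l)"
proof -
  assume "4 dvd k - l"
  then obtain m where "k - l = 4 * m" by blast
  then have "1 * (of_int k - of_int l) = 4 * (of_int m :: complex)"
    by (metis mult_1 of_int_diff of_int_mult of_int_numeral)
  then have "of_int k - of_int l \<in> I4" using one_notin_P unfolding I4_def by blast
  then show ?thesis by (simp add: four.cg_def)
qed

text \<open>Squaring lifts a congruence modulo 2 to one modulo 4. The multiplier \<open>t\<close>
  outside \<open>P\<close> gets squared too, and stays outside since \<open>P\<close> is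
  prime.\<close>

lemma sqr_cong_mod_4:
  assumes "t \<in> A - P" "r \<in> A" "x \<in> A" "y \<in> A" "t * (x - y) = 2 * r"
  shows "four.cg (x ^ 2) (y ^ 2)"
proof -
  have "t * t * (x ^ 2 - y ^ 2) = (t * (x - y)) * (t * (x - y) + 2 * t * y)"
    by (simp add: algebra_simps power2_eq_square)
  also have "\<dots> = 4 * (r * (r + t * y))" unfolding assms(5) by (simp add: algebra_simps)
  finally have "t * t * (x ^ 2 - y ^ 2) = 4 * (r * (r + t * y))" .
  moreover have "t * t \<in> A - P" using assms notin_P_mult by auto
  moreover have "r * (r + t * y) \<in> A" using assms by auto
  ultimately have "x ^ 2 - y ^ 2 \<in> I4" using assms unfolding I4_def by blast
  then show ?thesis using assms by (auto simp: four.cg_def)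
qed

text \<open>Modulo 2 the sum \<open>z = tau (1 + y) + 1 + y\<close> of Teichmueller representatives satisfies
  \<open>z ^ q = z\<close>, so \<open>1 - z ^ (q - 1)\<close>, which is prime to \<open>P\<close>, multiplies \<open>z\<close> into \<open>2 A\<close>.\<close>

lemma tau_1_plus_sqr:
  assumes p2: "p = 2" and y: "y \<in> mu"
  shows "four.cg (tau (1 + y) ^ 2) ((1 + y) ^ 2)"
proof -
  interpret two: complex_ideal A "(*) 2 ` A" by (rule principal_ideal) simp
  define a where "a = tau (1 + y)"
  have a: "a \<in> T" "a \<in> A" unfolding a_def using y by (auto intro!: tau_mem)
  \<comment> \<open>A sum serves in place of the difference, with which it agrees modulo 2: its
    three terms are all fixed by the \<open>q\<close>-th power, whereas -1 is not, \<open>q\<close>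
    being even.\<close>
  define z where "z = a + (1 + y)"
  have zA: "z \<in> A" using a y by (auto simp: z_def)
  have two: "Factorial_Ring.prime (2::nat)" "of_nat 2 \<in> (*) 2 ` A"
    by (auto intro!: image_eqI[of _ _ 1])
  have "two.cg (z ^ (2 ^ f)) (a ^ (2 ^ f) + (1 + y) ^ (2 ^ f))"
    unfolding z_def using a y by (intro two.cg_prime_power_add two) auto
  also have "two.cg (a ^ (2 ^ f) + (1 + y) ^ (2 ^ f)) (a ^ (2 ^ f) + (1 ^ (2 ^ f) + y ^ (2 ^ f)))"
    using a y by (intro two.cg_add two.cg_refl two.cg_prime_power_add two) auto
  also have "\<dots> = z"
    using T_power_q[OF a(1)] mu_power_q[OF y] by (simp add: z_def q_eq p2)
  finally have "z ^ q - z \<in> (*) 2 ` A" by (simp add: two.cg_def q_eq p2)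
  then obtain r where r: "r \<in> A" "z ^ q - z = 2 * r" by blast
  have "cg (a + (1 + y)) ((1 + y) + (1 + y))"
    unfolding a_def using y by (intro cg_add cg_refl cg_sym[OF cg_tau]) auto
  also have "cg ((1 + y) + (1 + y)) 0"
    unfolding cg_0_iff using ideal_absorb[OF _ p_mem_P, of "1 + y"] y by (auto simp: p2 algebra_simps)
  finally have zP: "z \<in> P" by (simp add: z_def cg_0_iff)
  define t where "t = 1 - z ^ (q - 1)"
  have zq: "z ^ q = z * z ^ (q - 1)" using q_gt_2 by (simp flip: power_Suc)
  have "q - 1 = Suc (q - 2)" using q_gt_2 by simp
  then have "z ^ (q - 1) = z ^ (q - 2) * z" by (simp only: power_Suc2)
  then have "z ^ (q - 1) \<in> P" using zP zA ideal_absorb power_closed by metis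
  then have t: "t \<in> A - P"
    using one_notin_P ideal_diff[of "t" "- (z ^ (q - 1))"] ideal_diff[of 0 "z ^ (q - 1)"] zA
    by (auto simp: t_def)
  have "t * z = z - z ^ q" by (simp add: t_def zq algebra_simps)
  have "t * (a - (1 + y)) = t * z - 2 * (t * (1 + y))" by (simp add: z_def algebra_simps)
  also have "\<dots> = - (z ^ q - z) - 2 * (t * (1 + y))" using \<open>t * z = z - z ^ q\<close> by simp
  also have "\<dots> = 2 * (- r - t * (1 + y))" unfolding r(2) by (simp add: algebra_simps)
  finally have eq: "t * (a - (1 + y)) = 2 * (- r - t * (1 + y))" .
  have "- r - t * (1 + y) \<in> A" using r t y by auto
  from sqr_cong_mod_4[OF t this a(2) _ eq] y show ?thesis
    unfolding a_def[symmetric] by auto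
qed

end

section \<open>Binomial coefficients modulo 4\<close>

lemma binomial_two_power_odd:
  fixes q r :: nat
  assumes q: "q = 2 ^ f" and r: "r < q"
  shows "odd ((q + r) choose q)"
proof -
  have even_choose: "even (q choose i)" if i: "0 < i" "i < q" for i
  proof (rule ccontr)
    assume "odd (q choose i)"
    then have "coprime q (q choose i)" by (simp add: q)
    moreover have "q dvd i * (q choose i)"
    proof -
      have "i * (q choose i) = q * ((q - 1) choose (i - 1))"
        using times_binomial_minus1_eq[of i q] i by simp
      then show ?thesis by simp
    qed
    ultimately have "q dvd i" by (simp add: coprime_dvd_mult_left_iff)
    then show False using i nat_dvd_not_less by blast
  qed
  \<comment> \<open>In Vandermonde's identity the term \<open>k = 0\<close> vanishes because
    \<open>r < q\<close>, the inner ones are even, and \<open>k = q\<close> contributes 1.\<close>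
  have "(q + r) choose q = (\<Sum>k\<le>q. (q choose k) * (r choose (q - k)))"
    by (rule vandermonde[symmetric])
  also have "\<dots> = (\<Sum>k<q. (q choose k) * (r choose (q - k))) + 1"
    by (simp add: lessThan_Suc_atMost[symmetric])
  finally have sum: "(q + r) choose q = (\<Sum>k<q. (q choose k) * (r choose (q - k))) + 1" .
  have "even (\<Sum>k<q. (q choose k) * (r choose (q - k)))"
  proof (rule dvd_sum)
    fix k assume "k \<in> {..<q}"
    then show "even ((q choose k) * (r choose (q - k)))"
      using even_choose[of k] r by (cases "k = 0") (auto simp: binomial_eq_0)
  qed
  then show ?thesis unfolding sum by simp
qed

text \<open>By absorption, \<open>q + 1\<close> times the coefficient is \<open>2 * m\<close> times
  an odd coefficient, and \<open>q + 1\<close> is congruent to 1 modulo 4.\<close>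

lemma binomial_mod_4:
  fixes q m :: nat
  assumes q: "q = 2 ^ f" "f \<ge> 3" and m: "odd m" "q + 1 \<le> 2 * m" "m < q"
  shows "[int ((2 * m) choose (q + 1)) = 2] (mod 4)"
proof -
  have "4 dvd q" using le_imp_power_dvd[of 2 f 2] q by simp
  then obtain q' where q': "q = 4 * q'" by blast
  have "(q + 1) * ((2 * m) choose (q + 1)) = 2 * m * ((2 * m - 1) choose q)"
    using times_binomial_minus1_eq[of "q + 1" "2 * m"] by simp
  moreover have "odd ((2 * m - 1) choose q)"
    using binomial_two_power_odd[OF q(1), of "2 * m - 1 - q"] m by simp
  then have "odd (m * ((2 * m - 1) choose q))" using m by simp
  then obtain k where "m * ((2 * m - 1) choose q) = 2 * k + 1" by (rule oddE)
  ultimately have "(q + 1) * ((2 * m) choose (q + 1)) = 2 * (2 * k + 1)" by (simp add: mult.assoc)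
  then have "int ((2 * m) choose (q + 1)) - 2 = 4 * (int k - int q' * int ((2 * m) choose (q + 1)))"
    unfolding q' by (simp add: algebra_simps flip: of_nat_mult of_nat_add)
  then show ?thesis by (simp add: cong_iff_dvd_diff)
qed

text \<open>The first coefficient depends on \<open>c\<close> modulo 4, thus on digit 1. The second
  one is present exactly when \<open>c < q / 2\<close>, that is, when digit \<open>f - 1\<close> is
  0; it contributes 2, which reverses the sign modulo 4.\<close>

lemma binomial_sum_mod_4:
  fixes q m c :: nat
  assumes q: "q = 2 ^ f" "f \<ge> 3" and c: "odd c" "c < q" and m: "m = q - c"
  shows "[(int q - 1) * (int ((2 * m) choose 2) + (if q + 1 \<le> 2 * m then int ((2 * m) choose (q + 1)) else 0))
    = (- 1) ^ (1 + digit 2 (int c) 1 + digit 2 (int c) (f - 1))] (mod 4)"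
proof -
  define h :: nat where "h = 2 ^ (f - 1)"
  have qh: "q = 2 * h" using q by (simp add: h_def power_eq_if)
  have "4 dvd q" using le_imp_power_dvd[of 2 f 2] q by simp
  then have q4: "[int q = 0] (mod 4)" by (simp add: cong_0_iff flip: int_dvd_int_iff)
  have top: "digit 2 (int c) (f - 1) = (if q + 1 \<le> 2 * m then 0 else 1)"
  proof -
    have dig: "digit 2 (int c) (f - 1) = (c div h) mod 2" by (simp add: digit_def h_def)
    show ?thesis
    proof (cases "c < h")
      case True
      then have "q + 1 \<le> 2 * m" using m qh by linarith
      then show ?thesis unfolding dig using True by simp
    next
      case False
      then have "\<not> q + 1 \<le> 2 * m" using m qh by linarith
      moreover have "c div h = 1" using False c(2) qh by (intro div_nat_eqI) auto
      ultimately show ?thesis unfolding dig by simp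
    qed
  qed
  have "c > 0" using c(1) by (cases c) auto
  then have odd_m: "odd m" "m < q" using c m qh by auto
  have "[int m = - int c] (mod 4)"
    using cong_diff[OF q4 cong_refl[of "int c"]] c(2) m by (simp add: of_nat_diff)
  then have "[int m = - (int c mod 4)] (mod 4)"
    by (metis cong_minus_minus_iff cong_mod_right cong_trans cong_refl)
  moreover have "(2 * m) choose 2 = m * (2 * m - 1)"
    by (simp add: choose_two)
  then have C2: "int ((2 * m) choose 2) = int m * (2 * int m - 1)"
    using odd_m by (cases m) (auto simp: algebra_simps)
  ultimately have "[int ((2 * m) choose 2) = - (int c mod 4) * (2 * (- (int c mod 4)) - 1)] (mod 4)"
    unfolding C2 by (intro cong_mult cong_diff cong_refl)
  moreover have "[(if q + 1 \<le> 2 * m then int ((2 * m) choose (q + 1)) else 0) = (if q + 1 \<le> 2 * m then 2 else 0)] (mod 4)"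
    using binomial_mod_4[OF q odd_m(1) _ odd_m(2)] by simp
  moreover have "[int q - 1 = 0 - 1] (mod 4)" using q4 by (intro cong_diff) auto
  ultimately have "[(int q - 1) * (int ((2 * m) choose 2) + (if q + 1 \<le> 2 * m then int ((2 * m) choose (q + 1)) else 0))
    = (0 - 1) * (- (int c mod 4) * (2 * (- (int c mod 4)) - 1) + (if q + 1 \<le> 2 * m then 2 else 0))] (mod 4)"
    by (intro cong_mult cong_add)
  also have "[(0 - 1) * (- (int c mod 4) * (2 * (- (int c mod 4)) - 1) + (if q + 1 \<le> 2 * m then 2 else 0))
    = (- 1) ^ (1 + digit 2 (int c) 1 + digit 2 (int c) (f - 1))] (mod 4)"
  proof -
    have d1: "digit 2 (int c) 1 = (c div 2) mod 2" by (simp add: digit_def)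
    have "c mod 4 = 1 \<or> c mod 4 = 3" using c(1) by presburger
    then show ?thesis
    proof
      assume "c mod 4 = 1"
      then have "int c mod 4 = 1" "(c div 2) mod 2 = 0" by presburger+
      then show ?thesis unfolding top d1 by (simp add: cong_iff_dvd_diff)
    next
      assume "c mod 4 = 3"
      then have "int c mod 4 = 3" "(c div 2) mod 2 = 1" by presburger+
      then show ?thesis unfolding top d1 by (simp add: cong_iff_dvd_diff)
    qed
  qed
  finally show ?thesis .
qed

section \<open>Jacobi sums modulo 4 and the induction along the digits\<close>

context residue_setup
begin

text \<open>By itself \<open>tau (1 - x)\<close> is understood only modulo \<open>P\<close>.
  Substituting \<open>x = y ^ 2\<close> makes it the square of \<open>tau (1 + y)\<close>, and this
  square may be replaced by \<open>(1 + y) ^ 2\<close> modulo 4.\<close>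

lemma J_cong_four:
  assumes p2: "p = 2" and f3: "f \<ge> 3" and c: "odd c" "c \<le> q - 2"
  shows "four.cg (J 1 (int c - 1)) ((- 1) ^ (1 + digit p (int c) 1 + digit p (int c) (f - 1)))"
proof -
  define m where "m = q - c"
  have c1: "1 \<le> c" using c(1) by (cases c) auto
  have m: "m > 0" using c q_gt_2 by (simp add: m_def)
  have "J 1 (int c - 1) = (\<Sum>x\<in>mu. x powi (- 1) * tau (1 - x) ^ m)"
    unfolding J_1_eq[OF c1 c(2)] m_def[symmetric] using m
    by (subst sum.remove[of mu 1]) (simp_all add: T_def zero_power)
  also have "\<dots> = (\<Sum>y\<in>mu. (y ^ p) powi (- 1) * tau (1 - y ^ p) ^ m)"
    by (rule sum.reindex_bij_betw[OF bij_mu_frob, symmetric])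
  also have "\<dots> = (\<Sum>y\<in>mu. y powi (- 2) * (tau (1 + y) ^ 2) ^ m)"
  proof (rule sum.cong)
    fix y assume y: "y \<in> mu"
    have "(- (y ^ 2) - y) * of_nat p \<in> P"
      using y by (intro ideal_absorb p_mem_P) (auto intro!: minus_closed diff_closed)
    moreover have "(1 - y ^ 2) - (1 + y) ^ 2 = (- (y ^ 2) - y) * of_nat p"
      by (simp add: p2 algebra_simps power2_eq_square)
    ultimately have "cg (1 - y ^ 2) ((1 + y) ^ 2)"
      using y by (auto simp: cg_def)
    also have "cg ((1 + y) ^ 2) (tau (1 + y) ^ 2)"
      using y by (intro cg_power cg_tau) auto
    finally have "tau (1 - y ^ 2) = tau (1 + y) ^ 2"
      using y by (intro tau_eqI T_power tau_mem) auto
    moreover have "(y ^ 2) powi (- 1) = y powi (- 2)"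
      using power_int_mult[of y 2 "- 1"] by simp
    ultimately show "(y ^ p) powi (- 1) * tau (1 - y ^ p) ^ m = y powi (- 2) * (tau (1 + y) ^ 2) ^ m"
      unfolding p2 by simp
  qed simp
  also have "four.cg \<dots> (\<Sum>y\<in>mu. y powi (- 2) * ((1 + y) ^ 2) ^ m)"
  proof (rule four.cg_sum)
    fix y assume y: "y \<in> mu"
    then have "y powi (- 2) \<in> A" using mu_powi by blast
    then show "four.cg (y powi (- 2) * (tau (1 + y) ^ 2) ^ m) (y powi (- 2) * ((1 + y) ^ 2) ^ m)"
      by (rule four.cg_mult[OF four.cg_refl four.cg_power[OF tau_1_plus_sqr[OF p2 y]]])
  qed
  also have "(\<Sum>y\<in>mu. y powi (- 2) * ((1 + y) ^ 2) ^ m) = (\<Sum>y\<in>mu. y powi (- 2) * (1 + 1 * y) ^ (2 * m))"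
    by (simp add: power_mult)
  also have "\<dots> = of_nat (q - 1) * (\<Sum>k | k \<le> 2 * m \<and> int (q - 1) dvd int k - 2. of_nat ((2 * m) choose k))"
    unfolding sum_mu_binomial by simp
  \<comment> \<open>Here \<open>k - 2\<close> is a multiple of \<open>q - 1\<close> lying strictly
    between \<open>-(q - 1)\<close> and \<open>2 * (q - 1)\<close>, since \<open>m = q - c\<close>
    is at most \<open>q - 1\<close>.\<close>
  also have "{k. k \<le> 2 * m \<and> int (q - 1) dvd int k - 2} = (if q + 1 \<le> 2 * m then {2, q + 1} else {2})"
  proof -
    have q8: "q \<ge> 8" using power_increasing[OF f3, of "2::nat"] by (simp add: q_eq p2)
    have pos: "0 < int (q - 1)" using q8 by simp
    have iff: "int (q - 1) dvd int k - 2 \<longleftrightarrow> k = 2 \<or> k = q + 1" if k: "k \<le> 2 * m" for k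
    proof
      assume "int (q - 1) dvd int k - 2"
      then obtain j where j: "int k - 2 = int (q - 1) * j" by blast
      have "int (q - 1) * j < int (q - 1) * 2" using j k c1 q8 by (simp add: m_def of_nat_diff)
      then have "j < 2" using mult_less_cancel_left_pos[OF pos] by blast
      have "int (q - 1) * j > int (q - 1) * (- 1)" using j q8 by (simp add: of_nat_diff)
      then have "j > - 1" using mult_less_cancel_left_pos[OF pos] by blast
      then have "j = 0 \<or> j = 1" using \<open>j < 2\<close> by linarith
      then show "k = 2 \<or> k = q + 1" using j q8 by (auto simp: of_nat_diff)
    next
      assume "k = 2 \<or> k = q + 1"
      then show "int (q - 1) dvd int k - 2" using q8 by (auto simp: of_nat_diff)
    qed
    show ?thesis
    proof (rule Set.set_eqI)
      fix k show "k \<in> {k. k \<le> 2 * m \<and> int (q - 1) dvd int k - 2} \<longleftrightarrow> k \<in> (if q + 1 \<le> 2 * m then {2, q + 1} else {2})"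
        using iff[of k] m by auto
    qed
  qed
  also have "of_nat (q - 1) * (\<Sum>k\<in>(if q + 1 \<le> 2 * m then {2, q + 1} else {2}). of_nat ((2 * m) choose k)) =
      (of_int ((int q - 1) * (int ((2 * m) choose 2) + (if q + 1 \<le> 2 * m then int ((2 * m) choose (q + 1)) else 0))) :: complex)"
    using q_gt_2 by (simp add: of_nat_diff)
  also have "four.cg \<dots> (of_int ((- 1) ^ (1 + digit p (int c) 1 + digit p (int c) (f - 1))))"
  proof (rule four_cg_int)
    have "c < q" using c q_gt_2 by simp
    from binomial_sum_mod_4[OF q_eq[unfolded p2] f3 c(1) this m_def]
    show "4 dvd (int q - 1) * (int ((2 * m) choose 2) + (if q + 1 \<le> 2 * m then int ((2 * m) choose (q + 1)) else 0))
      - (- 1) ^ (1 + digit p (int c) 1 + digit p (int c) (f - 1))"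
      unfolding p2 cong_iff_dvd_diff .
  qed
  finally show ?thesis by simp
qed

text \<open>Modulo \<open>P\<close> the additive character is 1, and what remains is a nontrivial
  multiplicative character sum.\<close>

lemma G_1_mem_P: "G 1 \<in> P"
proof -
  have "cg (G 1) (\<Sum>z\<in>mu. z powi (- 1) * 1)"
    unfolding G_def
  proof (intro cg_sum cg_mult cg_psi_1 cg_refl)
    fix z assume "z \<in> mu"
    then show "z powi - 1 \<in> A" using mu_powi by blast
  qed
  also have "(\<Sum>z\<in>mu. z powi (- 1) * 1) = 0"
  proof -
    have "\<not> int (q - 1) dvd - 1" using q_gt_2 by (auto dest!: dvd_imp_le_int)
    then show ?thesis using sum_mu_powi[of "- 1"] by simp
  qed
  finally show ?thesis by (simp add: cg_0_iff)
qed

lemma not_dvd_nat_less: "0 < c \<Longrightarrow> c < q - 1 \<Longrightarrow> \<not> int (q - 1) dvd int c"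
  unfolding int_dvd_int_iff by (rule nat_dvd_not_less)

lemma G_1_nz: "G 1 \<noteq> 0"
  using G_nz[of 1] not_dvd_nat_less[of 1] q_gt_2 by simp

text \<open>Stickelberger's congruence in multiplicative form: \<open>K\<close> is a product of Jacobi sums, so it
  takes the place of the quotient \<open>G 1 ^ s / G c\<close> and no valuation at \<open>P\<close> is needed.\<close>

lemma stickelberger:
  assumes "c < q - 1"
  shows "\<exists>K\<in>A. G 1 ^ digit_sum p f (int c) = K * G (int c) \<and>
     cg K ((- 1) ^ Suc (digit_sum p f (int c)) * of_nat (digit_fact_prod p f (int c))) \<and>
     (p = 2 \<and> f \<ge> 3 \<longrightarrow> four.cg K ((- 1) ^ (Suc (digit_sum p f (int c)) + digit_cyclic_corr p f (int c))))"
  using assms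
proof (induction c rule: less_induct)
  case (less c)
  have p0: "p > 0" using p_gt_1 by simp
  consider (zero) "c = 0" | (mult) "c > 0" "c mod p = 0" | (pred) "c mod p \<noteq> 0" by blast
  then show ?case
  proof cases
    case zero
    have "digit p 0 j = 0" for j by (simp add: digit_def)
    then have "digit_sum p f 0 = 0" "digit_fact_prod p f 0 = 1" "digit_cyclic_corr p f 0 = 0"
      by (simp_all add: digit_sum_def digit_fact_prod_def digit_cyclic_corr_def)
    moreover have "- 1 \<in> A" using minus_closed[OF one_closed] .
    \<comment> \<open>\<open>K = - 1\<close> because \<open>G 0 = - 1\<close>; this is the origin of
      the successor in the exponents of the sign.\<close>
    ultimately show ?thesis
      using zero G_0 by (intro bexI[of _ "- 1"]) (auto intro: cg_refl four.cg_refl)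
  next
    case mult
    then obtain d where d: "c = p * d" by (metis mod_0_imp_dvd dvdE)
    have "d < c" using d mult p_gt_1 by simp
    moreover from this have "d < q - 1" using less.prems by simp
    moreover have "p * d < p ^ f" using less.prems d q_eq by simp
    moreover have "G (int (p * d)) = G (int d)" using G_frob by simp
    ultimately show ?thesis
      using less.IH[of d] f_pos p0 unfolding d
      by (simp only: digit_sum_mult digit_fact_prod_mult digit_cyclic_corr_mult)
  next
    case pred
    have c0: "c > 0" using pred p0 by (cases c) auto
    then have c1: "1 \<le> c" "c \<le> q - 2" "int (c - 1) = int c - 1" using less.prems by auto
    obtain K where K: "K \<in> A" "G 1 ^ digit_sum p f (int (c - 1)) = K * G (int (c - 1))"
      "cg K ((- 1) ^ Suc (digit_sum p f (int (c - 1))) * of_nat (digit_fact_prod p f (int (c - 1))))"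
      "p = 2 \<and> f \<ge> 3 \<longrightarrow> four.cg K ((- 1) ^ (Suc (digit_sum p f (int (c - 1))) + digit_cyclic_corr p f (int (c - 1))))"
    proof -
      have "c - 1 < c" "c - 1 < q - 1" using less.prems c0 by linarith+
      from less.IH[OF this] show thesis using that by blast
    qed
    \<comment> \<open>Each unit taken from the lowest digit costs one Jacobi sum: modulo
      \<open>P\<close> it provides \<open>-1\<close> times the next factor of the factorial, and
      modulo 4 the sign recording the change of the cyclic sum.\<close>
    define j where "j = J 1 (int c - 1)"
    have jc: "cg j (- of_nat c)" unfolding j_def by (rule J_cong[OF c1(1,2)])
    have jA: "j \<in> A" using cg_closed(1)[OF jc] .
    have sum: "digit_sum p f (int c) = Suc (digit_sum p f (int (c - 1)))"
      using digit_sum_pred[OF pred f_pos] .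
    have prod: "digit_fact_prod p f (int c) = c mod p * digit_fact_prod p f (int (c - 1))"
      using digit_fact_prod_pred[OF pred f_pos] .
    show ?thesis
    proof (intro bexI[of _ "K * j"] conjI impI)
      show "K * j \<in> A" using K(1) jA by blast
      have "G 1 * G (int c - 1) = j * G (1 + (int c - 1))"
        unfolding j_def using not_dvd_nat_less[OF c0 less.prems] by (intro G_mult) simp
      then show "G 1 ^ digit_sum p f (int c) = K * j * G (int c)"
        unfolding sum power_Suc c1(3) K(2)[unfolded c1(3)] by (simp add: mult_ac)
      have "cg (of_nat c) (of_nat (c mod p))" by (simp add: cg_nat_iff)
      then have "cg j (- of_nat (c mod p))" using cg_trans[OF jc cg_minus] by blast
      from cg_mult[OF K(3) this]
      show "cg (K * j) ((- 1) ^ Suc (digit_sum p f (int c)) * of_nat (digit_fact_prod p f (int c)))"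
        unfolding sum prod by (simp add: mult_ac)
      assume p2: "p = 2 \<and> f \<ge> 3"
      then have "odd c" using pred by presburger
      with p2 c1 have j4: "four.cg j ((- 1) ^ (1 + digit p (int c) 1 + digit p (int c) (f - 1)))"
        unfolding j_def by (intro J_cong_four) auto
      have "digit_cyclic_corr p f (int c) =
         digit_cyclic_corr p f (int (c - 1)) + digit p (int c) 1 + digit p (int c) (f - 1)"
        using pred p2 by (intro digit_cyclic_corr_pred) auto
      then show "four.cg (K * j) ((- 1) ^ (Suc (digit_sum p f (int c)) + digit_cyclic_corr p f (int c)))"
        using four.cg_mult[OF K(4)[rule_format, OF p2] j4] unfolding sum
        by (simp add: power_add mult_ac)
    qed
  qed
qed

end

section \<open>Equality of Gauss sums\<close>

lemma cyc_ints_cnj: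
  assumes "n > 0" "x \<in> cyc_ints n"
  shows "cnj x \<in> cyc_ints n"
proof -
  have "cnj (unity_gen n) ^ n = 1"
    using unity_gen_power_self[OF assms(1)] by (metis complex_cnj_one complex_cnj_power)
  then have c: "cnj (unity_gen n) \<in> cyc_ints n" by (rule cyc_ints_root[OF assms(1)])
  have "cnj (ipoly g (unity_gen n)) \<in> cyc_ints n" for g
  proof (induction g)
    case (pCons a g)
    have "of_int a \<in> cyc_ints n" using ipoly_in_cyc_ints[of "[:a:]" n] by simp
    then show ?case using cyc_ints_add[OF _ cyc_ints_mult[OF c pCons.IH]] by simp
  qed simp
  then show ?thesis using assms(2) cyc_intsE by blast
qed

text \<open>On roots of unity both operations are compatible with powers, and the rest follows from
  the ring operations. This gives access to the conjugates of
  \<open>G c * cnj (G c')\<close>.\<close>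

lemma (in galois_action) galois_cnj:
  assumes "coprime u n" "x \<in> cyc_ints n"
  shows "galois n u (cnj x) = cnj (galois n u x)"
proof -
  define \<xi> where "\<xi> = unity_gen n"
  have root: "cnj \<xi> ^ n = 1"
    using unity_gen_power_self[OF n_pos] unfolding \<xi>_def by (metis complex_cnj_one complex_cnj_power)
  have "galois n u (cnj (ipoly g \<xi>)) = cnj (ipoly g (\<xi> ^ u))" for g
  proof (induction g)
    case (pCons a g)
    have a: "of_int a \<in> cyc_ints n" using ipoly_in_cyc_ints[of "[:a:]" n] by simp
    have m: "cnj \<xi> \<in> cyc_ints n" "cnj (ipoly g \<xi>) \<in> cyc_ints n"
      using cyc_ints_root[OF n_pos root] cyc_ints_cnj[OF n_pos] unfolding \<xi>_def by simp_all
    have "galois n u (cnj (ipoly (pCons a g) \<xi>)) = galois n u (of_int a + cnj \<xi> * cnj (ipoly g \<xi>))"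
      by simp
    also have "\<dots> = of_int a + galois n u (cnj \<xi>) * galois n u (cnj (ipoly g \<xi>))"
      using assms(1) a m by (simp add: galois_add galois_mult galois_of_int cyc_ints_mult)
    also have "\<dots> = cnj (ipoly (pCons a g) (\<xi> ^ u))"
      using galois_root[OF assms(1) root] pCons.IH by simp
    finally show ?case .
  qed (use assms galois_0 in simp)
  moreover obtain g where "x = ipoly g \<xi>" using assms(2) unfolding \<xi>_def by (rule cyc_intsE)
  ultimately show ?thesis using galois_ipoly[OF assms(1), of g] unfolding \<xi>_def by simp
qed

text \<open>Lets the zero class be recognised from its digit sum. The induction uses the same two
  moves as the one for Gauss sums.\<close>

lemma digit_sum_pos:
  assumes "p > 1" "f \<ge> 1" "0 < c" "c < p ^ f"
  shows "digit_sum p f (int c) > 0"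
  using assms(3,4)
proof (induction c rule: less_induct)
  case (less c)
  show ?case
  proof (cases "c mod p = 0")
    case True
    then obtain d where d: "c = p * d" by (metis mod_0_imp_dvd dvdE)
    have "d < c" "0 < d" using d less.prems assms(1) by simp_all
    then have "digit_sum p f (int d) > 0" using less by simp
    then show ?thesis using digit_sum_mult[of p d f] d less.prems assms by simp
  next
    case False
    then show ?thesis using digit_sum_pred[OF False assms(2)] by simp
  qed
qed

text \<open>All powers of an odd \<open>p\<close> are odd. Equal digit sums therefore give equal
  parities, which settles a sign in the sufficiency proof.\<close>

lemma even_digit_sum_iff:
  assumes "odd p" "p > 1" "f \<ge> 1" "c < p ^ f"
  shows "even (digit_sum p f (int c)) \<longleftrightarrow> even c"
  using assms(4)
proof (induction c rule: less_induct)
  case (less c)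
  consider (zero) "c = 0" | (mult) "c > 0" "c mod p = 0" | (pred) "c mod p \<noteq> 0" by blast
  then show ?case
  proof cases
    case zero
    then show ?thesis by (simp add: digit_sum_def digit_def)
  next
    case mult
    then obtain d where d: "c = p * d" by (metis mod_0_imp_dvd dvdE)
    have "d < c" using d mult assms(2) by simp
    then have "even (digit_sum p f (int d)) \<longleftrightarrow> even d" using less by simp
    then show ?thesis using digit_sum_mult[of p d f] d less.prems assms by simp
  next
    case pred
    have "c > 0" using pred by (cases c) auto
    then have "c - 1 < c" "c - 1 < p ^ f" using less.prems by linarith+
    then have "even (digit_sum p f (int (c - 1))) \<longleftrightarrow> even (c - 1)" by (rule less.IH)
    then show ?thesis using digit_sum_pred[OF pred assms(3)] \<open>c > 0\<close> by simp
  qed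
qed

section \<open>The Galois action on Gauss sums\<close>

context residue_setup
begin

lemma coprime_p_q_minus_1: "coprime p (q - 1)"
  using q_minus_1_notin_P of_nat_mem_P prime_p prime_imp_coprime by blast

text \<open>Raising \<open>psi z\<close> to the power \<open>u\<close> gives
  \<open>psi (u * z)\<close>, which depends only on \<open>u\<close> modulo \<open>P\<close>;
  substituting for \<open>tau u * z\<close> then moves \<open>tau u\<close> out as a root of
  unity.\<close>

lemma galois_G:
  assumes u: "coprime u (p * (q - 1))"
  shows "galois (p * (q - 1)) u (G c) = tau (of_nat u) powi (int u * c) * G (int u * c)"
proof -
  define w where "w = tau (of_nat u)"
  have "\<not> p dvd u" using u p_gt_1 by (metis coprime_common_divisor dvd_triv_left nat_dvd_1_iff_1 less_irrefl)
  then have w: "w \<in> mu" unfolding w_def by (intro tau_mu) (simp_all add: of_nat_mem_P)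
  have mem: "z powi (- c) \<in> cyc_ints (p * (q - 1))" "psi z \<in> cyc_ints (p * (q - 1))" if "z \<in> mu" for z
    using cyc_ints_root[OF n_pos mu_root[OF mu_powi[OF that]]] cyc_ints_root[OF n_pos psi_root] by blast+
  have "galois (p * (q - 1)) u (G c) = (\<Sum>z\<in>mu. galois (p * (q - 1)) u (z powi (- c) * psi z))"
    unfolding G_def using mem by (intro galois_sum[OF u] cyc_ints_mult)
  also have "\<dots> = (\<Sum>z\<in>mu. z powi (- (int u * c)) * psi (w * z))"
  proof (rule sum.cong)
    fix z assume z: "z \<in> mu"
    have "galois (p * (q - 1)) u (z powi (- c) * psi z) = (z powi (- c)) ^ u * psi z ^ u"
      using galois_mult[OF u mem[OF z]] galois_root[OF u mu_root[OF mu_powi[OF z]]] galois_root[OF u psi_root]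
      by simp
    also have "(z powi (- c)) ^ u = z powi (- (int u * c))"
      using power_int_mult[of z "- c" "int u"] by (simp add: mult.commute)
    also have "psi z ^ u = psi (of_nat u * z)" using psi_mult_nat[OF mu_mem[OF z]] by simp
    also have "\<dots> = psi (w * z)"
      unfolding w_def using z by (intro psi_cong cg_mult cg_tau cg_refl) auto
    finally show "galois (p * (q - 1)) u (z powi (- c) * psi z) = z powi (- (int u * c)) * psi (w * z)" .
  qed simp
  also have "\<dots> = (\<Sum>y\<in>mu. w powi (int u * c) * (y powi (- (int u * c)) * psi y))"
  proof (rule sum.reindex_bij_witness[of _ "\<lambda>y. y / w" "\<lambda>z. w * z"])
    fix z assume "z \<in> mu"
    have "(w * z) powi (- (int u * c)) = w powi (- (int u * c)) * z powi (- (int u * c))"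
      by (rule power_int_mult_distrib)
    moreover have "w powi (int u * c) * w powi (- (int u * c)) = 1"
      using mu_nz[OF w] power_int_add[of w "int u * c" "- (int u * c)"] by simp
    ultimately show "w powi (int u * c) * ((w * z) powi (- (int u * c)) * psi (w * z)) =
        z powi (- (int u * c)) * psi (w * z)"
      by (metis mult.assoc mult_1_left)
  qed (use w mu_nz in \<open>auto intro: mu_mult mu_divide\<close>)
  finally show ?thesis by (simp add: G_def w_def sum_distrib_left)
qed

text \<open>This separates 1 from -1 modulo \<open>I4\<close>, although they coincide modulo
  \<open>P\<close>.\<close>

lemma two_mult_notin_I4:
  assumes "p = 2" "x \<in> A" "x \<notin> P"
  shows "2 * x \<notin> I4"
proof
  assume "2 * x \<in> I4"
  then obtain t r where t: "t \<in> A - P" "r \<in> A" "t * (2 * x) = 4 * r" by (auto simp: I4_def)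
  then have "t * x = r * of_nat p" using assms(1) by (simp add: mult_ac)
  then have "t * x \<in> P" using ideal_absorb[OF t(2) p_mem_P] by simp
  then show False using P_prime t(1) assms by blast
qed

lemma minus_one_power_notin_P: "x \<in> A \<Longrightarrow> x \<notin> P \<Longrightarrow> (- 1) ^ k * x \<notin> P"
  using ideal_diff[of 0 "- x"] by (cases "even k") auto

lemma digit_fact_prod_notin_P: "of_nat (digit_fact_prod p f c) \<notin> P"
proof -
  have "\<not> p dvd fact (digit p c j)" for j
    using prime_p p_gt_1 by (simp add: prime_dvd_fact_iff digit_def not_le)
  then have "\<not> p dvd digit_fact_prod p f c"
    unfolding digit_fact_prod_def using prime_p by (simp add: prime_dvd_prod_iff)
  then show ?thesis by (simp add: of_nat_mem_P)
qed

lemma stickelbergerE: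
  assumes "c < q - 1"
  obtains K where "K \<in> A" "K \<notin> P" "G 1 ^ digit_sum p f (int c) = K * G (int c)"
    "cg K ((- 1) ^ Suc (digit_sum p f (int c)) * of_nat (digit_fact_prod p f (int c)))"
    "p = 2 \<and> f \<ge> 3 \<longrightarrow>
      four.cg K ((- 1) ^ (Suc (digit_sum p f (int c)) + digit_cyclic_corr p f (int c)))"
proof -
  obtain K where K: "K \<in> A" "G 1 ^ digit_sum p f (int c) = K * G (int c)"
    "cg K ((- 1) ^ Suc (digit_sum p f (int c)) * of_nat (digit_fact_prod p f (int c)))"
    "p = 2 \<and> f \<ge> 3 \<longrightarrow>
      four.cg K ((- 1) ^ (Suc (digit_sum p f (int c)) + digit_cyclic_corr p f (int c)))"
    using stickelberger[OF assms] by blast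
  have "K \<notin> P"
  proof
    assume "K \<in> P"
    then have "cg K 0" by (simp add: cg_0_iff)
    from cg_trans[OF cg_sym[OF K(3)] this]
    have "(- 1) ^ Suc (digit_sum p f (int c)) * of_nat (digit_fact_prod p f (int c)) \<in> P"
      by (simp only: cg_0_iff)
    then show False using minus_one_power_notin_P[OF nat_closed digit_fact_prod_notin_P] by blast
  qed
  then show thesis using that K by blast
qed

text \<open>Agreement of the leading terms of \<open>K\<close> for two classes whose digit sums, and
  hence common signs, already agree.\<close>

definition leading_cong :: "int \<Rightarrow> int \<Rightarrow> bool" where
  "leading_cong c c' \<longleftrightarrow> (if p = 2 then [digit_cyclic_corr p f c = digit_cyclic_corr p f c'] (mod 2)
     else [digit_fact_prod p f c = digit_fact_prod p f c'] (mod p))"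

section \<open>From equal Gauss sums to the digit conditions\<close>

lemma digit_sum_le_if_G_eq:
  assumes "c < q - 1" "c' < q - 1" "G (int c) = G (int c')"
  shows "digit_sum p f (int c) \<ge> digit_sum p f (int c')"
proof (rule ccontr)
  assume *: "\<not> digit_sum p f (int c) \<ge> digit_sum p f (int c')"
  define s s' where s: "s = digit_sum p f (int c)" "s' = digit_sum p f (int c')"
  obtain K where K: "K \<in> A" "K \<notin> P" "G 1 ^ s = K * G (int c)"
    using stickelbergerE[OF assms(1)] unfolding s by metis
  obtain K' where K': "K' \<in> A" "K' \<notin> P" "G 1 ^ s' = K' * G (int c)"
    using stickelbergerE[OF assms(2)] unfolding s assms(3) by metis
  have ss: "s' = s + (s' - s)" "s' - s > 0" using * s by simp_all
  have "G 1 ^ s * (K * G 1 ^ (s' - s)) = K * G 1 ^ s'" by (subst ss(1)) (simp add: power_add mult_ac)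
  also have "\<dots> = G 1 ^ s * K'" unfolding K(3) K'(3) by (simp add: mult_ac)
  finally have "K * G 1 ^ (s' - s) = K'" using G_1_nz by simp
  moreover have "G 1 ^ (s' - s) \<in> P"
    using ss(2) G_1_mem_P ideal_absorb[OF power_closed[OF G_mem] G_1_mem_P, of _ "s' - s - 1"]
    by (metis Suc_diff_1 power_Suc2)
  ultimately show False using K'(2) K(1) ideal_absorb by blast
qed

lemma leading_cong_if_G_eq:
  assumes f3: "p = 2 \<longrightarrow> f \<ge> 3" and c: "c < q - 1" "c' < q - 1" and eq: "G (int c) = G (int c')"
    and s: "digit_sum p f (int c) = digit_sum p f (int c')"
  shows "leading_cong (int c) (int c')"
proof -
  obtain K where K: "K \<in> A" "K \<notin> P" "G 1 ^ digit_sum p f (int c) = K * G (int c)"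
    "cg K ((- 1) ^ Suc (digit_sum p f (int c)) * of_nat (digit_fact_prod p f (int c)))"
    "p = 2 \<and> f \<ge> 3 \<longrightarrow>
      four.cg K ((- 1) ^ (Suc (digit_sum p f (int c)) + digit_cyclic_corr p f (int c)))"
    by (rule stickelbergerE[OF c(1)])
  obtain K' where K': "K' \<in> A" "K' \<notin> P" "G 1 ^ digit_sum p f (int c) = K' * G (int c)"
    "cg K' ((- 1) ^ Suc (digit_sum p f (int c)) * of_nat (digit_fact_prod p f (int c')))"
    "p = 2 \<and> f \<ge> 3 \<longrightarrow>
      four.cg K' ((- 1) ^ (Suc (digit_sum p f (int c)) + digit_cyclic_corr p f (int c')))"
    by (rule stickelbergerE[OF c(2), folded s eq])
  have KK: "K = K'"
  proof -
    have "K * G (int c) = K' * G (int c)" "K * G (int c) \<noteq> 0"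
      using K(3) K'(3) G_1_nz by (metis power_not_zero)+
    then show ?thesis by simp
  qed
  define e :: complex where "e = (- 1) ^ Suc (digit_sum p f (int c))"
  have ee: "e * e = 1" by (simp add: e_def power_mult_distrib[symmetric])
  have eA: "e \<in> A" unfolding e_def by (intro power_closed minus_closed) simp
  show ?thesis
  proof (cases "p = 2")
    case True
    define b b' where b: "b = digit_cyclic_corr p f (int c)" "b' = digit_cyclic_corr p f (int c')"
    have "four.cg (e * (- 1) ^ b) (e * (- 1) ^ b')"
      using four.cg_trans[OF four.cg_sym[OF mp[OF K(5)]] mp[OF K'(5)[folded KK]]] True f3
      unfolding e_def b power_add by simp
    from four.cg_mult[OF four.cg_refl[OF eA] this] ee
    have four: "four.cg ((- 1) ^ b) ((- 1) ^ b')" by (simp add: mult.assoc[symmetric])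
    have "even b \<longleftrightarrow> even b'"
    proof (rule ccontr)
      assume "\<not> (even b \<longleftrightarrow> even b')"
      then have "four.cg 1 (- 1)"
        using four four.cg_sym by (cases "even b") auto
      then have "2 * 1 \<in> I4" by (simp add: four.cg_def)
      then show False using two_mult_notin_I4[OF True one_closed one_notin_P] by blast
    qed
    then have "b mod 2 = b' mod 2" by presburger
    then have "[b = b'] (mod 2)" unfolding unique_euclidean_semiring_class.cong_def .
    then show ?thesis using True unfolding leading_cong_def b by simp
  next
    case False
    have "cg (e * of_nat (digit_fact_prod p f (int c))) (e * of_nat (digit_fact_prod p f (int c')))"
      using cg_trans[OF cg_sym[OF K(4)] K'(4)[folded KK]] unfolding e_def .
    from cg_mult[OF cg_refl[OF eA] this] ee
    have "cg (of_nat (digit_fact_prod p f (int c))) (of_nat (digit_fact_prod p f (int c')))"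
      by (simp add: mult.assoc[symmetric])
    then show ?thesis using False unfolding leading_cong_def unique_euclidean_semiring_class.cong_def cg_nat_iff by simp
  qed
qed

text \<open>Divisibility up to a multiplier outside \<open>P\<close> implies divisibility proper for
  rational integers: factors \<open>p\<close> are stripped one at a time, as \<open>P\<close>
  contains no integers besides the multiples of \<open>p\<close>.\<close>

lemma int_dvd_local:
  assumes "t \<in> A" "t \<notin> P" "r \<in> A" "t * of_int s = of_nat (p ^ m) * r"
  shows "int (p ^ m) dvd s"
  using assms(3,4)
proof (induction m arbitrary: r)
  case (Suc m)
  have "t * of_int s = of_nat (p ^ m) * (r * of_nat p)" using Suc.prems by simp
  from Suc.IH[OF mult_closed[OF Suc.prems(1) nat_closed] this] have "int (p ^ m) dvd s" .
  then obtain s' where s': "s = int (p ^ m) * s'" by blast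
  have "of_nat (p ^ m) * (t * of_int s') = of_nat (p ^ m) * (r * of_nat p)"
    using Suc.prems unfolding s' by (simp add: mult_ac)
  then have "t * of_int s' = r * of_nat p" using p_gt_1 by simp
  then have "t * of_int s' \<in> P" using ideal_absorb[OF Suc.prems(1) p_mem_P] by simp
  then have "int p dvd s'" using P_prime[OF assms(1) int_closed] assms(2) of_int_mem_P by blast
  then show ?case unfolding s' by (simp add: mult.commute mult_dvd_mono)
qed simp

lemma G_mod: "G (int (c mod (q - 1))) = G (int c)"
proof (rule G_cong)
  have "[int (c mod (q - 1)) = int c] (mod int (q - 1))"
    unfolding zmod_int by (simp add: unique_euclidean_semiring_class.cong_def)
  then show "int (q - 1) dvd int (c mod (q - 1)) - int c" by (simp add: cong_iff_dvd_diff)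
qed

lemma tau_nat_1: "[u = 1] (mod p) \<Longrightarrow> tau (of_nat u) = 1"
  using cg_nat_iff[of u 1] by (intro tau_eqI) (auto simp: T_def unique_euclidean_semiring_class.cong_def)

text \<open>By the Chinese remainder theorem the actions on the \<open>(q-1)\<close>-st roots of
  unity and on the \<open>p\<close>-th ones can be prescribed independently.\<close>

lemma exists_twist:
  assumes "coprime u (q - 1)" "coprime v p"
  obtains w where "coprime w (p * (q - 1))" "[w = u] (mod (q - 1))" "[w = v] (mod p)"
proof -
  obtain w where w: "[w = u] (mod (q - 1))" "[w = v] (mod p)"
    using binary_chinese_remainder_nat coprime_p_q_minus_1 coprime_commute by metis
  have "coprime w p" using w(2) assms(2) cong_imp_coprime cong_sym by blast
  moreover have "coprime w (q - 1)" using w(1) assms(1) cong_imp_coprime cong_sym by blast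
  ultimately show thesis using that w by simp
qed

text \<open>The conjugation is chosen to fix the \<open>p\<close>-th roots of unity, which makes the
  factor in \<open>galois_G\<close> equal to 1.\<close>

lemma G_mult_coprime_eq:
  assumes "coprime u (q - 1)" "G (int c) = G (int c')"
  shows "G (int (u * c)) = G (int (u * c'))"
proof -
  obtain w where w: "coprime w (p * (q - 1))" "[w = u] (mod (q - 1))" "[w = 1] (mod p)"
    using exists_twist[OF assms(1), of 1] by auto
  have "galois (p * (q - 1)) w (G (int d)) = G (int (u * d))" for d
  proof -
    have "galois (p * (q - 1)) w (G (int d)) = G (int (w * d))"
      using galois_G[OF w(1), of "int d"] tau_nat_1[OF w(3)] by simp
    also have "\<dots> = G (int (u * d))"
    proof (rule G_cong)
      have "[w * d = u * d] (mod (q - 1))" using w(2) by (rule cong_scalar_right)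
      then show "int (q - 1) dvd int (w * d) - int (u * d)"
        unfolding cong_int_iff[symmetric] cong_iff_dvd_diff .
    qed
    finally show ?thesis .
  qed
  then show ?thesis using assms(2) by metis
qed

lemma G_eq_imp:
  assumes f3: "p = 2 \<longrightarrow> f \<ge> 3" and c: "c < q - 1" "c' < q - 1" and eq: "G (int c) = G (int c')"
  shows "coprime u (q - 1) \<Longrightarrow>
      digit_sum p f (int (u * c mod (q - 1))) = digit_sum p f (int (u * c' mod (q - 1)))"
    and "leading_cong (int c) (int c')"
proof -
  show *: "digit_sum p f (int (u * c mod (q - 1))) = digit_sum p f (int (u * c' mod (q - 1)))"
    if "coprime u (q - 1)" for u
  proof -
    have eq': "G (int (u * c mod (q - 1))) = G (int (u * c' mod (q - 1)))"
      using G_mult_coprime_eq[OF that eq] by (simp only: G_mod)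
    have lt: "u * c mod (q - 1) < q - 1" "u * c' mod (q - 1) < q - 1" using q_gt_2 by simp_all
    show ?thesis
      using digit_sum_le_if_G_eq[OF lt eq'] digit_sum_le_if_G_eq[OF lt(2,1) eq'[symmetric]] by simp
  qed
  have "digit_sum p f (int c) = digit_sum p f (int c')"
    using *[of 1] c by simp
  then show "leading_cong (int c) (int c')" by (rule leading_cong_if_G_eq[OF f3 c eq])
qed

section \<open>From the digit conditions to equal Gauss sums\<close>

lemma G_quotient:
  assumes "c < q - 1" "0 < c'" "c' < q - 1" "digit_sum p f (int c) = digit_sum p f (int c')"
  obtains K K' where "K \<in> A" "K \<notin> P" "K' \<in> A" "K * (G (int c) * cnj (G (int c'))) = of_nat q * K'"
    "leading_cong (int c) (int c') \<Longrightarrow> cg K K'"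
    "p = 2 \<Longrightarrow> f \<ge> 3 \<Longrightarrow> leading_cong (int c) (int c') \<Longrightarrow> four.cg K K'"
proof -
  obtain K where K: "K \<in> A" "K \<notin> P" "G 1 ^ digit_sum p f (int c) = K * G (int c)"
    "cg K ((- 1) ^ Suc (digit_sum p f (int c)) * of_nat (digit_fact_prod p f (int c)))"
    "p = 2 \<and> f \<ge> 3 \<longrightarrow>
      four.cg K ((- 1) ^ (Suc (digit_sum p f (int c)) + digit_cyclic_corr p f (int c)))"
    by (rule stickelbergerE[OF assms(1)])
  obtain K' where K': "K' \<in> A" "K' \<notin> P" "G 1 ^ digit_sum p f (int c) = K' * G (int c')"
    "cg K' ((- 1) ^ Suc (digit_sum p f (int c)) * of_nat (digit_fact_prod p f (int c')))"
    "p = 2 \<and> f \<ge> 3 \<longrightarrow>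
      four.cg K' ((- 1) ^ (Suc (digit_sum p f (int c)) + digit_cyclic_corr p f (int c')))"
    by (rule stickelbergerE[OF assms(3), folded assms(4)])
  \<comment> \<open>The identity \<open>G c / G c' = K' / K\<close> with denominators cleared: the
    division by \<open>G c'\<close> is replaced by multiplication with its complex
    conjugate.\<close>
  have "K * (G (int c) * cnj (G (int c'))) = K' * (G (int c') * cnj (G (int c')))"
    using K(3) K'(3) by (simp add: mult.assoc[symmetric])
  also have "\<dots> = of_nat q * K'"
    using G_norm[OF not_dvd_nat_less[OF assms(2,3)]] by simp
  finally have KK: "K * (G (int c) * cnj (G (int c'))) = of_nat q * K'" .
  have four: "four.cg K K'" if "p = 2" "f \<ge> 3" "leading_cong (int c) (int c')"
  proof -
    define b b' where b: "b = digit_cyclic_corr p f (int c)" "b' = digit_cyclic_corr p f (int c')"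
    have "[b = b'] (mod 2)" using that(3) unfolding leading_cong_def b using that(1) by simp
    then have "b mod 2 = b' mod 2" unfolding unique_euclidean_semiring_class.cong_def .
    then have "even b \<longleftrightarrow> even b'" by presburger
    then have pm: "(- 1 :: complex) ^ b = (- 1) ^ b'" by (cases "even b") auto
    have "four.cg K' ((- 1) ^ (Suc (digit_sum p f (int c)) + b))"
      using K'(5) that pm unfolding b(2)[symmetric] power_add by simp
    moreover have "four.cg K ((- 1) ^ (Suc (digit_sum p f (int c)) + b))"
      using K(5) that unfolding b by simp
    ultimately show ?thesis using four.cg_trans four.cg_sym by blast
  qed
  have "cg K K'" if "leading_cong (int c) (int c')"
  proof -
    have "cg (of_nat (digit_fact_prod p f (int c))) (of_nat (digit_fact_prod p f (int c')))"
    proof (cases "p = 2")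
      case True
      have one: "digit_fact_prod p f a = 1" for a
      proof -
        have "fact (digit p a j) = (1::nat)" for j
        proof -
          have "digit p a j < 2" using True by (simp add: digit_def)
          then have "digit p a j = 0 \<or> digit p a j = 1" by linarith
          then show ?thesis by auto
        qed
        then show ?thesis by (simp add: digit_fact_prod_def)
      qed
      show ?thesis unfolding one by auto
    next
      case False
      then have "[digit_fact_prod p f (int c) = digit_fact_prod p f (int c')] (mod p)"
        using that by (simp add: leading_cong_def)
      then show ?thesis unfolding cg_nat_iff unique_euclidean_semiring_class.cong_def .
    qed
    moreover have "(- 1) ^ Suc (digit_sum p f (int c)) \<in> A" by (intro power_closed minus_closed) simp
    ultimately have "cg ((- 1) ^ Suc (digit_sum p f (int c)) * of_nat (digit_fact_prod p f (int c)))
      ((- 1) ^ Suc (digit_sum p f (int c)) * of_nat (digit_fact_prod p f (int c')))"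
      by (intro cg_mult cg_refl)
    from cg_trans[OF K(4) this] cg_sym[OF K'(4)] show ?thesis by (rule cg_trans)
  qed
  then show thesis using that K(1,2) K'(1) KK four by blast
qed

text \<open>The multipliers \<open>K u\<close> differ from one conjugate to the next. The product
  \<open>t\<close> of their powers serves all summands at once and is still outside
  \<open>P\<close>, so the divisibility passes to the rational integer \<open>s\<close>.\<close>

lemma int_mem_power_sums:
  assumes U: "finite U" and K: "\<And>u. u \<in> U \<Longrightarrow> K u \<in> A \<and> K u \<notin> P"
    and r: "\<And>u. u \<in> U \<Longrightarrow> r u \<in> A \<and> K u * x u = of_nat q * r u"
    and s: "(\<Sum>u\<in>U. x u ^ k) = of_int s"
  shows "int (q ^ k) dvd s"
proof -
  define t where "t = (\<Prod>u\<in>U. K u ^ k)"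
  define R where "R = (\<Sum>u\<in>U. (\<Prod>v\<in>U - {u}. K v ^ k) * r u ^ k)"
  have "t \<notin> P"
    unfolding t_def using U K
  proof (induction U rule: finite_induct)
    case (insert u U)
    have "K u ^ k \<notin> P" using P_power insert.prems by blast
    moreover have "(\<Prod>u\<in>U. K u ^ k) \<in> A"
      using insert.prems by (intro prod_closed power_closed) blast
    moreover have "K u ^ k \<in> A" using insert.prems by (intro power_closed) blast
    moreover have "(\<Prod>u\<in>U. K u ^ k) \<notin> P" using insert by blast
    ultimately show ?case using insert.hyps notin_P_mult by simp
  qed (simp add: one_notin_P)
  moreover have "t \<in> A" unfolding t_def using K by blast
  moreover have "R \<in> A" unfolding R_def using K r by (intro sum_closed mult_closed prod_closed power_closed) auto
  moreover have "t * of_int s = of_nat (p ^ (f * k)) * R"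
  proof -
    have "t * of_int s = (\<Sum>u\<in>U. t * x u ^ k)" by (simp only: s[symmetric] sum_distrib_left)
    also have "\<dots> = (\<Sum>u\<in>U. of_nat q ^ k * ((\<Prod>v\<in>U - {u}. K v ^ k) * r u ^ k))"
    proof (rule sum.cong)
      fix u assume u: "u \<in> U"
      have "t = K u ^ k * (\<Prod>v\<in>U - {u}. K v ^ k)" unfolding t_def by (rule prod.remove[OF U u])
      then have "t * x u ^ k = (\<Prod>v\<in>U - {u}. K v ^ k) * (K u * x u) ^ k"
        by (simp add: power_mult_distrib mult_ac)
      also have "(K u * x u) ^ k = of_nat q ^ k * r u ^ k" using r[OF u] by (simp add: power_mult_distrib)
      finally show "t * x u ^ k = of_nat q ^ k * ((\<Prod>v\<in>U - {u}. K v ^ k) * r u ^ k)" by (simp add: mult_ac)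
    qed simp
    also have "\<dots> = of_nat (p ^ (f * k)) * R"
      unfolding R_def sum_distrib_left q_eq by (simp add: power_mult)
    finally show ?thesis .
  qed
  ultimately have "int (p ^ (f * k)) dvd s" using int_dvd_local by blast
  then show ?thesis by (simp add: q_eq power_mult)
qed

lemma mu_cnj_mem: "x \<in> mu \<Longrightarrow> cnj x \<in> mu"
  by (simp add: mu_cnj mu_inverse)

text \<open>The conjugates of \<open>M = G c * cnj (G c')\<close> all have absolute value \<open>q\<close>, and the traces of the
  powers \<open>(M / q) ^ k\<close> are integers; this makes \<open>M / q = G c / G c'\<close> a root of unity.\<close>

lemma G_quotient_root_of_unity:
  assumes c: "0 < c" "c < q - 1" "0 < c'" "c' < q - 1"
    and s: "\<And>u. coprime u (q - 1) \<Longrightarrow>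
      digit_sum p f (int (u * c mod (q - 1))) = digit_sum p f (int (u * c' mod (q - 1)))"
  obtains k where "k > 0" "(G (int c) * cnj (G (int c'))) ^ k = of_nat q ^ k"
proof -
  define n where "n = p * (q - 1)"
  define M where "M = G (int c) * cnj (G (int c'))"
  define U where "U = {u. u < n \<and> coprime u n}"
  have npos: "n > 0" unfolding n_def by (rule n_pos)
  have Mcyc: "M \<in> cyc_ints n"
    unfolding M_def n_def by (intro cyc_ints_mult cyc_ints_cnj[OF n_pos] G_cyc)
  have conj: "\<exists>K r. K \<in> A \<and> K \<notin> P \<and> r \<in> A \<and> K * galois n u M = of_nat q * r"
    and norm: "norm (galois n u M) = q" if u: "u \<in> U" for u
  proof -
    have cop: "coprime u (p * (q - 1))" "coprime u (q - 1)" using u by (auto simp: U_def n_def)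
    define w where "w = tau (of_nat u)"
    have "\<not> p dvd u" using cop p_gt_1 by (metis coprime_common_divisor dvd_triv_left nat_dvd_1_iff_1 less_irrefl)
    then have w: "w \<in> mu" unfolding w_def by (intro tau_mu) (simp_all add: of_nat_mem_P)
    \<comment> \<open>The factor produced by \<open>galois_G\<close>; being an element of
      \<open>A\<close> of absolute value 1, it disturbs neither the integrality at \<open>P\<close>
      nor the norm.\<close>
    define x where "x = w powi (int u * int c) * cnj (w powi (int u * int c'))"
    have xA: "x \<in> A" unfolding x_def using w
      by (intro mult_closed mu_mem mu_cnj_mem mu_powi)
    \<comment> \<open>Multiplication by a unit keeps nonzero classes nonzero, so
      \<open>G_norm\<close> applies to every conjugate.\<close>
    have red: "0 < u * d mod (q - 1)" if "0 < d" "d < q - 1" for d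
    proof -
      have "\<not> (q - 1) dvd d" using that nat_dvd_not_less by blast
      then have "\<not> (q - 1) dvd u * d" using cop(2) by (simp add: coprime_dvd_mult_right_iff coprime_commute)
      then show ?thesis by (simp add: mod_greater_zero_iff_not_dvd)
    qed
    have lt: "u * d mod (q - 1) < q - 1" for d using q_gt_2 by simp
    have gM: "galois n u M = x * (G (int (u * c mod (q - 1))) * cnj (G (int (u * c' mod (q - 1)))))"
    proof -
      have "galois n u M = galois n u (G (int c)) * cnj (galois n u (G (int c')))"
        unfolding M_def n_def
        using galois_mult[OF cop(1) G_cyc cyc_ints_cnj[OF n_pos G_cyc]] galois_cnj[OF cop(1) G_cyc] by simp
      then show ?thesis
        unfolding n_def galois_G[OF cop(1)] G_mod w_def[symmetric] x_def by (simp add: mult_ac)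
    qed
    obtain K K' where K: "K \<in> A" "K \<notin> P" "K' \<in> A"
      "K * (G (int (u * c mod (q - 1))) * cnj (G (int (u * c' mod (q - 1))))) = of_nat q * K'"
      using G_quotient[OF lt red[OF c(3,4)] lt s[OF cop(2)]] by metis
    have "K * galois n u M = x * (K * (G (int (u * c mod (q - 1))) * cnj (G (int (u * c' mod (q - 1))))))"
      unfolding gM by (simp only: mult_ac)
    also have "\<dots> = of_nat q * (x * K')" unfolding K(4) by (simp only: mult_ac)
    finally have "K * galois n u M = of_nat q * (x * K')" .
    moreover have "x * K' \<in> A" using xA K(3) by (rule mult_closed)
    ultimately show "\<exists>K r. K \<in> A \<and> K \<notin> P \<and> r \<in> A \<and> K * galois n u M = of_nat q * r"
      using K(1,2) by blast
    have nx: "norm x = 1"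
      unfolding x_def norm_mult complex_mod_cnj using mu_norm[OF mu_powi[OF w]] by simp
    have nG: "norm (G (int (u * d mod (q - 1)))) = sqrt q" if "0 < d" "d < q - 1" for d
      using G_norm_abs[OF not_dvd_nat_less[OF red[OF that] lt]] by (metis norm_ge_zero real_sqrt_unique)
    show "norm (galois n u M) = q"
      unfolding gM norm_mult complex_mod_cnj nx nG[OF c(1,2)] nG[OF c(3,4)] by simp
  qed
  obtain K r where Kr: "\<And>u. u \<in> U \<Longrightarrow> K u \<in> A \<and> K u \<notin> P \<and> r u \<in> A \<and> K u * galois n u M = of_nat q * r u"
    using conj by metis
  have "(\<Sum>u\<in>U. (galois n u M / of_nat q) ^ k) \<in> \<int>" for k
  proof -
    have "(\<Sum>u\<in>U. galois n u M ^ k) = (\<Sum>u\<in>U. galois n u (M ^ k))"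
      unfolding U_def n_def by (intro sum.cong refl galois_power[symmetric]) (use Mcyc in \<open>auto simp: n_def\<close>)
    also have "\<dots> \<in> \<int>"
      unfolding U_def n_def by (intro sum_galois_int cyc_ints_power Mcyc[unfolded n_def])
    finally obtain s where s: "(\<Sum>u\<in>U. galois n u M ^ k) = of_int s" by (elim Ints_cases)
    have "int (q ^ k) dvd s"
      by (rule int_mem_power_sums[OF _ _ _ s, of K r]) (use Kr in \<open>auto simp: U_def\<close>)
    then obtain s' where "s = int (q ^ k) * s'" by blast
    then have "(\<Sum>u\<in>U. galois n u M ^ k) = of_nat q ^ k * of_int s'" using s by simp
    then have "(\<Sum>u\<in>U. galois n u M ^ k) / of_nat q ^ k = of_int s'" using q_gt_2 by simp
    then show ?thesis by (simp add: power_divide flip: sum_divide_distrib)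
  qed
  moreover have "norm (galois n u M / of_nat q) = 1" if "u \<in> U" for u
    using norm[OF that] q_gt_2 by (simp add: norm_divide)
  moreover have "U \<subseteq> {..<n}" by (auto simp: U_def)
  ultimately obtain k where k: "k > 0" "\<And>u. u \<in> U \<Longrightarrow> (galois n u M / of_nat q) ^ k = 1"
    using roots_of_unity_if_int_power_sums[of U n "\<lambda>u. galois n u M / of_nat q"] by metis
  have "n \<noteq> 1" using p_gt_1 unfolding n_def by simp
  then have one: "1 \<in> U" using npos by (auto simp: U_def)
  have "galois n 1 M = M"
  proof -
    obtain g where "M = ipoly g (unity_gen n)" using Mcyc by (rule cyc_intsE)
    then show ?thesis using galois_ipoly[of 1 g] by (simp add: n_def)
  qed
  then have "M ^ k = of_nat q ^ k" using k(2)[OF one] q_gt_2 by (simp add: power_divide)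
  then show thesis using that k(1) unfolding M_def by blast
qed

text \<open>If \<open>\<epsilon>\<close> were not 1, its geometric sum would vanish, while after
  multiplication by \<open>B ^ (k - 1)\<close> it is congruent to \<open>k * B ^ (k - 1)\<close>,
  which is prime to \<open>P\<close>. Powers of \<open>B\<close> are spread over the terms so that
  \<open>\<epsilon>\<close> occurs only in \<open>\<epsilon> * B\<close>, which is known to lie in
  \<open>A\<close>.\<close>

lemma eq_1_if_power_coprime_p:
  assumes "B \<in> A" "B \<notin> P" "cg (\<epsilon> * B) B" "\<epsilon> ^ k = 1" "\<not> p dvd k"
  shows "\<epsilon> = 1"
proof (rule ccontr)
  assume ne: "\<epsilon> \<noteq> 1"
  have "(\<Sum>i<k. (\<epsilon> * B) ^ i * B ^ (k - 1 - i)) = (\<Sum>i<k. \<epsilon> ^ i) * B ^ (k - 1)"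
    unfolding sum_distrib_right
    by (intro sum.cong) (auto simp: power_mult_distrib mult.assoc power_add[symmetric])
  also have "(\<Sum>i<k. \<epsilon> ^ i) = 0" using geometric_sum[OF ne, of k] assms(4) by simp
  finally have 0: "(\<Sum>i<k. (\<epsilon> * B) ^ i * B ^ (k - 1 - i)) = 0" by simp
  have "cg (\<Sum>i<k. (\<epsilon> * B) ^ i * B ^ (k - 1 - i)) (\<Sum>i<k. B ^ i * B ^ (k - 1 - i))"
    using assms by (intro cg_sum cg_mult cg_power[OF assms(3)] cg_refl power_closed)
  also have "(\<Sum>i<k. B ^ i * B ^ (k - 1 - i)) = of_nat k * B ^ (k - 1)"
    by (simp add: power_add[symmetric])
  finally have "of_nat k * B ^ (k - 1) \<in> P" unfolding 0 using cg_0_iff cg_sym by blast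
  then show False
    using P_prime[OF nat_closed power_closed[OF assms(1)]] P_power[OF assms(1)] assms(2,5) of_nat_mem_P by blast
qed

lemma G_eq_if:
  assumes f3: "p = 2 \<longrightarrow> f \<ge> 3" and c: "0 < c" "c < q - 1" "0 < c'" "c' < q - 1"
    and s: "\<And>u. coprime u (q - 1) \<Longrightarrow>
      digit_sum p f (int (u * c mod (q - 1))) = digit_sum p f (int (u * c' mod (q - 1)))"
    and lead: "leading_cong (int c) (int c')"
  shows "G (int c) = G (int c')"
proof -
  define M where "M = G (int c) * cnj (G (int c'))"
  define \<epsilon> where "\<epsilon> = M / of_nat q"
  have M: "M = of_nat q * \<epsilon>" using q_gt_2 by (simp add: \<epsilon>_def)
  have s1: "digit_sum p f (int c) = digit_sum p f (int c')" using s[of 1] c by simp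
  obtain K K' where K: "K \<in> A" "K \<notin> P" "K' \<in> A" "K * M = of_nat q * K'" "cg K K'"
    "p = 2 \<Longrightarrow> f \<ge> 3 \<Longrightarrow> four.cg K K'"
    unfolding M_def using G_quotient[OF c(2-4) s1] lead by metis
  have KK: "K' = \<epsilon> * K" using K(4) q_gt_2 by (simp add: M mult_ac)
  obtain k where k: "k > 0" "\<epsilon> ^ k = 1"
  proof -
    obtain k where "k > 0" "M ^ k = of_nat q ^ k"
      using G_quotient_root_of_unity[OF c s] unfolding M_def by blast
    then show thesis using that[of k] q_gt_2 by (simp add: \<epsilon>_def power_divide)
  qed
  \<comment> \<open>The part of the order prime to \<open>p\<close> is eliminated by the congruence
    modulo \<open>P\<close> alone; the \<open>p\<close>-part is lowered below, one factor
    \<open>p\<close> at a time.\<close>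
  obtain a k' where k': "k = p ^ a * k'" "\<not> p dvd k'"
    using k(1) prime_p multiplicity_decompose'[of k p] prime_p not_prime_unit
    by (metis less_irrefl mult.commute)
  have "\<epsilon> ^ (p ^ a) = 1"
  proof (rule eq_1_if_power_coprime_p)
    show "K ^ (p ^ a) \<in> A" "K ^ (p ^ a) \<notin> P" using K(1,2) P_power by blast+
    have "cg (K' ^ (p ^ a)) (K ^ (p ^ a))" using cg_power[OF cg_sym[OF K(5)]] .
    then show "cg (\<epsilon> ^ (p ^ a) * K ^ (p ^ a)) (K ^ (p ^ a))" by (simp only: KK power_mult_distrib)
    show "(\<epsilon> ^ (p ^ a)) ^ k' = 1" using k(2) k'(1) by (simp add: power_mult)
  qed (rule k'(2))
  then have "\<epsilon> = 1"
  proof (induction a)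
    case (Suc a)
    define \<eta> where "\<eta> = \<epsilon> ^ (p ^ a)"
    have \<eta>p: "\<eta> ^ p = 1" using Suc.prems by (simp add: \<eta>_def power_mult[symmetric] mult.commute)
    have "\<eta> = 1"
    proof (cases "p = 2")
      case True
      show ?thesis
      proof (rule ccontr)
        assume "\<eta> \<noteq> 1"
        then have "\<eta> = - 1" using \<eta>p True by (simp add: power2_eq_1_iff)
        then have "K' ^ (p ^ a) = - (K ^ (p ^ a))" by (simp add: KK power_mult_distrib \<eta>_def)
        then have "four.cg (K ^ (p ^ a)) (- (K ^ (p ^ a)))"
          using four.cg_power[OF K(6), of "p ^ a"] True f3 by simp
        then have "2 * K ^ (p ^ a) \<in> I4" by (simp add: four.cg_def)
        then show False using two_mult_notin_I4[OF True power_closed[OF K(1)]] P_power[OF K(1)] K(2) by blast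
      qed
    next
      case False
      then have podd: "odd p" using prime_p primes_dvd_imp_eq two_is_prime_nat by blast
      have qeven: "even (q - 1)" using podd by (simp add: q_eq)
      \<comment> \<open>\<open>p - 1\<close> stands for -1: this conjugation fixes the
        \<open>(q-1)\<close>-st roots of unity and inverts the \<open>p\<close>-th ones. As
        \<open>tau w\<close> is -1, it multiplies \<open>G d\<close> by
        \<open>(-1) ^ d\<close>.\<close>
      obtain w where w: "coprime w (p * (q - 1))" "[w = 1] (mod (q - 1))" "[w = p - 1] (mod p)"
      proof (rule exists_twist[of 1 "p - 1"])
        show "coprime (p - 1) p" using p_gt_1 coprime_diff_one_left_nat by auto
      qed auto
      have wodd: "odd w" using w(1) qeven by (meson coprime_common_divisor dvd_mult odd_one)
      have pw: "p dvd w + 1"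
      proof -
        have "[w + 1 = (p - 1) + 1] (mod p)" using w(3) by (intro cong_add cong_refl)
        then have "[w + 1 = 0] (mod p)" using p_gt_1 by (simp add: unique_euclidean_semiring_class.cong_def)
        then show ?thesis by (simp add: cong_0_iff)
      qed
      have tw: "tau (of_nat w) = - 1"
      proof (rule tau_eqI)
        show "- 1 \<in> T" using qeven by (simp add: T_def mu_def)
        have "of_nat w - (- 1) = (of_nat (w + 1) :: complex)" by simp
        then have "of_nat w - (- 1) \<in> P" using pw of_nat_mem_P[of "w + 1"] by metis
        then show "cg (of_nat w) (- 1)"
          unfolding cg_def using minus_closed[OF one_closed] nat_closed by blast
      qed
      have gG: "galois (p * (q - 1)) w (G (int d)) = (- 1) ^ d * G (int d)" for d
      proof -
        have "[int w * int d = 1 * int d] (mod int (q - 1))"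
          using w(2) by (intro cong_mult cong_refl) (simp add: cong_int_iff[symmetric])
        then have "G (int w * int d) = G (int d)"
          by (intro G_cong) (simp add: cong_iff_dvd_diff)
        moreover have "(- 1 :: complex) powi (int w * int d) = (- 1) ^ d"
          using wodd by (simp add: power_int_mult)
        ultimately show ?thesis using galois_G[OF w(1), of "int d"] tw by simp
      qed
      \<comment> \<open>The signs picked up by the two Gauss sums cancel because equal digit sums
        force equal parity of \<open>c\<close> and \<open>c'\<close>; hence \<open>M\<close> is
        fixed.\<close>
      have "even c \<longleftrightarrow> even c'"
        using even_digit_sum_iff[OF podd p_gt_1 f_pos, of c] even_digit_sum_iff[OF podd p_gt_1 f_pos, of c'] c s1
        by (simp add: q_eq)
      then have sign: "(- 1 :: complex) ^ c * (- 1) ^ c' = 1" by (cases "even c") auto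
      have "galois (p * (q - 1)) w M = galois (p * (q - 1)) w (G (int c)) * cnj (galois (p * (q - 1)) w (G (int c')))"
        unfolding M_def
        using galois_mult[OF w(1) G_cyc cyc_ints_cnj[OF n_pos G_cyc]] galois_cnj[OF w(1) G_cyc] by simp
      also have "\<dots> = ((- 1) ^ c * (- 1) ^ c') * M"
        unfolding gG M_def by (simp add: mult_ac)
      finally have gM: "galois (p * (q - 1)) w M = M" unfolding sign by simp
      have Mcyc: "M \<in> cyc_ints (p * (q - 1))"
        unfolding M_def by (intro cyc_ints_mult cyc_ints_cnj[OF n_pos] G_cyc)
      have \<eta>n: "\<eta> ^ (p * (q - 1)) = 1" by (simp add: power_mult \<eta>p)
      have \<eta>cyc: "\<eta> \<in> cyc_ints (p * (q - 1))" by (rule cyc_ints_root[OF n_pos \<eta>n])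
      \<comment> \<open>\<open>\<eta>\<close> is compared with its conjugate through
        \<open>M ^ (p ^ a) = N * \<eta>\<close>: the left side and \<open>N\<close> are both fixed
        by the conjugation.\<close>
      define N where "N = int (q ^ (p ^ a))"
      have Ncyc: "of_int N \<in> cyc_ints (p * (q - 1))"
        using ipoly_in_cyc_ints[of "[:N:]"] by simp
      have Mpow: "M ^ (p ^ a) = of_int N * \<eta>" by (simp add: M power_mult_distrib \<eta>_def N_def)
      have "of_int N * \<eta> = galois (p * (q - 1)) w (M ^ (p ^ a))"
        unfolding galois_power[OF w(1) Mcyc] gM by (rule Mpow[symmetric])
      also have "\<dots> = of_int N * \<eta> ^ w"
        unfolding Mpow
        by (simp only: galois_mult[OF w(1) Ncyc \<eta>cyc] galois_of_int[OF w(1)] galois_root[OF w(1) \<eta>n])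
      finally have "\<eta> = \<eta> ^ w" using q_gt_2 by (simp add: N_def)
      \<comment> \<open>Being fixed and inverted at once leaves \<open>\<eta> ^ 2 = 1\<close>, which
        together with \<open>\<eta> ^ p = 1\<close> for odd \<open>p\<close> gives
        \<open>\<eta> = 1\<close>.\<close>
      then have "\<eta> ^ 2 = \<eta> ^ (w + 1)" by (simp add: power2_eq_square)
      also have "\<dots> = 1"
      proof -
        obtain j where "w + 1 = p * j" using pw by (rule dvdE)
        then show ?thesis by (simp only: power_mult \<eta>p power_one)
      qed
      finally have \<eta>2: "\<eta> ^ 2 = 1" .
      obtain j where "p = 2 * j + 1" using podd by (rule oddE)
      then have "\<eta> ^ p = \<eta>" using \<eta>2 by (simp add: power_add power_mult)
      then show ?thesis using \<eta>p by simp
    qed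
    then show ?case unfolding \<eta>_def by (rule Suc.IH)
  qed simp
  then have "G (int c) * cnj (G (int c')) = G (int c') * cnj (G (int c'))"
    using G_norm[OF not_dvd_nat_less[OF c(3,4)]] M unfolding M_def by simp
  then show ?thesis using G_nz[OF not_dvd_nat_less[OF c(3,4)]] by simp
qed

theorem G_eq_iff:
  assumes f3: "p = 2 \<longrightarrow> f \<ge> 3" and c: "c < q - 1" "c' < q - 1"
  shows "G (int c) = G (int c') \<longleftrightarrow>
    (\<forall>u. coprime u (q - 1) \<longrightarrow>
      digit_sum p f (int (u * c mod (q - 1))) = digit_sum p f (int (u * c' mod (q - 1)))) \<and>
    leading_cong (int c) (int c')"
proof
  assume "G (int c) = G (int c')"
  then show "(\<forall>u. coprime u (q - 1) \<longrightarrow>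
      digit_sum p f (int (u * c mod (q - 1))) = digit_sum p f (int (u * c' mod (q - 1)))) \<and>
    leading_cong (int c) (int c')"
    using G_eq_imp[OF f3 c] by blast
next
  assume *: "(\<forall>u. coprime u (q - 1) \<longrightarrow>
      digit_sum p f (int (u * c mod (q - 1))) = digit_sum p f (int (u * c' mod (q - 1)))) \<and>
    leading_cong (int c) (int c')"
  then have s1: "digit_sum p f (int c) = digit_sum p f (int c')"
    using c by (auto dest!: spec[of _ 1])
  \<comment> \<open>The zero class, whose Gauss sum is -1 and not of absolute value
    \<open>sqrt q\<close>, is matched separately; its digit sum identifies it.\<close>
  have s0: "digit_sum p f (int d) = 0 \<longleftrightarrow> d = 0" if "d < q - 1" for d
  proof
    assume "digit_sum p f (int d) = 0"
    moreover have "d < p ^ f" using that unfolding q_eq by linarith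
    ultimately show "d = 0" using digit_sum_pos[OF p_gt_1 f_pos, of d] by (cases "d = 0") auto
  qed (simp add: digit_sum_def digit_def)
  show "G (int c) = G (int c')"
  proof (cases "c = 0")
    case True
    then have "c' = 0" using s0[OF c(1)] s0[OF c(2)] s1 by simp
    then show ?thesis using True by simp
  next
    case False
    then have "c' \<noteq> 0" using s0[OF c(1)] s0[OF c(2)] s1 by simp
    then show ?thesis using False * c by (intro G_eq_if[OF f3]) auto
  qed
qed

end

section \<open>Transfer from the residue field\<close>

lemma algebraic_int_root_of_unity:
  fixes z :: complex
  assumes "n > 0" "z ^ n = 1"
  shows "algebraic_int z"
proof (rule algebraic_int_root)
  show "poly (Polynomial.monom 1 n) z = 1" using assms by (simp add: poly_monom)
qed (use assms in \<open>auto simp: degree_monom_eq\<close>)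

locale residue_field_iso =
  fixes p f q :: nat
    and F :: "('a, 'b) ring_scheme"
    and \<zeta> :: complex
    and OL :: "complex ring"
    and P :: "complex set"
    and \<phi> :: "complex set \<Rightarrow> 'a"
  assumes p: "Factorial_Ring.prime p" and f: "f \<ge> 1" and q: "q = p ^ f" and q2: "q > 2"
    and F: "field F" "Coset.order F = q"
    and zeta: "unity_roots p = {\<zeta> ^ k | k :: nat. True}"
    and OL: "OL = ring_of_integers (cyclotomic (p * (q - 1)))"
    and P: "prime_over OL p P"
    and \<phi>: "\<phi> \<in> ring_iso (OL Quot P) F"
begin

lemma OL_simps:
  "monoid.mult OL = (*)" "monoid.one OL = 1" "ring.zero OL = 0" "ring.add OL = (+)"
  by (simp_all add: OL ring_of_integers_def ring_of_type_algebra_def)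

lemma primeideal_P: "primeideal P OL"
  using P by (simp add: prime_over_def)

sublocale F: field F by (rule F(1))

sublocale P: primeideal P OL by (rule primeideal_P)

text \<open>The inverse in the ring record is defined abstractly from its addition and carrier, so
  it must be identified with complex negation.\<close>

lemma a_minus_OL:
  assumes "x \<in> carrier OL" "y \<in> carrier OL"
  shows "x \<ominus>\<^bsub>OL\<^esub> y = x - y"
proof -
  have "\<ominus>\<^bsub>OL\<^esub> y + y = 0" using P.l_neg[OF assms(2)] by (simp add: OL_simps)
  then have "\<ominus>\<^bsub>OL\<^esub> y = - y" by (simp add: eq_neg_iff_add_eq_0)
  then show ?thesis by (simp add: a_minus_def OL_simps)
qed

definition red :: "complex \<Rightarrow> 'a" where
  "red x = \<phi> (P +>\<^bsub>OL\<^esub> x)"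

lemma red_hom: "red \<in> ring_hom OL F"
proof -
  have "\<phi> \<in> ring_hom (OL Quot P) F" using \<phi> by (simp add: ring_iso_def)
  from ring_hom_trans[OF P.rcos_ring_hom this] show ?thesis
    by (simp add: red_def[abs_def] comp_def)
qed

lemma red_eq_iff:
  assumes "x \<in> carrier OL" "y \<in> carrier OL"
  shows "red x = red y \<longleftrightarrow> x - y \<in> P"
proof -
  have mem: "P +>\<^bsub>OL\<^esub> z \<in> carrier (OL Quot P)" if "z \<in> carrier OL" for z
    using that by (auto simp: FactRing_def A_RCOSETS_def')
  have "inj_on \<phi> (carrier (OL Quot P))" using \<phi> by (simp add: ring_iso_def bij_betw_def)
  then have "red x = red y \<longleftrightarrow> P +>\<^bsub>OL\<^esub> x = P +>\<^bsub>OL\<^esub> y"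
    unfolding red_def using mem[OF assms(1)] mem[OF assms(2)] by (auto dest: inj_onD)
  also have "\<dots> \<longleftrightarrow> x \<ominus>\<^bsub>OL\<^esub> y \<in> P"
    using P.quotient_eq_iff_same_a_r_cos[OF P.is_ideal assms] by simp
  finally show ?thesis using a_minus_OL[OF assms] by simp
qed

lemma red_image: "red ` carrier OL = carrier F"
proof -
  have "\<phi> ` carrier (OL Quot P) = carrier F" using \<phi> by (simp add: ring_iso_def bij_betw_def)
  moreover have "carrier (OL Quot P) = (\<lambda>x. P +>\<^bsub>OL\<^esub> x) ` carrier OL"
    by (auto simp: FactRing_def A_RCOSETS_def')
  ultimately show ?thesis by (simp add: red_def image_image)
qed

lemma additive_subgroup_P: "additive_subgroup P OL"
  by (rule ideal.axioms(1)[OF P.is_ideal])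

lemma prime_above_OL: "prime_above (carrier OL) P p f q"
proof
  show "1 \<in> carrier OL" using P.one_closed by (simp add: OL_simps)
  show "x - y \<in> carrier OL" if "x \<in> carrier OL" "y \<in> carrier OL" for x y
    using P.minus_closed[OF that] a_minus_OL[OF that] by simp
  show "x * y \<in> carrier OL" if "x \<in> carrier OL" "y \<in> carrier OL" for x y
    using P.m_closed[OF that] by (simp add: OL_simps)
  show "P \<subseteq> carrier OL" by (rule P.a_subset)
  show "0 \<in> P"
    using additive_subgroup.zero_closed[OF additive_subgroup_P] by (simp add: OL_simps)
  show "x - y \<in> P" if "x \<in> P" "y \<in> P" for x y
  proof -
    have "x \<ominus>\<^bsub>OL\<^esub> y \<in> P"
      unfolding a_minus_def using that additive_subgroup.a_closed[OF additive_subgroup_P]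
        additive_subgroup.a_inv_closed[OF additive_subgroup_P] P.is_abelian_group by blast
    then show ?thesis using a_minus_OL that P.a_Hcarr by simp
  qed
  show "a * x \<in> P" if "a \<in> carrier OL" "x \<in> P" for a x
    using P.I_l_closed[OF that(2,1)] by (simp add: OL_simps)
  show "algebraic_int x" if "x \<in> carrier OL" for x
    using that by (simp add: OL ring_of_integers_def)
  show "z \<in> carrier OL" if "z ^ (p * (q - 1)) = 1" for z
  proof -
    have "z \<in> cyclotomic (p * (q - 1))"
      unfolding cyclotomic_def using that by (intro generate_field.incl) (simp add: unity_roots_def)
    moreover have "algebraic_int z"
      using algebraic_int_root_of_unity[OF _ that] q2 prime_gt_0_nat[OF p] by simp
    ultimately show ?thesis by (simp add: OL ring_of_integers_def)
  qed
  show "x \<in> P \<or> y \<in> P" if "x \<in> carrier OL" "y \<in> carrier OL" "x * y \<in> P" for x y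
    using P.I_prime[OF that(1,2)] that(3) by (simp add: OL_simps)
  show "of_int k \<in> P \<longleftrightarrow> int p dvd k" for k
  proof -
    have "of_int k \<in> P \<longleftrightarrow> of_int k \<in> P \<inter> \<int>" by simp
    also have "\<dots> \<longleftrightarrow> int p dvd k" using P by (auto simp: prime_over_def)
    finally show ?thesis .
  qed
qed (use p f q q2 in auto)

text \<open>The order of \<open>F\<close> enters here: reduction has an image of exactly
  \<open>q\<close> elements, so the \<open>q\<close> representatives in \<open>T\<close> meet every
  class.\<close>

sublocale residue_setup "carrier OL" P p f q \<zeta>
proof (intro residue_setup.intro residue_setup_axioms.intro prime_above_OL)
  interpret base: prime_above "carrier OL" P p f q by (rule prime_above_OL)
  fix x assume x: "x \<in> carrier OL"
  have "card (carrier F) = q" using F(2) by (simp add: Coset.order_def)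
  then have "finite (red ` carrier OL)" "card (red ` carrier OL) \<le> q"
    using q2 unfolding red_image by (auto intro: card_ge_0_finite)
  from base.residue_representative[OF red_eq_iff this x] show "\<exists>z\<in>prime_above.T q. x - z \<in> P" .
qed (rule zeta)

lemma red_eq_iff_cg: "x \<in> carrier OL \<Longrightarrow> y \<in> carrier OL \<Longrightarrow> red x = red y \<longleftrightarrow> cg x y"
  by (simp add: red_eq_iff cg_def)

lemma red_mem [simp]: "x \<in> carrier OL \<Longrightarrow> red x \<in> carrier F"
  using ring_hom_closed[OF red_hom] .

lemma red_add: "x \<in> carrier OL \<Longrightarrow> y \<in> carrier OL \<Longrightarrow> red (x + y) = red x \<oplus>\<^bsub>F\<^esub> red y"
  using ring_hom_add[OF red_hom] by (simp add: OL_simps)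

lemma red_mult: "x \<in> carrier OL \<Longrightarrow> y \<in> carrier OL \<Longrightarrow> red (x * y) = red x \<otimes>\<^bsub>F\<^esub> red y"
  using ring_hom_mult[OF red_hom] by (simp add: OL_simps)

lemma red_1: "red 1 = \<one>\<^bsub>F\<^esub>"
  using ring_hom_one[OF red_hom] by (simp add: OL_simps)

lemma red_0: "red 0 = \<zero>\<^bsub>F\<^esub>"
proof -
  have "red 0 \<oplus>\<^bsub>F\<^esub> red 0 = red 0" using red_add[of 0 0] by simp
  then show ?thesis using F.add.l_cancel_one[of "red 0" "red 0"] by simp
qed

lemma red_power: "x \<in> carrier OL \<Longrightarrow> red (x ^ k) = red x [^]\<^bsub>F\<^esub> k"
  by (induction k) (simp_all add: red_1 red_mult power_closed F.m_comm)

lemma red_of_nat: "red (of_nat k) = [k] \<cdot>\<^bsub>F\<^esub> \<one>\<^bsub>F\<^esub>"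
  by (induction k) (simp_all add: red_0 red_1 red_add F.a_comm)

lemma red_trc:
  assumes "x \<in> carrier OL"
  shows "red (trc x) = field_trace F p f (red x)"
proof -
  have "red (\<Sum>i<m. x ^ (p ^ i)) = (\<Oplus>\<^bsub>F\<^esub>i\<in>{..<m}. red x [^]\<^bsub>F\<^esub> (p ^ i))" for m
  proof (induction m)
    case (Suc m)
    have "red (\<Sum>i<Suc m. x ^ (p ^ i)) = red (x ^ (p ^ m)) \<oplus>\<^bsub>F\<^esub> red (\<Sum>i<m. x ^ (p ^ i))"
      using assms by (simp add: red_add power_closed sum_closed add.commute)
    then show ?case
      using assms by (simp add: lessThan_Suc red_power Suc)
  qed (simp add: red_0)
  then show ?thesis by (simp add: trc_def field_trace_def)
qed

text \<open>Both exponents are described as the unique number with a given property, and reduction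
  turns one property into the other.\<close>

lemma additive_char_red:
  assumes "x \<in> carrier OL"
  shows "additive_char F p f \<zeta> (red x) = psi x"
proof -
  have "[k] \<cdot>\<^bsub>F\<^esub> \<one>\<^bsub>F\<^esub> = field_trace F p f (red x) \<longleftrightarrow> cg (of_nat k) (trc x)" for k
    unfolding red_of_nat[symmetric] red_trc[OF assms, symmetric]
    using assms by (intro red_eq_iff_cg) auto
  then show ?thesis by (simp add: additive_char_def psi_def tr_def)
qed

lemma bij_red_mu: "bij_betw red mu (Units F)"
proof -
  have inj: "inj_on red T"
  proof (rule inj_onI)
    fix y z assume yz: "y \<in> T" "z \<in> T" "red y = red z"
    then have "cg y z" using red_eq_iff_cg[OF T_mem T_mem] by blast
    then show "y = z" by (rule T_cg_imp_eq[OF yz(1,2)])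
  qed
  have "red ` T = carrier F"
  proof
    show "red ` T \<subseteq> carrier F" using T_mem by auto
    show "carrier F \<subseteq> red ` T"
    proof
      fix a assume "a \<in> carrier F"
      then obtain x where x: "x \<in> carrier OL" "a = red x" unfolding red_image[symmetric] by blast
      obtain z where "z \<in> T" "x - z \<in> P" using residue[OF x(1)] by blast
      then show "a \<in> red ` T" using x red_eq_iff[OF x(1) T_mem] by blast
    qed
  qed
  moreover have "red ` (T - {0}) = red ` T - red ` {0}"
    by (rule inj_on_image_set_diff[OF inj]) (auto simp: T_def)
  ultimately have "red ` (T - {0}) = carrier F - {\<zero>\<^bsub>F\<^esub>}"
    by (simp add: red_0)
  moreover have "T - {0} = mu" by (auto simp: T_def)
  ultimately have "red ` mu = Units F" using F.field_Units by simp
  moreover have "inj_on red mu" using inj by (rule inj_on_subset) (auto simp: T_def)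
  ultimately show ?thesis by (simp add: bij_betw_def)
qed

lemma teichmueller_red:
  assumes "z \<in> mu"
  shows "teichmueller OL P \<phi> q (red z) = z"
  unfolding teichmueller_def red_def[symmetric]
proof (rule the_equality)
  show "z \<in> unity_roots (q - 1) \<and> red z = red z" using assms by (simp add: unity_roots_def mu_def)
  fix y assume "y \<in> unity_roots (q - 1) \<and> red y = red z"
  then have "y \<in> mu" "red y = red z" by (simp_all add: unity_roots_def mu_def)
  then show "y = z" using bij_red_mu assms by (auto simp: bij_betw_def inj_on_def)
qed

lemma gauss_sum_eq_G:
  "gauss_sum F p f \<zeta> (\<lambda>a. teichmueller OL P \<phi> q a powi (- c)) = G c"
proof -
  have "gauss_sum F p f \<zeta> (\<lambda>a. teichmueller OL P \<phi> q a powi (- c)) =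
    (\<Sum>z\<in>mu. teichmueller OL P \<phi> q (red z) powi (- c) * additive_char F p f \<zeta> (red z))"
    unfolding gauss_sum_def by (rule sum.reindex_bij_betw[OF bij_red_mu, symmetric])
  also have "\<dots> = G c"
    unfolding G_def
    by (intro sum.cong) (simp_all only: teichmueller_red additive_char_red mu_mem)
  finally show ?thesis .
qed

end

text \<open>Passes between units as integers in the range from 1 to \<open>m - 1\<close> and
  arbitrary natural numbers coprime to \<open>m\<close>; \<open>D\<close> sees only the reduced
  product, so both quantifications say the same.\<close>

lemma residue_ring_units_iff:
  fixes c c' m :: nat
  assumes "m > 1" and Z: "Z = residue_ring (int m)"
  shows "(\<forall>u\<in>Units Z. D (u \<otimes>\<^bsub>Z\<^esub> int c) = D (u \<otimes>\<^bsub>Z\<^esub> int c')) \<longleftrightarrow>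
    (\<forall>u. coprime u m \<longrightarrow> D (int (u * c mod m)) = D (int (u * c' mod m)))"
proof -
  interpret residues "int m" Z
    by unfold_locales (use assms in auto)
  have mult: "u \<otimes>\<^bsub>Z\<^esub> v = u * v mod int m" for u v by (rule res_mult_eq)
  show ?thesis
  proof safe
    fix u assume *: "\<forall>u\<in>Units Z. D (u \<otimes>\<^bsub>Z\<^esub> int c) = D (u \<otimes>\<^bsub>Z\<^esub> int c')" and u: "coprime u m"
    have cop: "coprime (u mod m) m" using u assms(1) by simp
    have "u mod m \<noteq> 0"
    proof
      assume "u mod m = 0"
      then show False using cop assms(1) by simp
    qed
    then have "int (u mod m) \<in> Units Z"
      unfolding res_units_eq using cop assms(1) by (simp del: of_nat_mod)
    moreover have "int (u mod m) \<otimes>\<^bsub>Z\<^esub> int d = int (u * d mod m)" for d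
      unfolding mult by (simp add: zmod_int mod_mult_left_eq)
    ultimately show "D (int (u * c mod m)) = D (int (u * c' mod m))" using * by metis
  next
    fix u assume *: "\<forall>u. coprime u m \<longrightarrow> D (int (u * c mod m)) = D (int (u * c' mod m))" and u: "u \<in> Units Z"
    then have "0 < u" "coprime u (int m)" unfolding res_units_eq by auto
    then obtain v where v: "u = int v" by (metis zero_less_imp_eq_int)
    then have "coprime v m" using \<open>coprime u (int m)\<close> by simp
    moreover have "u \<otimes>\<^bsub>Z\<^esub> int d = int (v * d mod m)" for d
      unfolding mult v by (simp add: zmod_int)
    ultimately show "D (u \<otimes>\<^bsub>Z\<^esub> int c) = D (u \<otimes>\<^bsub>Z\<^esub> int c')" using * by metis
  qed
qed

theorem proposition2p9:
  fixes p f q :: nat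
    and F :: "('a, 'b) ring_scheme"
    and \<zeta> :: complex
    and OL :: "complex ring"
    and P :: "complex set"
    and \<phi> :: "complex set \<Rightarrow> 'a"
    and \<omega> :: "'a \<Rightarrow> complex"
    and Z :: "int ring"
    and c c' :: int
    and \<chi> \<chi>' :: "'a \<Rightarrow> complex"
  assumes "Factorial_Ring.prime p" and "f \<ge> 1" and "p = 2 \<longrightarrow> f \<ge> 3" and "q = p ^ f"
    and "field F" and "Coset.order F = q"
    and "unity_roots p = {\<zeta> ^ k | k :: nat. True}"
    and "OL = ring_of_integers (cyclotomic (p * (q - 1)))"
    and "prime_over OL p P"
    and "\<phi> \<in> ring_iso (OL Quot P) F"
    and "\<omega> = teichmueller OL P \<phi> q"
    and "Z = residue_ring (int q - 1)"
    and "c \<in> carrier Z" and "c' \<in> carrier Z"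
    and "\<chi> = (\<lambda>a. \<omega> a powi (- c))" and "\<chi>' = (\<lambda>a. \<omega> a powi (- c'))"
  shows "gauss_sum F p f \<zeta> \<chi> = gauss_sum F p f \<zeta> \<chi>' \<longleftrightarrow>
    (\<forall>u\<in>Units Z. digit_sum p f (u \<otimes>\<^bsub>Z\<^esub> c) = digit_sum p f (u \<otimes>\<^bsub>Z\<^esub> c')) \<and>
    (if p = 2 then [digit_cyclic_corr p f c = digit_cyclic_corr p f c'] (mod 2)
     else [digit_fact_prod p f c = digit_fact_prod p f c'] (mod p))"
proof -
  have "q > 2"
  proof (cases "p = 2")
    case True
    then have "(2::nat) ^ 3 \<le> q" using assms(3,4) power_increasing[of 3 f "2::nat"] by simp
    then show ?thesis by simp
  next
    case False
    then have "2 < p" using prime_ge_2_nat[OF assms(1)] by simp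
    also have "p \<le> q" using assms(2,4) \<open>2 < p\<close> by (simp add: self_le_power)
    finally show ?thesis .
  qed
  interpret residue_field_iso p f q F \<zeta> OL P \<phi>
    by (intro residue_field_iso.intro) (fact assms \<open>q > 2\<close>)+
  have m: "int q - 1 = int (q - 1)" using \<open>q > 2\<close> by simp
  have Z: "Z = residue_ring (int (q - 1))" using assms(12) unfolding m .
  have "\<exists>d. e = int d \<and> d < q - 1" if "e \<in> carrier Z" for e
  proof -
    have "0 \<le> e" "e \<le> int (q - 1) - 1" using that unfolding Z residue_ring_def by auto
    then show ?thesis by (intro exI[of _ "nat e"]) linarith
  qed
  then obtain d d' where d: "c = int d" "d < q - 1" "c' = int d'" "d' < q - 1"
    using assms(13,14) by metis
  have G: "gauss_sum F p f \<zeta> \<chi> = G c" "gauss_sum F p f \<zeta> \<chi>' = G c'"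
    unfolding assms(11,15,16) by (rule gauss_sum_eq_G)+
  have "q - 1 > 1" using \<open>q > 2\<close> by simp
  from residue_ring_units_iff[OF this Z, of "digit_sum p f" d d']
  show ?thesis
    unfolding G d(1,3) using G_eq_iff[OF assms(3) d(2,4)] unfolding leading_cong_def by simp
qed

end
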